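(* Let $d\in\{1,2,3\}$ and let $\mathcal{D}\subset\mathbb{R}^d$ be a bounded domain. For every $N>0$ there exists at least one non-negative ground state for $e(\mathcal{D},N)$, i.e. a function $\varPhi\in H^1_0(\mathcal{D})$ with $\varPhi\ge 0$, $\int_{\mathcal{D}}|\varPhi|^2\,dx=N$ and $E(\varPhi)=e(\mathcal{D},N)$. Moreover, if $\mathcal{D}$ is a ball centered at the origin, then there exists at least one ground state for $e(\mathcal{D},N)$ that is non-negative, radially symmetric and decreasing (with respect to $|x|$).
   Context: For a domain $\mathcal{D}\subset\mathbb{R}^d$ and $N>0$, define $$E(\varPhi)=\frac12\int_{\mathcal{D}}|\nabla\varPhi|^2\,dx-\frac14\int_{\mathcal{D}}|\varPhi|^4\,dx+\frac16\int_{\mathcal{D}}|\varPhi|^6\,dx,$$ $$e(\mathcal{D},N)=\inf\Big\{E(\varPhi):\ \varPhi\in H^1_0(\mathcal{D}),\ \int_{\mathcal{D}}|\varPhi|^2\,dx=N\Big\}.$$ A (normalized) ground state for $e(\mathcal{D},N)$ is a minimizer of this problem. "Decreasing" is in the sense of symmetric-decreasing rearrangement, i.e. non-increasing in $|x|$. *)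

theory Defs
  imports "HOL-Analysis.Analysis"
begin

section \<open>Smooth functions and test functions\<close>

text \<open>Quantifying over all directions \<open>v\<close> rather than over a basis gives the same class, since
  the derivative is linear in \<open>v\<close>.\<close>

primrec C_k :: "nat \<Rightarrow> ('a::euclidean_space \<Rightarrow> 'b::real_normed_vector) \<Rightarrow> bool" where
  "C_k 0 f \<longleftrightarrow> continuous_on UNIV f"
| "C_k (Suc k) f \<longleftrightarrow>
     (\<forall>x. f differentiable (at x)) \<and> (\<forall>v. C_k k (\<lambda>x. frechet_derivative f (at x) v))"

definition smooth :: "('a::euclidean_space \<Rightarrow> 'b::real_normed_vector) \<Rightarrow> bool" where
  "smooth f \<longleftrightarrow> (\<forall>k. C_k k f)"

text \<open>The class \<open>C\<^sub>c\<^sup>\<infinity>(D)\<close>, each function being extended by zero to the whole space.\<close>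

definition test_function ::
  "'a::euclidean_space set \<Rightarrow> ('a \<Rightarrow> 'b::real_normed_vector) \<Rightarrow> bool" where
  "test_function D \<phi> \<longleftrightarrow>
     smooth \<phi> \<and> compact (closure {x. \<phi> x \<noteq> 0}) \<and> closure {x. \<phi> x \<noteq> 0} \<subseteq> D"


section \<open>Sobolev spaces on an open set\<close>

text \<open>Elements of the function spaces are represented by total functions of which only the
  values on \<open>D\<close> matter, up to null sets.\<close>

definition L2 :: "'a::euclidean_space set \<Rightarrow> ('a \<Rightarrow> complex) set" where
  "L2 D = {f. f \<in> borel_measurable (lebesgue_on D) \<and>
              integrable (lebesgue_on D) (\<lambda>x. (norm (f x))\<^sup>2)}"

definition is_weak_partial ::
  "'a::euclidean_space set \<Rightarrow> 'a \<Rightarrow> ('a \<Rightarrow> complex) \<Rightarrow> ('a \<Rightarrow> complex) \<Rightarrow> bool" where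
  "is_weak_partial D b u g \<longleftrightarrow>
     (\<forall>\<phi> :: 'a \<Rightarrow> real. test_function D \<phi> \<longrightarrow>
        (\<integral>x. frechet_derivative \<phi> (at x) b *\<^sub>R u x \<partial>lebesgue_on D) =
        - (\<integral>x. \<phi> x *\<^sub>R g x \<partial>lebesgue_on D))"

definition H1 :: "'a::euclidean_space set \<Rightarrow> ('a \<Rightarrow> complex) set" where
  "H1 D = {u \<in> L2 D. \<forall>b\<in>Basis. \<exists>g\<in>L2 D. is_weak_partial D b u g}"

text \<open>For \<open>u \<in> H1 D\<close> and \<open>b \<in> Basis\<close> the weak partial derivative is determined almost everywhere
  on \<open>D\<close>, so the choice below is immaterial under the integral sign.\<close>

definition weak_partial ::
  "'a::euclidean_space set \<Rightarrow> 'a \<Rightarrow> ('a \<Rightarrow> complex) \<Rightarrow> ('a \<Rightarrow> complex)" where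
  "weak_partial D b u = (SOME g. g \<in> L2 D \<and> is_weak_partial D b u g)"

definition grad_norm_sq ::
  "'a::euclidean_space set \<Rightarrow> ('a \<Rightarrow> complex) \<Rightarrow> 'a \<Rightarrow> real" where
  "grad_norm_sq D u x = (\<Sum>b\<in>Basis. (norm (weak_partial D b u x))\<^sup>2)"

definition H1_norm :: "'a::euclidean_space set \<Rightarrow> ('a \<Rightarrow> complex) \<Rightarrow> real" where
  "H1_norm D u =
     sqrt ((\<integral>x. (norm (u x))\<^sup>2 \<partial>lebesgue_on D) + (\<integral>x. grad_norm_sq D u x \<partial>lebesgue_on D))"

text \<open>The closure of \<open>C\<^sub>c\<^sup>\<infinity>(D)\<close> in \<open>H1 D\<close>.\<close>

definition H10 :: "'a::euclidean_space set \<Rightarrow> ('a \<Rightarrow> complex) set" where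
  "H10 D = {u \<in> H1 D. \<exists>\<phi> :: nat \<Rightarrow> 'a \<Rightarrow> complex.
     (\<forall>k. test_function D (\<phi> k)) \<and> (\<lambda>k. H1_norm D (\<lambda>x. u x - \<phi> k x)) \<longlonglongrightarrow> 0}"


section \<open>The cubic-quintic energy and its normalized ground states\<close>

text \<open>On a bounded domain in dimension at most three, the Sobolev embedding of
  \<open>H\<^sup>1\<^sub>0\<close> into \<open>L\<^sup>6\<close> makes all integrals below finite for \<open>\<Phi> \<in> H10 D\<close>.\<close>

definition energy :: "'a::euclidean_space set \<Rightarrow> ('a \<Rightarrow> complex) \<Rightarrow> real" where
  "energy D \<Phi> =
       1/2 * (\<integral>x. grad_norm_sq D \<Phi> x \<partial>lebesgue_on D)
     - 1/4 * (\<integral>x. (norm (\<Phi> x))^4 \<partial>lebesgue_on D)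
     + 1/6 * (\<integral>x. (norm (\<Phi> x))^6 \<partial>lebesgue_on D)"

definition admissible :: "'a::euclidean_space set \<Rightarrow> real \<Rightarrow> ('a \<Rightarrow> complex) set" where
  "admissible D N = {\<Phi> \<in> H10 D. (\<integral>x. (norm (\<Phi> x))\<^sup>2 \<partial>lebesgue_on D) = N}"

text \<open>The infimum is taken in the extended reals, where it is meaningful without knowing
  beforehand that the energy is bounded below.\<close>

definition min_energy :: "'a::euclidean_space set \<Rightarrow> real \<Rightarrow> ereal" where
  "min_energy D N = (INF \<Phi>\<in>admissible D N. ereal (energy D \<Phi>))"

definition ground_state :: "'a::euclidean_space set \<Rightarrow> real \<Rightarrow> ('a \<Rightarrow> complex) \<Rightarrow> bool" where
  "ground_state D N \<Phi> \<longleftrightarrow> \<Phi> \<in> admissible D N \<and> ereal (energy D \<Phi>) = min_energy D N"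

definition radially_symmetric_on :: "'a::euclidean_space set \<Rightarrow> ('a \<Rightarrow> real) \<Rightarrow> bool" where
  "radially_symmetric_on D u \<longleftrightarrow> (\<forall>x\<in>D. \<forall>y\<in>D. norm x = norm y \<longrightarrow> u x = u y)"

definition radially_decreasing_on :: "'a::euclidean_space set \<Rightarrow> ('a \<Rightarrow> real) \<Rightarrow> bool" where
  "radially_decreasing_on D u \<longleftrightarrow> (\<forall>x\<in>D. \<forall>y\<in>D. norm x \<le> norm y \<longrightarrow> u y \<le> u x)"

end

theory Submission
  imports Defs "HOL-Complex_Analysis.Great_Picard" "HOL-Library.Diagonal_Subsequence"
begin

text \<open>Replacing \<open>\<Phi>\<close> by \<open>|\<Phi>|\<close> does not increase the energy, so one may minimise over nonnegative real
  functions. For these, \<open>H\<^sup>1\<^sub>0\<close> and its Dirichlet integral are described by relaxation: \<open>u\<close> is an \<open>L\<^sup>2\<close> limit of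
  test functions whose Dirichlet integrals are asymptotically at most \<open>c\<close>. The pairs \<open>(u, c)\<close> with \<open>c\<close> bounded
  form a compact set in \<open>L\<^sup>2\<close> by Rellich's theorem, and adding \<open>3/32\<close> of the mass makes the nonlinear energy
  density nonnegative, so Fatou's lemma gives lower semicontinuity and the direct argument applies. The
  Sobolev embedding into \<open>L\<^sup>6\<close>, derived from the Loomis-Whitney inequality, makes all integrals finite.

  On a ball, rearrangement is replaced by polarization (two-point symmetrization) with respect to
  hyperplanes that have the centre strictly on the preferred side. It maps minimisers to minimisers. Among the
  minimisers choose one that maximises \<open>\<integral> u w\<close> for a strictly radially decreasing weight \<open>w\<close>; since
  every polarization increases this integral strictly unless it fixes \<open>u\<close>, the chosen \<open>u\<close> is
  fixed by all of them, and hence agrees almost everywhere with a radially decreasing function. This function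
  is finite at the origin because minimisers are bounded: cutting off at a high level and
  rescaling would otherwise lower the energy.\<close>

section \<open>Calculus of smooth functions\<close>

text \<open>The obstacle to the direct method is weak compactness in \<open>H10\<close>, and weak
  derivatives are awkward to truncate, reflect or compose. Both difficulties are met by carrying an
  upper bound c for the Dirichlet integral as a second variable: a limit of pairs (u, c) is again
  such a pair, so lower semicontinuity of the gradient term costs nothing, and every operation on u
  has to be carried out on smooth functions only. Weak derivatives come back only where a competitor
  is replaced by its modulus and where the minimiser is shown to lie in \<open>H10\<close>.

  Polarization fits this scheme because it is built from the absolute value alone, which has smooth
  approximations of slope at most one. Hyperplanes through the origin are excluded since reflecting
  in them leaves a radial weight unchanged; points of equal norm are therefore compared by a limit.
  Each hyperplane brings its own null set and there are uncountably many hyperplanes. Averages over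
  small balls turn the almost everywhere statements into inequalities at every point, after which a
  single null set remains.\<close>

lemma C_k_SucI:
  assumes "\<And>x. (f has_derivative D x) (at x)" "\<And>v. C_k k (\<lambda>x. D x v)"
  shows "C_k (Suc k) f"
proof -
  have "frechet_derivative f (at x) = D x" for x
    using frechet_derivative_at[OF assms(1)] by simp
  then show ?thesis
    using assms by (auto simp: differentiable_def)
qed

lemma C_k_Suc_has_derivative:
  "C_k (Suc k) f \<Longrightarrow> (f has_derivative frechet_derivative f (at x)) (at x)"
  by (simp add: frechet_derivative_works[symmetric])

lemma C_k_Suc_derivative: "C_k (Suc k) f \<Longrightarrow> C_k k (\<lambda>x. frechet_derivative f (at x) v)"
  by simp

lemma C_k_Suc_D: "C_k (Suc k) f \<Longrightarrow> C_k k f"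
proof (induction k arbitrary: f)
  case 0
  then show ?case
    by (auto intro!: differentiable_imp_continuous_on simp: differentiable_on_def differentiable_at_withinI)
next
  case (Suc k)
  have d: "\<forall>x. f differentiable (at x)" and s: "\<And>v. C_k (Suc k) (\<lambda>x. frechet_derivative f (at x) v)"
    using Suc.prems unfolding C_k.simps(2)[of "Suc k"] by blast+
  show ?case using d Suc.IH[OF s] by simp
qed

lemma C_k_const: "C_k k (\<lambda>x. c)"
proof (induction k arbitrary: c)
  case (Suc k)
  show ?case by (rule C_k_SucI[where D = "\<lambda>x v. 0"]) (use Suc in auto)
qed auto

lemma C_k_add: "C_k k f \<Longrightarrow> C_k k g \<Longrightarrow> C_k k (\<lambda>x. f x + g x)"
proof (induction k arbitrary: f g)
  case (Suc k)
  show ?case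
    by (rule C_k_SucI[OF has_derivative_add[OF C_k_Suc_has_derivative[OF Suc.prems(1)]
            C_k_Suc_has_derivative[OF Suc.prems(2)]]])
      (intro Suc.IH C_k_Suc_derivative Suc.prems)
qed (auto intro: continuous_intros)

lemma C_k_bounded_linear:
  assumes "bounded_linear L"
  shows "C_k k f \<Longrightarrow> C_k k (\<lambda>x. L (f x))"
proof (induction k arbitrary: f)
  case 0
  then show ?case using bounded_linear.continuous_on[OF assms] by auto
next
  case (Suc k)
  show ?case
    by (rule C_k_SucI[OF bounded_linear.has_derivative[OF assms C_k_Suc_has_derivative[OF Suc.prems]]])
      (intro Suc.IH C_k_Suc_derivative Suc.prems)
qed

lemma C_k_mult:
  fixes f g :: "'a::euclidean_space \<Rightarrow> real"
  shows "C_k k f \<Longrightarrow> C_k k g \<Longrightarrow> C_k k (\<lambda>x. f x * g x)"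
proof (induction k arbitrary: f g)
  case (Suc k)
  show ?case
    by (rule C_k_SucI[OF has_derivative_mult[OF C_k_Suc_has_derivative[OF Suc.prems(1)]
            C_k_Suc_has_derivative[OF Suc.prems(2)]]])
      (intro C_k_add Suc.IH C_k_Suc_derivative Suc.prems C_k_Suc_D[OF Suc.prems(1)] C_k_Suc_D[OF Suc.prems(2)])
qed (auto intro: continuous_intros)

lemma C_k_affine:
  fixes A :: "'a::euclidean_space \<Rightarrow> 'c::euclidean_space"
  assumes "bounded_linear A"
  shows "C_k k f \<Longrightarrow> C_k k (\<lambda>x. f (A x + t))"
proof (induction k arbitrary: f)
  case 0
  have "continuous_on UNIV (\<lambda>x. A x + t)"
    using bounded_linear.continuous_on[OF assms continuous_on_id] by (intro continuous_intros) auto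
  then show ?case using 0 continuous_on_compose2[of UNIV f UNIV "\<lambda>x. A x + t"] by auto
next
  case (Suc k)
  have A: "((\<lambda>x. A x + t) has_derivative A) (at x)" for x
    using has_derivative_add_const[OF bounded_linear_imp_has_derivative[OF assms]] by blast
  show ?case
    by (rule C_k_SucI[OF has_derivative_compose[OF A C_k_Suc_has_derivative[OF Suc.prems]]])
      (intro Suc.IH C_k_Suc_derivative Suc.prems)
qed

lemma C_k_linear: "bounded_linear A \<Longrightarrow> C_k k A"
proof (induction k)
  case 0
  then show ?case using bounded_linear.continuous_on[OF _ continuous_on_id] by auto
next
  case (Suc k)
  show ?case
    by (rule C_k_SucI[OF bounded_linear_imp_has_derivative[OF Suc.prems] C_k_const])
qed

lemma frechet_derivative_real:
  fixes h :: "real \<Rightarrow> real"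
  assumes "h differentiable (at s)"
  shows "frechet_derivative h (at s) v = frechet_derivative h (at s) 1 * v"
  using linear_cmul[OF linear_frechet_derivative[OF assms], of v 1] by (simp add: mult.commute)

lemma C_k_compose:
  fixes h :: "real \<Rightarrow> real" and f :: "'a::euclidean_space \<Rightarrow> real"
  shows "C_k k h \<Longrightarrow> C_k k f \<Longrightarrow> C_k k (\<lambda>x. h (f x))"
proof (induction k arbitrary: h f)
  case 0
  then show ?case using continuous_on_compose2[of UNIV h UNIV f] by auto
next
  case (Suc k)
  have "((\<lambda>x. h (f x)) has_derivative
      (\<lambda>v. frechet_derivative h (at (f x)) 1 * frechet_derivative f (at x) v)) (at x)" for x
    using has_derivative_compose[OF C_k_Suc_has_derivative[OF Suc.prems(2)]
        C_k_Suc_has_derivative[OF Suc.prems(1)], of x]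
    using Suc.prems(1) by (subst frechet_derivative_real[symmetric]) auto
  then show ?case
    by (rule C_k_SucI) (intro C_k_mult Suc.IH[OF C_k_Suc_derivative] C_k_Suc_derivative Suc.prems
        C_k_Suc_D[OF Suc.prems(2)])
qed

text \<open>The exponent is generalised in the induction because differentiation replaces a by a -
  1.\<close>

lemma C_k_powr:
  fixes f :: "'a::euclidean_space \<Rightarrow> real"
  shows "C_k k f \<Longrightarrow> (\<And>x. f x > 0) \<Longrightarrow> C_k k (\<lambda>x. f x powr a)"
proof (induction k arbitrary: a)
  case 0
  then show ?case by (auto intro!: continuous_intros simp: less_imp_neq[THEN not_sym])
next
  case (Suc k)
  have "((\<lambda>x. f x powr a) has_derivative
      (\<lambda>v. (a * f x powr (a - 1)) * frechet_derivative f (at x) v)) (at x)" for x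
    by (rule has_derivative_eq_rhs[OF has_derivative_powr[OF C_k_Suc_has_derivative[OF Suc.prems(1)] has_derivative_const]])
      (use Suc.prems(2)[of x] in \<open>auto simp: powr_diff field_simps\<close>)
  then show ?case
    by (rule C_k_SucI) (intro C_k_mult C_k_const Suc.IH C_k_Suc_derivative Suc.prems
        C_k_Suc_D[OF Suc.prems(1)])
qed

lemma C_k_sqrt:
  fixes f :: "'a::euclidean_space \<Rightarrow> real"
  assumes "C_k k f" "\<And>x. f x > 0" shows "C_k k (\<lambda>x. sqrt (f x))"
  using C_k_powr[OF assms, of "1/2"] assms(2) by (simp add: powr_half_sqrt less_imp_le)

text \<open>Meant for a smooth function multiplied by a sign that jumps across a hyperplane; the
  sign may be chosen differently at different points. The induction works because an equality valid
  near x is valid near every y close to x, so the derivatives satisfy the same alternative.\<close>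

lemma C_k_local_sign:
  assumes "C_k k f" "\<And>x. (\<forall>\<^sub>F y in nhds x. g y = f y) \<or> (\<forall>\<^sub>F y in nhds x. g y = - f y)"
  shows "C_k k g"
  using assms
proof (induction k arbitrary: f g)
  case 0
  have f: "continuous_on UNIV f" "continuous_on UNIV (\<lambda>x. - f x)"
    using 0 by (auto intro: continuous_intros)
  have "isCont g x" for x
    using 0(2)[of x] f by (auto simp: isCont_cong continuous_on_eq_continuous_at)
  then show ?case by (simp add: continuous_at_imp_continuous_on)
next
  case (Suc k)
  define G where "G x = (if (\<forall>\<^sub>F y in nhds x. g y = f y) then frechet_derivative f (at x)
    else (\<lambda>v. - frechet_derivative f (at x) v))" for x
  have pos: "(g has_derivative frechet_derivative f (at x)) (at x)" if "\<forall>\<^sub>F y in nhds x. g y = f y" for x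
    using that eventually_nhds_x_imp_x[OF that]
    by (intro has_derivative_transform_eventually[OF C_k_Suc_has_derivative[OF Suc.prems(1)]])
      (auto simp: eventually_at_filter elim: eventually_mono)
  have neg: "(g has_derivative (\<lambda>v. - frechet_derivative f (at x) v)) (at x)"
    if "\<forall>\<^sub>F y in nhds x. g y = - f y" for x
    using that eventually_nhds_x_imp_x[OF that]
    by (intro has_derivative_transform_eventually[OF has_derivative_minus[OF C_k_Suc_has_derivative[OF Suc.prems(1)]]])
      (auto simp: eventually_at_filter elim: eventually_mono)
  have D: "(g has_derivative G x) (at x)" for x
    using pos neg Suc.prems(2)[of x] by (auto simp: G_def)
  have G: "G x = frechet_derivative g (at x)" for x
    using frechet_derivative_at[OF D] .
  have "C_k k (\<lambda>x. G x v)" for v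
  proof (rule Suc.IH)
    show "C_k k (\<lambda>x. frechet_derivative f (at x) v)" using Suc.prems(1) by simp
    fix x
    consider "\<forall>\<^sub>F y in nhds x. \<forall>\<^sub>F z in nhds y. g z = f z" | "\<forall>\<^sub>F y in nhds x. \<forall>\<^sub>F z in nhds y. g z = - f z"
      using Suc.prems(2)[of x] by (auto simp: eventually_eventually)
    then show "(\<forall>\<^sub>F y in nhds x. G y v = frechet_derivative f (at y) v) \<or>
       (\<forall>\<^sub>F y in nhds x. G y v = - frechet_derivative f (at y) v)"
    proof cases
      case 1
      then have "\<forall>\<^sub>F y in nhds x. G y v = frechet_derivative f (at y) v"
        by eventually_elim (simp add: G frechet_derivative_at[OF pos])
      then show ?thesis ..
    next
      case 2
      then have "\<forall>\<^sub>F y in nhds x. G y v = - frechet_derivative f (at y) v"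
        by eventually_elim (use G frechet_derivative_at[OF neg] in metis)
      then show ?thesis ..
    qed
  qed
  with D show ?case by (rule C_k_SucI)
qed

section \<open>Closure properties of smooth functions\<close>

lemma smooth_const: "smooth (\<lambda>x. c)"
  by (simp add: smooth_def C_k_const)

lemma smooth_add: "smooth f \<Longrightarrow> smooth g \<Longrightarrow> smooth (\<lambda>x. f x + g x)"
  by (simp add: smooth_def C_k_add)

lemma smooth_bounded_linear: "bounded_linear L \<Longrightarrow> smooth f \<Longrightarrow> smooth (\<lambda>x. L (f x))"
  by (simp add: smooth_def C_k_bounded_linear)

lemma smooth_diff: "smooth f \<Longrightarrow> smooth g \<Longrightarrow> smooth (\<lambda>x. f x - g x)"
  using smooth_add[of f "\<lambda>x. - g x"] smooth_bounded_linear[OF bounded_linear_minus[OF bounded_linear_ident]]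
  by auto

lemma smooth_mult:
  fixes f g :: "'a::euclidean_space \<Rightarrow> real"
  shows "smooth f \<Longrightarrow> smooth g \<Longrightarrow> smooth (\<lambda>x. f x * g x)"
  by (simp add: smooth_def C_k_mult)

lemma smooth_prod:
  fixes f :: "'i \<Rightarrow> 'a::euclidean_space \<Rightarrow> real"
  assumes "finite I" "\<And>i. i \<in> I \<Longrightarrow> smooth (f i)"
  shows "smooth (\<lambda>x. \<Prod>i\<in>I. f i x)"
  using assms by (induction I) (auto intro: smooth_const smooth_mult)

lemma smooth_compose:
  fixes h :: "real \<Rightarrow> real" and f :: "'a::euclidean_space \<Rightarrow> real"
  shows "smooth h \<Longrightarrow> smooth f \<Longrightarrow> smooth (\<lambda>x. h (f x))"
  by (simp add: smooth_def C_k_compose)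

lemma smooth_sqrt:
  fixes f :: "'a::euclidean_space \<Rightarrow> real"
  assumes "smooth f" "\<And>x. f x > 0" shows "smooth (\<lambda>x. sqrt (f x))"
  using assms by (simp add: smooth_def C_k_sqrt)

lemma smooth_affine:
  fixes A :: "'a::euclidean_space \<Rightarrow> 'c::euclidean_space"
  shows "bounded_linear A \<Longrightarrow> smooth f \<Longrightarrow> smooth (\<lambda>x. f (A x + t))"
  by (simp add: smooth_def C_k_affine)

lemma smooth_linear: "bounded_linear A \<Longrightarrow> smooth A"
  by (simp add: smooth_def C_k_linear)

lemma smooth_local_sign:
  assumes "smooth f" "\<And>x. (\<forall>\<^sub>F y in nhds x. g y = f y) \<or> (\<forall>\<^sub>F y in nhds x. g y = - f y)"
  shows "smooth g"
  using assms C_k_local_sign unfolding smooth_def by blast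

lemma smooth_has_derivative:
  "smooth f \<Longrightarrow> (f has_derivative frechet_derivative f (at x)) (at x)"
  using C_k_Suc_has_derivative[of 0 f] unfolding smooth_def by blast

lemma smooth_derivative: "smooth f \<Longrightarrow> smooth (\<lambda>x. frechet_derivative f (at x) v)"
  unfolding smooth_def using C_k_Suc_derivative by blast

lemma smooth_continuous: "smooth f \<Longrightarrow> continuous_on UNIV f"
  unfolding smooth_def using C_k.simps(1) by blast

lemma smooth_differentiable: "smooth f \<Longrightarrow> f differentiable (at x)"
  using smooth_has_derivative differentiable_def by blast

subsection \<open>The flat function\<close>

text \<open>The classical function exp (-1/s) and its multiples by powers of 1/s. The derivative of
  a member is a linear combination of two later members, so smoothness of the whole family follows
  by one induction.\<close>

definition flat :: "nat \<Rightarrow> real \<Rightarrow> real" where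
  "flat n s = (if s > 0 then inverse s ^ n * exp (- inverse s) else 0)"

lemma flat_tendsto_0: "(flat n \<longlongrightarrow> 0) (at 0)"
proof -
  have "((\<lambda>y::real. y ^ n / exp y) \<longlongrightarrow> 0) at_top"
    by (rule tendsto_power_div_exp_0)
  then have "((\<lambda>s::real. inverse s ^ n / exp (inverse s)) \<longlongrightarrow> 0) (at_right 0)"
    by (rule filterlim_compose) (rule filterlim_inverse_at_top_right)
  then have "(flat n \<longlongrightarrow> 0) (at_right 0)"
    by (rule Lim_transform_eventually)
      (auto simp: flat_def eventually_at_filter exp_minus divide_inverse)
  moreover have "(flat n \<longlongrightarrow> 0) (at_left 0)"
    by (rule tendsto_eventually) (auto simp: flat_def eventually_at_filter)
  ultimately show ?thesis by (simp add: filterlim_split_at)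
qed

lemma flat_has_derivative:
  "(flat n has_real_derivative (flat (n + 2) s - n * flat (n + 1) s)) (at s)"
proof (cases "s = 0")
  case True
  \<comment> \<open>At 0 the difference quotient of \<open>flat n\<close> is the next member of the
    family, which tends to 0.\<close>
  have "(\<lambda>h. (flat n (0 + h) - flat n 0) / h) = flat (Suc n)"
    by (auto simp: flat_def divide_inverse)
  then show ?thesis
    using flat_tendsto_0[of "Suc n"] True by (simp add: DERIV_def flat_def)
next
  case False
  show ?thesis
  proof (cases "s > 0")
    case True
    have "((\<lambda>s. inverse s ^ n * exp (- inverse s)) has_real_derivative
        (n * (- (inverse s ^ 2)) * inverse s ^ (n - 1)) * exp (- inverse s)
        + exp (- inverse s) * inverse s ^ 2 * inverse s ^ n) (at s)"
      using True by (auto intro!: derivative_eq_intros simp: power2_eq_square)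
    also have "(n * (- (inverse s ^ 2)) * inverse s ^ (n - 1)) * exp (- inverse s)
        + exp (- inverse s) * inverse s ^ 2 * inverse s ^ n = flat (n + 2) s - n * flat (n + 1) s"
      using True by (cases n) (simp_all add: flat_def algebra_simps power2_eq_square)
    finally have "((\<lambda>s. inverse s ^ n * exp (- inverse s)) has_real_derivative
        (flat (n + 2) s - n * flat (n + 1) s)) (at s)" .
    moreover have "\<forall>\<^sub>F x in nhds s. flat n x = inverse x ^ n * exp (- inverse x)"
      using eventually_nhds_in_open[of "{0<..}" s] True
      by (auto elim!: eventually_mono simp: flat_def)
    ultimately show ?thesis by (subst DERIV_cong_ev[OF refl _ refl])
  next
    case neg: False
    have "\<forall>\<^sub>F x in nhds s. flat n x = 0"
      using eventually_nhds_in_open[of "{..<0}" s] neg \<open>s \<noteq> 0\<close>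
      by (auto elim!: eventually_mono simp: flat_def)
    then show ?thesis
      using neg by (subst DERIV_cong_ev[OF refl _ refl]) (auto simp: flat_def)
  qed
qed

lemma smooth_flat: "smooth (flat n)"
proof -
  have "C_k k (flat n)" for k
  proof (induction k arbitrary: n)
    case 0
    show ?case using DERIV_isCont[OF flat_has_derivative] by (auto intro!: continuous_at_imp_continuous_on)
  next
    case (Suc k)
    have "(flat n has_derivative (\<lambda>v. v *\<^sub>R (flat (n + 2) s + (- real n) * flat (n + 1) s))) (at s)" for s
      using flat_has_derivative[of n s] by (simp add: has_field_derivative_def mult.commute[of _ "_ - _"])
    then show ?case
      by (rule C_k_SucI)
        (intro C_k_bounded_linear[OF bounded_linear_scaleR_right] C_k_add C_k_mult C_k_const Suc)
  qed
  then show ?thesis by (simp add: smooth_def)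
qed

lemma flat0_bounds: "0 \<le> flat 0 s" "flat 0 s \<le> 1" "flat 0 s > 0 \<longleftrightarrow> s > 0" "s \<le> 0 \<Longrightarrow> flat 0 s = 0"
  by (auto simp: flat_def)

text \<open>A smooth substitute for \<open>max s 0\<close>: with \<open>y = e / s\<close> its derivative is \<open>(1 + y) exp (-y)\<close>, which lies
  between \<open>0\<close> and \<open>1\<close>.\<close>

definition spos :: "real \<Rightarrow> real \<Rightarrow> real" where
  "spos e s = s * flat 0 (s / e)"

lemma smooth_spos: "smooth (spos e)"
  using smooth_mult[OF smooth_linear[OF bounded_linear_ident] smooth_affine[OF bounded_linear_divide smooth_flat[of 0], where t=0]]
  by (simp add: spos_def[abs_def])

lemma spos_nonpos [simp]: "e > 0 \<Longrightarrow> s \<le> 0 \<Longrightarrow> spos e s = 0"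
  by (auto simp: spos_def flat_def zero_less_divide_iff)

lemma spos_bounds:
  assumes "e > 0"
  shows "0 \<le> spos e s" "spos e s \<le> max s 0" "max s 0 - e \<le> spos e s"
proof -
  have *: "s * flat 0 (s/e) \<le> s" "s - e \<le> s * flat 0 (s/e)" "0 \<le> s * flat 0 (s/e)" if "s > 0"
  proof -
    show "s * flat 0 (s/e) \<le> s" using that flat0_bounds[of "s/e"] mult_left_mono[of "flat 0 (s/e)" 1 s] by simp
    \<comment> \<open>This yields s exp (-e/s) \<ge> s - e, so \<open>spos e\<close> stays within e
      of the positive part.\<close>
    have "1 + (- (e / s)) \<le> exp (- (e / s))" by (rule exp_ge_add_one_self)
    then have "s * (1 + (- (e / s))) \<le> s * exp (- (e / s))" using that by (intro mult_left_mono) auto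
    then show "s - e \<le> s * flat 0 (s/e)" using that assms by (simp add: flat_def distrib_left right_diff_distrib)
  qed (use that flat0_bounds in auto)
  show "0 \<le> spos e s" "spos e s \<le> max s 0" "max s 0 - e \<le> spos e s"
  proof (atomize (full), cases "s > 0")
    case True
    then show "0 \<le> spos e s \<and> spos e s \<le> max s 0 \<and> max s 0 - e \<le> spos e s"
      using * unfolding spos_def by (metis max.absorb1 less_imp_le)
  next
    case False
    then show "0 \<le> spos e s \<and> spos e s \<le> max s 0 \<and> max s 0 - e \<le> spos e s"
      using assms by simp
  qed
qed

lemma spos_derivative_bounds:
  assumes "e > 0"
  shows "0 \<le> frechet_derivative (spos e) (at s) 1" "frechet_derivative (spos e) (at s) 1 \<le> 1"
proof -
  have "((\<lambda>s. s * flat 0 (s / e)) has_real_derivative flat 0 (s/e) + s * (flat 2 (s/e) * (1 / e))) (at s)"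
    using DERIV_mult[OF DERIV_ident DERIV_chain2[OF flat_has_derivative[of 0 "s/e"] DERIV_cdivide[OF DERIV_ident]]]
    by (simp add: eval_nat_numeral ac_simps)
  then have "frechet_derivative (spos e) (at s) = (*) (flat 0 (s/e) + s * (flat 2 (s/e) * (1 / e)))"
    unfolding has_field_derivative_def spos_def[abs_def] by (rule frechet_derivative_at[symmetric])
  then have eq: "frechet_derivative (spos e) (at s) 1 = flat 0 (s/e) + (s/e) * flat 2 (s/e)"
    by simp
  show "0 \<le> frechet_derivative (spos e) (at s) 1"
    unfolding eq using assms by (auto simp: flat_def zero_less_divide_iff)
  show "frechet_derivative (spos e) (at s) 1 \<le> 1"
  proof (cases "s > 0")
    case True
    define y where "y = e / s"
    have "flat 0 (s/e) + (s/e) * flat 2 (s/e) = (1 + y) * exp (- y)"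
      using True assms by (simp add: flat_def y_def field_simps power2_eq_square)
    also have "\<dots> \<le> exp y * exp (- y)" by (intro mult_right_mono exp_ge_add_one_self) auto
    finally show ?thesis unfolding eq by (simp add: exp_minus)
  qed (use assms in \<open>auto simp: eq flat_def zero_less_divide_iff\<close>)
qed

section \<open>Square-integrable functions\<close>

text \<open>Measure and codomain are left general because both \<open>lborel\<close> and
  \<open>lebesgue_on D\<close>, and both real and complex functions, occur below.\<close>

definition sqint :: "'x measure \<Rightarrow> ('x \<Rightarrow> 'b::{banach,second_countable_topology}) \<Rightarrow> bool" where
  "sqint M f \<longleftrightarrow> f \<in> borel_measurable M \<and> integrable M (\<lambda>x. (norm (f x))\<^sup>2)"

definition l2 :: "'x measure \<Rightarrow> ('x \<Rightarrow> 'b::{banach,second_countable_topology}) \<Rightarrow> real" where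
  "l2 M f = sqrt (\<integral>x. (norm (f x))\<^sup>2 \<partial>M)"

lemma sqint_borel [measurable_dest]: "sqint M f \<Longrightarrow> f \<in> borel_measurable M"
  and sqint_integrable: "sqint M f \<Longrightarrow> integrable M (\<lambda>x. (norm (f x))\<^sup>2)"
  by (auto simp: sqint_def)

lemma l2_nonneg [simp]: "0 \<le> l2 M f"
  by (simp add: l2_def)

lemma l2_sq: "(l2 M f)\<^sup>2 = (\<integral>x. (norm (f x))\<^sup>2 \<partial>M)"
  by (simp add: l2_def integral_nonneg_AE)

lemma sqint_bound:
  assumes "g \<in> borel_measurable M" "integrable M h" "\<And>x. x \<in> space M \<Longrightarrow> (norm (g x))\<^sup>2 \<le> h x"
  shows "sqint M g"
  unfolding sqint_def
proof (intro conjI)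
  note [measurable] = assms(1)
  show "integrable M (\<lambda>x. (norm (g x))\<^sup>2)"
    by (rule Bochner_Integration.integrable_bound[OF assms(2)]) (auto intro!: AE_I2 order.trans[OF assms(3)])
qed fact

section \<open>Cauchy-Schwarz and triangle inequalities\<close>

lemma sqint_mult_integrable:
  assumes [measurable]: "sqint M f" "sqint M g"
  shows "integrable M (\<lambda>x. norm (f x) * norm (g x))"
proof (rule Bochner_Integration.integrable_bound)
  show "integrable M (\<lambda>x. (norm (f x))\<^sup>2 + (norm (g x))\<^sup>2)"
    using assms by (intro Bochner_Integration.integrable_add sqint_integrable)
  have "norm (f x) * norm (g x) \<le> (norm (f x))\<^sup>2 + (norm (g x))\<^sup>2" for x
  proof -
    have "2 * (norm (f x) * norm (g x)) \<le> (norm (f x))\<^sup>2 + (norm (g x))\<^sup>2"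
      using sum_squares_bound[of "norm (f x)" "norm (g x)"] by (simp add: mult.assoc)
    moreover have "0 \<le> norm (f x) * norm (g x)" by simp
    ultimately show ?thesis by linarith
  qed
  then show "AE x in M. norm (norm (f x) * norm (g x)) \<le> norm ((norm (f x))\<^sup>2 + (norm (g x))\<^sup>2)"
    by simp
qed measurable

lemma cauchy_schwarz:
  assumes [measurable]: "sqint M f" "sqint M g"
  shows "(\<integral>x. norm (f x) * norm (g x) \<partial>M) \<le> l2 M f * l2 M g"
proof -
  have "(ennreal (\<integral>x. norm (f x) * norm (g x) \<partial>M))\<^sup>2 = (\<integral>\<^sup>+x. ennreal (norm (f x)) * ennreal (norm (g x)) \<partial>M)\<^sup>2"
    by (subst nn_integral_eq_integral[symmetric])
      (auto intro!: sqint_mult_integrable assms simp: ennreal_mult)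
  also have "\<dots> \<le> (\<integral>\<^sup>+x. ennreal (norm (f x)) ^ 2 \<partial>M) * (\<integral>\<^sup>+x. ennreal (norm (g x)) ^ 2 \<partial>M)"
    by (rule Cauchy_Schwarz_nn_integral) auto
  also have "(\<integral>\<^sup>+x. ennreal (norm (f x)) ^ 2 \<partial>M) = ennreal ((l2 M f)\<^sup>2)"
    by (simp add: ennreal_power l2_sq nn_integral_eq_integral sqint_integrable assms)
  also have "(\<integral>\<^sup>+x. ennreal (norm (g x)) ^ 2 \<partial>M) = ennreal ((l2 M g)\<^sup>2)"
    by (simp add: ennreal_power l2_sq nn_integral_eq_integral sqint_integrable assms)
  also have "ennreal ((l2 M f)\<^sup>2) * ennreal ((l2 M g)\<^sup>2) = ennreal ((l2 M f * l2 M g)\<^sup>2)"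
    by (simp add: ennreal_mult[symmetric] power_mult_distrib)
  finally have "(\<integral>x. norm (f x) * norm (g x) \<partial>M)\<^sup>2 \<le> (l2 M f * l2 M g)\<^sup>2"
    by (subst (asm) ennreal_power) (auto simp: integral_nonneg_AE)
  then show ?thesis by (rule power2_le_imp_le) simp
qed

lemma sqint_add:
  assumes [measurable]: "sqint M f" "sqint M g" shows "sqint M (\<lambda>x. f x + g x)"
proof (rule sqint_bound)
  show "integrable M (\<lambda>x. 2 * (norm (f x))\<^sup>2 + 2 * (norm (g x))\<^sup>2)"
    using assms by (intro Bochner_Integration.integrable_add integrable_mult_right sqint_integrable)
  fix x
  have "(norm (f x + g x))\<^sup>2 \<le> (norm (f x) + norm (g x))\<^sup>2"
    by (intro power_mono norm_triangle_ineq) auto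
  also have "\<dots> \<le> 2 * (norm (f x))\<^sup>2 + 2 * (norm (g x))\<^sup>2"
    using sum_squares_bound[of "norm (f x)" "norm (g x)"] by (simp add: power2_sum)
  finally show "(norm (f x + g x))\<^sup>2 \<le> 2 * (norm (f x))\<^sup>2 + 2 * (norm (g x))\<^sup>2" .
qed measurable

lemma sqint_scaleR:
  assumes [measurable]: "sqint M f" shows "sqint M (\<lambda>x. c *\<^sub>R f x)"
  by (rule sqint_bound[where h = "\<lambda>x. c\<^sup>2 * (norm (f x))\<^sup>2"])
    (auto intro!: integrable_mult_right sqint_integrable assms simp: power_mult_distrib)

lemma sqint_minus: "sqint M f \<Longrightarrow> sqint M (\<lambda>x. - f x)"
  using sqint_scaleR[of M f "-1"] by simp

lemma sqint_diff: "sqint M f \<Longrightarrow> sqint M g \<Longrightarrow> sqint M (\<lambda>x. f x - g x)"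
  using sqint_add[OF _ sqint_minus, of M f g] by simp

lemma sqint_zero: "sqint M (\<lambda>x. 0)"
  by (simp add: sqint_def)

lemma l2_triangle:
  assumes [measurable]: "sqint M f" "sqint M g"
  shows "l2 M (\<lambda>x. f x + g x) \<le> l2 M f + l2 M g"
proof -
  have "(l2 M (\<lambda>x. f x + g x))\<^sup>2 \<le> (\<integral>x. (norm (f x))\<^sup>2 + 2 * (norm (f x) * norm (g x)) + (norm (g x))\<^sup>2 \<partial>M)"
    unfolding l2_sq
  proof (rule integral_mono)
    show "(norm (f x + g x))\<^sup>2 \<le> (norm (f x))\<^sup>2 + 2 * (norm (f x) * norm (g x)) + (norm (g x))\<^sup>2" for x
      using power_mono[OF norm_triangle_ineq[of "f x" "g x"], of 2] by (simp add: power2_sum algebra_simps)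
  qed (intro sqint_integrable sqint_add Bochner_Integration.integrable_add integrable_mult_right
        sqint_mult_integrable assms)+
  also have "\<dots> = (l2 M f)\<^sup>2 + 2 * (\<integral>x. norm (f x) * norm (g x) \<partial>M) + (l2 M g)\<^sup>2"
    unfolding l2_sq using assms
    by (simp add: Bochner_Integration.integral_add Bochner_Integration.integrable_add integrable_mult_right
        sqint_mult_integrable sqint_integrable)
  also have "\<dots> \<le> (l2 M f + l2 M g)\<^sup>2"
    using cauchy_schwarz[OF assms] by (simp add: power2_sum)
  finally show ?thesis by (rule power2_le_imp_le) simp
qed

lemma l2_scaleR: "l2 M (\<lambda>x. c *\<^sub>R f x) = \<bar>c\<bar> * l2 M f"
  by (simp add: l2_def power_mult_distrib real_sqrt_mult)

lemma l2_diff_commute: "l2 M (\<lambda>x. f x - g x) = l2 M (\<lambda>x. g x - f x)"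
  by (simp add: l2_def norm_minus_commute)

lemma l2_triangle_diff:
  assumes "sqint M f" "sqint M g" "sqint M h"
  shows "l2 M (\<lambda>x. f x - h x) \<le> l2 M (\<lambda>x. f x - g x) + l2 M (\<lambda>x. g x - h x)"
  using l2_triangle[OF sqint_diff[OF assms(1,2)] sqint_diff[OF assms(2,3)]] by simp

lemma l2_diff_triangle:
  assumes "sqint M f" "sqint M g"
  shows "\<bar>l2 M f - l2 M g\<bar> \<le> l2 M (\<lambda>x. f x - g x)"
  using l2_triangle[OF sqint_diff[OF assms] assms(2)] l2_triangle[OF sqint_diff[OF assms(2,1)] assms(1)]
  by (simp add: l2_diff_commute[of M f g])

lemma l2_mono:
  assumes "sqint M f" "sqint M g" "AE x in M. norm (f x) \<le> norm (g x)"
  shows "l2 M f \<le> l2 M g"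
  unfolding l2_def
  by (intro real_sqrt_le_mono integral_mono_AE sqint_integrable assms)
    (use assms(3) in eventually_elim, simp add: power_mono)

lemma l2_cong_AE:
  assumes "f \<in> borel_measurable M" "g \<in> borel_measurable M" "AE x in M. f x = g x"
  shows "l2 M f = l2 M g"
proof -
  note [measurable] = assms(1,2)
  have "(\<integral>x. (norm (f x))\<^sup>2 \<partial>M) = (\<integral>x. (norm (g x))\<^sup>2 \<partial>M)"
    by (rule integral_cong_AE) (use assms(3) in auto)
  then show ?thesis by (simp add: l2_def)
qed

lemma l2_tendsto:
  assumes "\<And>n. sqint M (f n)" "sqint M g" "(\<lambda>n. l2 M (\<lambda>x. f n x - g x)) \<longlonglongrightarrow> 0"
  shows "(\<lambda>n. l2 M (f n)) \<longlonglongrightarrow> l2 M g"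
proof -
  have "(\<lambda>n. l2 M (f n) - l2 M g) \<longlonglongrightarrow> 0"
    by (rule Lim_null_comparison[OF _ assms(3)]) (use l2_diff_triangle[OF assms(1,2)] in simp)
  then show ?thesis by (simp add: LIM_zero_iff)
qed

section \<open>Almost everywhere convergence and completeness\<close>

lemma l2_AE_subseq:
  fixes f :: "nat \<Rightarrow> 'x \<Rightarrow> 'b::{banach,second_countable_topology}"
  assumes "\<And>n. sqint M (f n)" "sqint M g" "(\<lambda>n. l2 M (\<lambda>x. f n x - g x)) \<longlonglongrightarrow> 0"
  obtains r :: "nat \<Rightarrow> nat" where "strict_mono r" "AE x in M. (\<lambda>n. f (r n) x) \<longlonglongrightarrow> g x"
proof -
  have "(\<lambda>n. \<integral>x. norm ((norm (f n x - g x))\<^sup>2) \<partial>M) \<longlonglongrightarrow> 0"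
    using tendsto_power[OF assms(3), of 2] by (simp add: l2_sq)
  then obtain r :: "nat \<Rightarrow> nat" where r: "strict_mono r" "AE x in M. (\<lambda>n. (norm (f (r n) x - g x))\<^sup>2) \<longlonglongrightarrow> 0"
    using tendsto_L1_AE_subseq[of M "\<lambda>n x. (norm (f n x - g x))\<^sup>2"] sqint_integrable[OF sqint_diff[OF assms(1,2)]]
    by auto
  have "AE x in M. (\<lambda>n. f (r n) x) \<longlonglongrightarrow> g x"
    using r(2)
  proof eventually_elim
    case (elim x)
    have "(\<lambda>n. norm (f (r n) x - g x)) \<longlonglongrightarrow> 0"
      using tendsto_real_sqrt[OF elim] by simp
    then show ?case using tendsto_norm_zero_iff LIM_zero_iff by blast
  qed
  with r(1) show thesis by (rule that)
qed

text \<open>Riesz-Fischer. Along a subsequence whose steps have norm below 2^-k, the weighted sum of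
  2^k times the squared increments has finite integral. Where it is finite, the increments decay
  like 2^(-k/2), so the subsequence converges there. Fatou's lemma then gives norm convergence of
  the full sequence.\<close>

lemma l2_complete:
  fixes f :: "nat \<Rightarrow> 'x \<Rightarrow> 'b::{banach,second_countable_topology}"
  assumes sq: "\<And>n. sqint M (f n)"
    and cauchy: "\<And>e. e > 0 \<Longrightarrow> \<exists>N. \<forall>m\<ge>N. \<forall>n\<ge>N. l2 M (\<lambda>x. f m x - f n x) < e"
  obtains g where "sqint M g" "(\<lambda>n. l2 M (\<lambda>x. f n x - g x)) \<longlonglongrightarrow> 0"
proof -
  note [measurable] = sqint_borel[OF sq]
  have "\<exists>N. \<forall>k. strict_mono N \<and> (\<forall>m\<ge>N k. \<forall>n\<ge>N k. l2 M (\<lambda>x. f m x - f n x) < (1/2) ^ k)"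
  proof -
    have "\<exists>N. \<forall>k. (\<forall>m\<ge>N k. \<forall>n\<ge>N k. l2 M (\<lambda>x. f m x - f n x) < (1/2) ^ k) \<and> N k < N (Suc k)"
    proof (rule dependent_nat_choice)
      show "\<exists>N. \<forall>m\<ge>N. \<forall>n\<ge>N. l2 M (\<lambda>x. f m x - f n x) < (1/2) ^ 0" by (rule cauchy) simp
      fix N k
      obtain N' where "\<forall>m\<ge>N'. \<forall>n\<ge>N'. l2 M (\<lambda>x. f m x - f n x) < (1/2) ^ Suc k"
        using cauchy[of "(1/2) ^ Suc k"] by auto
      then show "\<exists>N'. (\<forall>m\<ge>N'. \<forall>n\<ge>N'. l2 M (\<lambda>x. f m x - f n x) < (1/2) ^ Suc k) \<and> N < N'"
        by (intro exI[of _ "max N' (Suc N)"]) auto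
    qed
    then show ?thesis by (meson strict_mono_Suc_iff)
  qed
  then obtain r where r: "strict_mono r" "\<And>k m n. m \<ge> r k \<Longrightarrow> n \<ge> r k \<Longrightarrow> l2 M (\<lambda>x. f m x - f n x) < (1/2) ^ k"
    by blast
  define d where "d k x = norm (f (r (Suc k)) x - f (r k) x)" for k x
  have [measurable]: "d k \<in> borel_measurable M" for k unfolding d_def by measurable
  have "(\<integral>\<^sup>+x. (\<Sum>k. ennreal (2 ^ k * (d k x)\<^sup>2)) \<partial>M) = (\<Sum>k. \<integral>\<^sup>+x. ennreal (2 ^ k * (d k x)\<^sup>2) \<partial>M)"
    by (rule nn_integral_suminf) measurable
  also have "\<dots> \<le> (\<Sum>k. ennreal ((1/2) ^ k))"
  proof (intro suminf_le summableI)
    fix k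
    have sqd: "integrable M (\<lambda>x. (d k x)\<^sup>2)"
      unfolding d_def by (intro sqint_integrable sqint_diff sq)
    have "(l2 M (\<lambda>x. f (r (Suc k)) x - f (r k) x))\<^sup>2 \<le> ((1/2) ^ k)\<^sup>2"
      using r(2)[of k "r (Suc k)" "r k"] strict_monoD[OF r(1), of k "Suc k"]
      by (intro power_mono) (auto intro: less_imp_le)
    then have "2 ^ k * (\<integral>x. (d k x)\<^sup>2 \<partial>M) \<le> 2 ^ k * ((1/2) ^ k)\<^sup>2"
      by (simp add: l2_sq d_def)
    also have "\<dots> = (1/2::real) ^ k" by (simp add: power2_eq_square power_one_over)
    finally have "2 ^ k * (\<integral>x. (d k x)\<^sup>2 \<partial>M) \<le> (1/2) ^ k" .
    then have "ennreal (\<integral>x. 2 ^ k * (d k x)\<^sup>2 \<partial>M) \<le> ennreal ((1/2) ^ k)" by (simp add: ennreal_leI)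
    moreover have "integrable M (\<lambda>x. 2 ^ k * (d k x)\<^sup>2)" using sqd by simp
    ultimately show "(\<integral>\<^sup>+x. ennreal (2 ^ k * (d k x)\<^sup>2) \<partial>M) \<le> ennreal ((1/2) ^ k)"
      by (subst nn_integral_eq_integral) auto
  qed
  also have "\<dots> < \<infinity>"
    by (subst suminf_ennreal2) (auto intro: summable_geometric)
  finally have "AE x in M. (\<Sum>k. ennreal (2 ^ k * (d k x)\<^sup>2)) \<noteq> \<infinity>"
    by (intro nn_integral_PInf_AE) auto
  then have conv: "AE x in M. convergent (\<lambda>k. f (r k) x)"
  proof eventually_elim
    case (elim x)
    have "summable (\<lambda>k. 2 ^ k * (d k x)\<^sup>2)"
      using elim by (intro summable_suminf_not_top) auto
    then have "Bseq (\<lambda>k. 2 ^ k * (d k x)\<^sup>2)"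
      using summable_LIMSEQ_zero convergent_def convergent_imp_Bseq by blast
    then obtain C where C: "C > 0" "\<And>k. norm (2 ^ k * (d k x)\<^sup>2) \<le> C" by (auto elim: BseqE)
    have "norm (d k x) \<le> sqrt C * (1 / sqrt 2) ^ k" for k
    proof -
      have "(d k x)\<^sup>2 \<le> C / 2 ^ k" using C(2)[of k] by (simp add: field_simps)
      then have "sqrt ((d k x)\<^sup>2) \<le> sqrt (C / 2 ^ k)" by (rule real_sqrt_le_mono)
      moreover have "sqrt ((d k x)\<^sup>2) = d k x" by (simp add: d_def)
      ultimately show ?thesis by (simp add: real_sqrt_divide real_sqrt_power power_one_over d_def)
    qed
    then have "summable (\<lambda>k. d k x)"
      by (intro summable_comparison_test[OF _ summable_mult[OF summable_geometric, of "1 / sqrt 2" "sqrt C"]])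
        (auto intro!: exI[of _ 0])
    then have "summable (\<lambda>k. f (r (Suc k)) x - f (r k) x)"
      unfolding d_def by (rule summable_norm_cancel)
    then have "convergent (\<lambda>k. \<Sum>i<k. f (r (Suc i)) x - f (r i) x)"
      by (simp add: summable_iff_convergent)
    then have "convergent (\<lambda>k. f (r k) x - f (r 0) x)"
      by (simp add: sum_lessThan_telescope[of "\<lambda>k. f (r k) x"])
    then show ?case
      using convergent_add[OF _ convergent_const, of "\<lambda>k. f (r k) x - f (r 0) x" "f (r 0) x"] by simp
  qed
  define g where "g x = lim (\<lambda>k. f (r k) x)" for x
  have [measurable]: "g \<in> borel_measurable M" unfolding g_def by measurable
  have lim: "AE x in M. (\<lambda>k. f (r k) x) \<longlonglongrightarrow> g x"
    using conv by eventually_elim (simp add: g_def convergent_LIMSEQ_iff)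
  have bound: "(\<integral>\<^sup>+x. ennreal ((norm (f n x - g x))\<^sup>2) \<partial>M) \<le> ennreal (((1/2) ^ j)\<^sup>2)" if "n \<ge> r j" for n j
  proof -
    have "(\<integral>\<^sup>+x. ennreal ((norm (f n x - g x))\<^sup>2) \<partial>M) = (\<integral>\<^sup>+x. liminf (\<lambda>k. ennreal ((norm (f n x - f (r k) x))\<^sup>2)) \<partial>M)"
    proof (rule nn_integral_cong_AE)
      show "AE x in M. ennreal ((norm (f n x - g x))\<^sup>2) = liminf (\<lambda>k. ennreal ((norm (f n x - f (r k) x))\<^sup>2))"
        using lim
      proof eventually_elim
        case (elim x)
        have "(\<lambda>k. ennreal ((norm (f n x - f (r k) x))\<^sup>2)) \<longlonglongrightarrow> ennreal ((norm (f n x - g x))\<^sup>2)"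
          by (intro tendsto_intros elim)
        then show ?case by (rule lim_imp_Liminf[OF trivial_limit_sequentially, symmetric])
      qed
    qed
    also have "\<dots> \<le> liminf (\<lambda>k. \<integral>\<^sup>+x. ennreal ((norm (f n x - f (r k) x))\<^sup>2) \<partial>M)"
      by (rule nn_integral_liminf) measurable
    also have "\<dots> \<le> ennreal (((1/2) ^ j)\<^sup>2)"
    proof (intro Liminf_le)
      show "\<forall>\<^sub>F k in sequentially. (\<integral>\<^sup>+x. ennreal ((norm (f n x - f (r k) x))\<^sup>2) \<partial>M) \<le> ennreal (((1/2) ^ j)\<^sup>2)"
        using eventually_ge_at_top[of j]
      proof eventually_elim
        case (elim k)
        have "r j \<le> r k" using r(1) elim by (simp add: strict_mono_less_eq)
        then have "(l2 M (\<lambda>x. f n x - f (r k) x))\<^sup>2 \<le> ((1/2) ^ j)\<^sup>2"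
          using r(2)[OF that, of "r k"] by (intro power_mono) auto
        then show ?case
          by (subst nn_integral_eq_integral) (auto intro!: sqint_integrable sqint_diff sq ennreal_leI simp: l2_sq)
      qed
    qed auto
    finally show ?thesis .
  qed
  have sqd: "sqint M (\<lambda>x. f (r 0) x - g x)"
    using bound[of 0 "r 0"] by (auto simp: sqint_def integrable_iff_bounded intro: le_less_trans)
  have g: "sqint M g"
    using sqint_diff[OF sq[of "r 0"] sqd] by simp
  have "l2 M (\<lambda>x. f n x - g x) \<le> (1/2) ^ j" if "n \<ge> r j" for n j
  proof -
    have "ennreal ((l2 M (\<lambda>x. f n x - g x))\<^sup>2) \<le> ennreal (((1/2) ^ j)\<^sup>2)"
      using bound[OF that] by (subst (asm) nn_integral_eq_integral) (auto intro!: sqint_integrable sqint_diff sq g simp: l2_sq)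
    then have "(l2 M (\<lambda>x. f n x - g x))\<^sup>2 \<le> ((1/2) ^ j)\<^sup>2" by simp
    then show ?thesis by (rule power2_le_imp_le) simp
  qed
  then have "(\<lambda>n. l2 M (\<lambda>x. f n x - g x)) \<longlonglongrightarrow> 0"
  proof (intro LIMSEQ_I)
    fix e :: real assume "e > 0"
    then obtain j where "(1/2::real) ^ j < e" using real_arch_pow_inv[of e "1/2"] by auto
    then show "\<exists>N. \<forall>n\<ge>N. norm (l2 M (\<lambda>x. f n x - g x) - 0) < e"
      using \<open>\<And>n j. n \<ge> r j \<Longrightarrow> l2 M (\<lambda>x. f n x - g x) \<le> (1/2) ^ j\<close>
      by (intro exI[of _ "r j"]) (force intro: le_less_trans)
  qed
  with g show thesis by (rule that)
qed

section \<open>Continuous functions of compact support\<close>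

definition Cc :: "('a::euclidean_space \<Rightarrow> 'b::euclidean_space) \<Rightarrow> bool" where
  "Cc f \<longleftrightarrow> continuous_on UNIV f \<and> (\<exists>K. compact K \<and> (\<forall>x. x \<notin> K \<longrightarrow> f x = 0))"

lemma Cc_continuous: "Cc f \<Longrightarrow> continuous_on UNIV f"
  by (simp add: Cc_def)

lemma Cc_borel [measurable_dest]: "Cc f \<Longrightarrow> f \<in> borel_measurable borel"
  by (simp add: Cc_continuous borel_measurable_continuous_onI)

lemma Cc_compose:
  assumes "Cc f" "continuous_on UNIV h" "h 0 = 0" shows "Cc (\<lambda>x. h (f x))"
  using assms continuous_on_compose2[of UNIV h UNIV f] unfolding Cc_def by auto

lemma Cc_add: "Cc f \<Longrightarrow> Cc g \<Longrightarrow> Cc (\<lambda>x. f x + g x)"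
  unfolding Cc_def by (auto intro!: continuous_intros) (metis UnCI add.left_neutral compact_Un)

lemma Cc_zero: "Cc (\<lambda>x. 0)"
  by (auto simp: Cc_def intro: exI[of _ "{}"])

lemma Cc_sum: "finite I \<Longrightarrow> (\<And>i. i \<in> I \<Longrightarrow> Cc (f i)) \<Longrightarrow> Cc (\<lambda>x. \<Sum>i\<in>I. f i x)"
  by (induction I rule: finite_induct) (auto intro: Cc_add Cc_zero)

lemma Cc_uminus: "Cc f \<Longrightarrow> Cc (\<lambda>x. - f x)"
  by (rule Cc_compose) (auto intro: continuous_intros)

lemma Cc_diff: "Cc f \<Longrightarrow> Cc g \<Longrightarrow> Cc (\<lambda>x. f x - g x)"
  using Cc_add[OF _ Cc_uminus, of f g] by simp

lemma Cc_norm_power: "Cc f \<Longrightarrow> n > 0 \<Longrightarrow> Cc (\<lambda>x. norm (f x) ^ n)"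
  by (rule Cc_compose) (auto intro!: continuous_intros simp: power_0_left)

lemma Cc_power:
  fixes f :: "'a::euclidean_space \<Rightarrow> real"
  shows "Cc f \<Longrightarrow> n > 0 \<Longrightarrow> Cc (\<lambda>x. f x ^ n)"
  by (rule Cc_compose) (auto intro!: continuous_intros simp: power_0_left)

lemma Cc_scaleR_left: "continuous_on UNIV g \<Longrightarrow> Cc f \<Longrightarrow> Cc (\<lambda>x. g x *\<^sub>R f x)"
  unfolding Cc_def by (auto intro!: continuous_intros)

lemma Cc_scaleR_right: "continuous_on UNIV g \<Longrightarrow> Cc f \<Longrightarrow> Cc (\<lambda>x. f x *\<^sub>R g x)"
  unfolding Cc_def by (auto intro!: continuous_intros)

lemma Cc_mult:
  fixes f :: "'a::euclidean_space \<Rightarrow> real"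
  shows "Cc f \<Longrightarrow> Cc g \<Longrightarrow> Cc (\<lambda>x. f x * g x)"
  using Cc_scaleR_left[OF Cc_continuous, of f g] by simp

lemma Cc_inverse_image:
  assumes "Cc f" "continuous_on UNIV s" "continuous_on UNIV t" "\<And>x. t (s x) = x"
  shows "Cc (\<lambda>x. f (s x))"
proof -
  obtain K where K: "compact K" "\<And>x. x \<notin> K \<Longrightarrow> f x = 0" using assms(1) by (auto simp: Cc_def)
  have "compact (t ` K)" using K(1) assms(3) by (meson compact_continuous_image continuous_on_subset subset_UNIV)
  moreover have "f (s x) = 0" if "x \<notin> t ` K" for x
    using that K(2) assms(4) by (metis image_eqI)
  ultimately show ?thesis
    using assms(1,2) continuous_on_compose2[of UNIV f UNIV s] unfolding Cc_def by auto
qed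

lemma Cc_shift: "Cc f \<Longrightarrow> Cc (\<lambda>x. f (x + z))"
  by (rule Cc_inverse_image[where t = "\<lambda>x. x - z"]) (auto intro: continuous_intros)

lemma Cc_integrable:
  assumes "Cc f" shows "integrable lborel f"
proof -
  obtain K where K: "compact K" "\<And>x. x \<notin> K \<Longrightarrow> f x = 0" using assms by (auto simp: Cc_def)
  have "integrable lborel (\<lambda>x. indicator K x *\<^sub>R f x)"
    using assms by (intro borel_integrable_compact K) (auto simp: Cc_def intro: continuous_on_subset)
  also have "(\<lambda>x. indicator K x *\<^sub>R f x) = f" using K(2) by (auto simp: indicator_def)
  finally show ?thesis .
qed

lemma Cc_bounded:
  assumes "Cc f" obtains B where "B > 0" "\<And>x. norm (f x) \<le> B"
proof -
  obtain K where K: "compact K" "\<And>x. x \<notin> K \<Longrightarrow> f x = 0" using assms by (auto simp: Cc_def)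
  have "bounded (f ` K)"
    using K(1) assms by (meson Cc_continuous compact_continuous_image compact_imp_bounded continuous_on_subset subset_UNIV)
  then obtain B where B: "B > 0" "\<And>x. x \<in> K \<Longrightarrow> norm (f x) \<le> B" by (auto simp: bounded_pos)
  have "norm (f x) \<le> B" for x using B K(2) by (cases "x \<in> K") auto
  with B(1) show thesis by (rule that)
qed

lemma Cc_support_ball:
  assumes "Cc f" obtains R where "R > 0" "\<And>x. norm x > R \<Longrightarrow> f x = 0"
proof -
  obtain K where K: "compact K" "\<And>x. x \<notin> K \<Longrightarrow> f x = 0" using assms by (auto simp: Cc_def)
  obtain R where "R > 0" "\<And>x. x \<in> K \<Longrightarrow> norm x \<le> R" using compact_imp_bounded[OF K(1)] by (auto simp: bounded_pos)
  then show thesis using K(2) by (intro that[of R]) force+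
qed

lemma Cc_sqint: "Cc f \<Longrightarrow> sqint lborel f"
  using Cc_integrable[OF Cc_norm_power, of f 2] by (auto simp: sqint_def dest: Cc_borel)

section \<open>Translations and difference quotients\<close>

lemma lborel_integral_shift:
  fixes f :: "'a::euclidean_space \<Rightarrow> 'b::{banach,second_countable_topology}"
  assumes [measurable]: "f \<in> borel_measurable borel"
  shows "(\<integral>x. f (x + z) \<partial>lborel) = (\<integral>x. f x \<partial>lborel)"
proof -
  have "(\<integral>x. f x \<partial>lborel) = (\<integral>x. f x \<partial>distr lborel borel ((+) z))"
    by (simp add: lborel_distr_plus)
  also have "\<dots> = (\<integral>x. f (z + x) \<partial>lborel)" by (rule integral_distr) auto
  finally show ?thesis by (simp add: add.commute)
qed

lemma difference_bound:
  fixes f :: "'a::euclidean_space \<Rightarrow> 'b::euclidean_space"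
  assumes d: "\<And>x. (f has_derivative f' x) (at x)" and B: "\<And>x. norm (f' x v) \<le> B" and "0 \<le> t"
  shows "norm (f (x + t *\<^sub>R v) - f x) \<le> t * B"
proof -
  have "norm ((\<lambda>s. f (x + s *\<^sub>R v)) t - (\<lambda>s. f (x + s *\<^sub>R v)) 0) \<le> B * norm (t - 0)"
  proof (rule differentiable_bound[where S = UNIV and f' = "\<lambda>s h. f' (x + s *\<^sub>R v) (h *\<^sub>R v)"])
    fix s
    show "((\<lambda>s. f (x + s *\<^sub>R v)) has_derivative (\<lambda>h. f' (x + s *\<^sub>R v) (h *\<^sub>R v))) (at s)"
      by (rule has_derivative_compose[OF _ d]) (auto intro!: derivative_eq_intros)
    have "bounded_linear (f' (x + s *\<^sub>R v))" using d has_derivative_bounded_linear by blast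
    then have "f' (x + s *\<^sub>R v) (h *\<^sub>R v) = h *\<^sub>R f' (x + s *\<^sub>R v) v" for h
      by (simp add: linear_cmul bounded_linear.linear)
    then show "onorm (\<lambda>h. f' (x + s *\<^sub>R v) (h *\<^sub>R v)) \<le> B"
      using B by (intro onorm_le) (auto simp: mult.commute[of B] intro: mult_left_mono)
  qed auto
  then show ?thesis using \<open>0 \<le> t\<close> by (simp add: mult.commute)
qed

lemma difference_quotient_tendsto:
  fixes f :: "'a::euclidean_space \<Rightarrow> 'b::euclidean_space"
  assumes "(f has_derivative f') (at x)"
  shows "(\<lambda>n. real (Suc n) *\<^sub>R (f (x + (1 / real (Suc n)) *\<^sub>R v) - f x)) \<longlonglongrightarrow> f' v"
proof -
  have "((\<lambda>s. f (x + s *\<^sub>R v)) has_derivative (\<lambda>h. f' (h *\<^sub>R v))) (at 0)"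
    by (rule has_derivative_compose[where f = "\<lambda>s. x + s *\<^sub>R v"]) (use assms in \<open>auto intro!: derivative_eq_intros\<close>)
  moreover have "f' (h *\<^sub>R v) = h *\<^sub>R f' v" for h
    using assms by (simp add: has_derivative_bounded_linear linear_cmul bounded_linear.linear)
  ultimately have "((\<lambda>h. norm (f (x + h *\<^sub>R v) - f x - h *\<^sub>R f' v) / norm h) \<longlongrightarrow> 0) (at 0)"
    by (simp add: has_derivative_at)
  then have "((\<lambda>h. norm ((f (x + h *\<^sub>R v) - f x) /\<^sub>R h - f' v)) \<longlongrightarrow> 0) (at 0)"
  proof (rule Lim_transform_eventually)
    have "norm (f (x + h *\<^sub>R v) - f x - h *\<^sub>R f' v) / norm h = norm ((f (x + h *\<^sub>R v) - f x) /\<^sub>R h - f' v)"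
      if "h \<noteq> 0" for h
    proof -
      have "(f (x + h *\<^sub>R v) - f x) /\<^sub>R h - f' v = (f (x + h *\<^sub>R v) - f x - h *\<^sub>R f' v) /\<^sub>R h"
        using that by (simp add: scaleR_diff_right)
      then show ?thesis by (simp add: divide_inverse mult.commute)
    qed
    then show "\<forall>\<^sub>F h in at 0. norm (f (x + h *\<^sub>R v) - f x - h *\<^sub>R f' v) / norm h
        = norm ((f (x + h *\<^sub>R v) - f x) /\<^sub>R h - f' v)"
      by (auto simp: eventually_at_filter)
  qed
  then have "((\<lambda>h. (f (x + h *\<^sub>R v) - f x) /\<^sub>R h) \<longlongrightarrow> f' v) (at 0)"
    by (rule LIM_zero_cancel[OF tendsto_norm_zero_cancel])
  moreover have "filterlim (\<lambda>n. 1 / real (Suc n)) (at 0) sequentially"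
    by (auto simp: filterlim_at LIMSEQ_Suc[OF lim_1_over_n] simp del: of_nat_Suc)
  ultimately have "(\<lambda>n. (f (x + (1 / real (Suc n)) *\<^sub>R v) - f x) /\<^sub>R (1 / real (Suc n))) \<longlonglongrightarrow> f' v"
    by (rule filterlim_compose)
  then show ?thesis by (simp add: divide_inverse del: of_nat_Suc)
qed

text \<open>Both integral identities for derivatives come from dominated convergence of these
  difference quotients, so no iterated integrals are needed.\<close>

lemma difference_quotient_dominated:
  fixes f :: "'a::euclidean_space \<Rightarrow> 'b::euclidean_space"
  assumes f: "Cc f" and d: "\<And>x. (f has_derivative f' x) (at x)" and c: "Cc (\<lambda>x. f' x v)"
  obtains R B where "B > 0"
    "\<And>n x. norm (real (Suc n) *\<^sub>R (f (x + (1 / real (Suc n)) *\<^sub>R v) - f x)) \<le> B * indicator (cball 0 R) x"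
proof -
  obtain B where B: "B > 0" "\<And>x. norm (f' x v) \<le> B" using Cc_bounded[OF c] by blast
  obtain R where R: "R > 0" "\<And>x. norm x > R \<Longrightarrow> f x = 0" using Cc_support_ball[OF f] by blast
  show thesis
  proof (rule that[OF B(1)])
    fix n x
    let ?t = "1 / real (Suc n)"
    show "norm (real (Suc n) *\<^sub>R (f (x + ?t *\<^sub>R v) - f x)) \<le> B * indicator (cball 0 (R + norm v)) x"
    proof (cases "norm x \<le> R + norm v")
      case True
      have "norm (f (x + ?t *\<^sub>R v) - f x) \<le> ?t * B"
        by (rule difference_bound[OF d B(2)]) simp
      then have "real (Suc n) * norm (f (x + ?t *\<^sub>R v) - f x) \<le> real (Suc n) * (?t * B)"
        by (intro mult_left_mono) auto
      then show ?thesis using True by (simp del: of_nat_Suc)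
    next
      case False
      have "norm (?t *\<^sub>R v) \<le> norm v" by (simp add: divide_le_eq mult_le_cancel_left1)
      then have "norm (x + ?t *\<^sub>R v) > R"
        using False norm_triangle_ineq4[of "x + ?t *\<^sub>R v" "?t *\<^sub>R v"] by simp
      moreover have "norm x > R" using False norm_ge_zero[of v] by linarith
      ultimately show ?thesis using R(2) B(1) by (simp add: indicator_def)
    qed
  qed
qed

text \<open>By translation invariance every difference quotient has integral 0, and this survives in
  the limit.\<close>

lemma integral_derivative_eq_0:
  fixes f :: "'a::euclidean_space \<Rightarrow> 'b::euclidean_space"
  assumes f: "Cc f" and d: "\<And>x. (f has_derivative f' x) (at x)" and c: "Cc (\<lambda>x. f' x v)"
  shows "(\<integral>x. f' x v \<partial>lborel) = 0"
proof -
  let ?q = "\<lambda>n x. real (Suc n) *\<^sub>R (f (x + (1 / real (Suc n)) *\<^sub>R v) - f x)"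
  obtain R B where B: "B > 0" "\<And>n x. norm (?q n x) \<le> B * indicator (cball 0 R) x"
    by (rule difference_quotient_dominated[OF assms]) (rule that)
  note [measurable] = Cc_borel[OF f] Cc_borel[OF c]
  have "(\<lambda>n. \<integral>x. ?q n x \<partial>lborel) \<longlonglongrightarrow> (\<integral>x. f' x v \<partial>lborel)"
  proof (rule integral_dominated_convergence[where w = "\<lambda>x. B * indicator (cball 0 R) x"])
    show "integrable lborel (\<lambda>x. B * indicator (cball 0 R) x)"
      by (intro integrable_mult_right integrable_real_indicator) (use emeasure_lborel_cball_finite in auto)
  qed (use B difference_quotient_tendsto[OF d] in auto)
  moreover have "(\<integral>x. ?q n x \<partial>lborel) = 0" for n
    by (simp add: Bochner_Integration.integral_diff Cc_integrable[OF f] Cc_integrable[OF Cc_shift[OF f]]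
        lborel_integral_shift del: of_nat_Suc)
  ultimately show ?thesis using LIMSEQ_unique[of "\<lambda>n. 0" _ 0] by simp
qed

text \<open>The difference f (x + v) - f x telescopes into m steps of size v/m. Cauchy-Schwarz for
  the sum costs a factor m, and all m steps have the same integral by translation invariance. The
  total is the squared norm of the difference quotient with step 1/m, which tends to the right-hand
  side.\<close>

lemma translation_estimate:
  fixes f :: "'a::euclidean_space \<Rightarrow> 'b::euclidean_space"
  assumes f: "Cc f" and d: "\<And>x. (f has_derivative f' x) (at x)" and c: "Cc (\<lambda>x. f' x v)"
  shows "(\<integral>x. (norm (f (x + v) - f x))\<^sup>2 \<partial>lborel) \<le> (\<integral>x. (norm (f' x v))\<^sup>2 \<partial>lborel)"
proof -
  let ?q = "\<lambda>n x. real (Suc n) *\<^sub>R (f (x + (1 / real (Suc n)) *\<^sub>R v) - f x)"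
  obtain R B where B: "B > 0" "\<And>n x. norm (?q n x) \<le> B * indicator (cball 0 R) x"
    by (rule difference_quotient_dominated[OF assms]) (rule that)
  note [measurable] = Cc_borel[OF f] Cc_borel[OF c]
  have lim: "(\<lambda>n. \<integral>x. (norm (?q n x))\<^sup>2 \<partial>lborel) \<longlonglongrightarrow> (\<integral>x. (norm (f' x v))\<^sup>2 \<partial>lborel)"
  proof (rule integral_dominated_convergence[where w = "\<lambda>x. B\<^sup>2 * indicator (cball 0 R) x"])
    show "integrable lborel (\<lambda>x. B\<^sup>2 * indicator (cball 0 R) x)"
      by (intro integrable_mult_right integrable_real_indicator) (use emeasure_lborel_cball_finite in auto)
    show "AE x in lborel. (\<lambda>n. (norm (?q n x))\<^sup>2) \<longlonglongrightarrow> (norm (f' x v))\<^sup>2"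
      using difference_quotient_tendsto[OF d] by (intro AE_I2 tendsto_power tendsto_norm)
    have "(norm (?q n x))\<^sup>2 \<le> B\<^sup>2 * indicator (cball 0 R) x" for n x
      using power_mono[OF B(2)[of n x], of 2] by (cases "norm x \<le> R") (auto simp: power_mult_distrib)
    then show "AE x in lborel. norm ((norm (?q n x))\<^sup>2) \<le> B\<^sup>2 * indicator (cball 0 R) x" for n
      by simp
  qed auto
  have "(\<integral>x. (norm (f (x + v) - f x))\<^sup>2 \<partial>lborel) \<le> (\<integral>x. (norm (?q n x))\<^sup>2 \<partial>lborel)" for n
  proof -
    let ?m = "Suc n"
    define w where "w = (1 / real ?m) *\<^sub>R v"
    define g where "g x = f (x + w) - f x" for x
    have g: "Cc g" unfolding g_def by (intro Cc_diff Cc_shift f)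
    have "(norm (f (x + v) - f x))\<^sup>2 \<le> real ?m * (\<Sum>i<?m. (norm (g (x + real i *\<^sub>R w)))\<^sup>2)" for x
    proof -
      have "(\<Sum>i<?m. g (x + real i *\<^sub>R w)) = (\<Sum>i<?m. f (x + real (Suc i) *\<^sub>R w) - f (x + real i *\<^sub>R w))"
        by (rule sum.cong) (auto simp: g_def algebra_simps)
      also have "\<dots> = f (x + real ?m *\<^sub>R w) - f x"
        by (subst sum_lessThan_telescope) simp
      also have "real ?m *\<^sub>R w = v" by (simp add: w_def del: of_nat_Suc)
      finally have "(norm (f (x + v) - f x))\<^sup>2 \<le> (\<Sum>i<?m. norm (g (x + real i *\<^sub>R w)))\<^sup>2"
        by (intro power_mono) (metis norm_sum, simp)
      also have "\<dots> \<le> real ?m * (\<Sum>i<?m. (norm (g (x + real i *\<^sub>R w)))\<^sup>2)"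
        using Cauchy_Schwarz_ineq_sum[of "\<lambda>_. 1" "\<lambda>i. norm (g (x + real i *\<^sub>R w))" "{..<?m}"] by simp
      finally show ?thesis .
    qed
    then have "(\<integral>x. (norm (f (x + v) - f x))\<^sup>2 \<partial>lborel)
        \<le> (\<integral>x. real ?m * (\<Sum>i<?m. (norm (g (x + real i *\<^sub>R w)))\<^sup>2) \<partial>lborel)"
      by (intro integral_mono integrable_mult_right Bochner_Integration.integrable_sum Cc_integrable
          Cc_norm_power Cc_diff Cc_shift f g) auto
    also have "\<dots> = real ?m * (\<Sum>i<?m. \<integral>x. (norm (g (x + real i *\<^sub>R w)))\<^sup>2 \<partial>lborel)"
      by (subst integral_mult_right_zero, subst Bochner_Integration.integral_sum)
        (auto intro!: Cc_integrable Cc_norm_power Cc_shift g)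
    also have "\<dots> = real ?m * (\<Sum>i<?m. \<integral>x. (norm (g x))\<^sup>2 \<partial>lborel)"
      using lborel_integral_shift[OF Cc_borel[OF Cc_norm_power[OF g]], of 2] by simp
    also have "\<dots> = (\<integral>x. (norm (?q n x))\<^sup>2 \<partial>lborel)"
    proof -
      have "(\<integral>x. (norm (?q n x))\<^sup>2 \<partial>lborel) = (\<integral>x. (real ?m)\<^sup>2 * (norm (g x))\<^sup>2 \<partial>lborel)"
        by (simp add: g_def w_def power_mult_distrib del: of_nat_Suc)
      then show ?thesis by (simp add: power2_eq_square[of "real ?m"] mult.assoc del: of_nat_Suc)
    qed
    finally show ?thesis .
  qed
  with lim show ?thesis by (intro LIMSEQ_le_const) auto
qed

section \<open>Test functions\<close>

lemma test_functionI:
  assumes "smooth f" "compact K" "K \<subseteq> D" "\<And>x. x \<notin> K \<Longrightarrow> f x = 0"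
  shows "test_function D f"
proof -
  have "closure {x. f x \<noteq> 0} \<subseteq> K"
    using assms by (intro closure_minimal) (auto intro: compact_imp_closed)
  then show ?thesis
    using assms compact_Int_closed[OF assms(2) closed_closure, of "{x. f x \<noteq> 0}"]
    unfolding test_function_def by (auto simp: Int_absorb1)
qed

lemma test_function_support:
  assumes "test_function D f"
  obtains K where "compact K" "K \<subseteq> D" "\<And>x. x \<notin> K \<Longrightarrow> f x = 0"
  using assms closure_subset[of "{x. f x \<noteq> 0}"] unfolding test_function_def
  by (metis (mono_tags, lifting) mem_Collect_eq subsetD)

lemma test_function_zero_outside: "test_function D f \<Longrightarrow> x \<notin> D \<Longrightarrow> f x = 0"
  by (metis test_function_support subsetD)

lemma test_function_smooth: "test_function D f \<Longrightarrow> smooth f"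
  by (simp add: test_function_def)

lemma test_function_Cc: "test_function D f \<Longrightarrow> Cc f"
  by (metis Cc_def test_function_support smooth_continuous test_function_smooth)

lemma test_function_has_derivative:
  "test_function D f \<Longrightarrow> (f has_derivative frechet_derivative f (at x)) (at x)"
  by (simp add: smooth_has_derivative test_function_smooth)

lemma frechet_derivative_outside:
  assumes "closed K" "\<And>x. x \<notin> K \<Longrightarrow> f x = 0" "x \<notin> K"
  shows "frechet_derivative f (at x) v = 0"
proof -
  have "(f has_derivative (\<lambda>v. 0)) (at x)"
    by (rule has_derivative_transform_within_open[of "\<lambda>x. 0" _ _ _ "- K"]) (use assms in auto)
  then show ?thesis using frechet_derivative_at by metis
qed

lemma test_function_derivative:
  assumes "test_function D f" shows "test_function D (\<lambda>x. frechet_derivative f (at x) v)"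
proof -
  obtain K where K: "compact K" "K \<subseteq> D" "\<And>x. x \<notin> K \<Longrightarrow> f x = 0"
    by (rule test_function_support[OF assms]) (rule that)
  show ?thesis
    by (rule test_functionI[OF smooth_derivative[OF test_function_smooth[OF assms]] K(1,2)])
      (rule frechet_derivative_outside[OF compact_imp_closed[OF K(1)] K(3)])
qed

lemma test_function_mono: "test_function D f \<Longrightarrow> D \<subseteq> D' \<Longrightarrow> test_function D' f"
  by (auto simp: test_function_def)

lemma test_function_add:
  assumes "test_function D f" "test_function D g" shows "test_function D (\<lambda>x. f x + g x)"
proof -
  obtain K where K: "compact K" "K \<subseteq> D" "\<And>x. x \<notin> K \<Longrightarrow> f x = 0"
    by (rule test_function_support[OF assms(1)]) (rule that)
  obtain L where L: "compact L" "L \<subseteq> D" "\<And>x. x \<notin> L \<Longrightarrow> g x = 0"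
    by (rule test_function_support[OF assms(2)]) (rule that)
  show ?thesis
    by (rule test_functionI[of _ "K \<union> L"]) (use K L assms in \<open>auto intro: smooth_add test_function_smooth\<close>)
qed

lemma test_function_bounded_linear:
  assumes "test_function D f" "bounded_linear L" shows "test_function D (\<lambda>x. L (f x))"
proof -
  obtain K where K: "compact K" "K \<subseteq> D" "\<And>x. x \<notin> K \<Longrightarrow> f x = 0"
    by (rule test_function_support[OF assms(1)]) (rule that)
  have "L 0 = 0" using assms(2) by (simp add: linear_0 bounded_linear.linear)
  then show ?thesis
    using K assms by (intro test_functionI[of _ K]) (auto intro: smooth_bounded_linear test_function_smooth)
qed

lemma test_function_scaleR: "test_function D f \<Longrightarrow> test_function D (\<lambda>x. c *\<^sub>R f x)"
  by (rule test_function_bounded_linear[OF _ bounded_linear_scaleR_right])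

lemma test_function_diff: "test_function D f \<Longrightarrow> test_function D g \<Longrightarrow> test_function D (\<lambda>x. f x - g x)"
  using test_function_add[OF _ test_function_scaleR, of D f g "-1"] by simp

lemma test_function_compose:
  fixes h :: "real \<Rightarrow> real"
  assumes "test_function D f" "smooth h" "h 0 = 0" shows "test_function D (\<lambda>x. h (f x))"
proof -
  obtain K where "compact K" "K \<subseteq> D" "\<And>x. x \<notin> K \<Longrightarrow> f x = 0"
    by (rule test_function_support[OF assms(1)]) (rule that)
  then show ?thesis
    using assms by (intro test_functionI[of _ K]) (auto intro: smooth_compose test_function_smooth)
qed

lemma test_function_sqint:
  fixes f :: "'a::euclidean_space \<Rightarrow> 'b::euclidean_space"
  shows "test_function D f \<Longrightarrow> sqint lborel f"
  by (simp add: Cc_sqint test_function_Cc)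

lemma test_function_derivative_sqint:
  fixes f :: "'a::euclidean_space \<Rightarrow> 'b::euclidean_space"
  shows "test_function D f \<Longrightarrow> sqint lborel (\<lambda>x. frechet_derivative f (at x) v)"
  by (rule test_function_sqint[OF test_function_derivative])

lemma frechet_derivative_eqI:
  "(f has_derivative f') (at x) \<Longrightarrow> frechet_derivative f (at x) v = f' v"
  by (metis frechet_derivative_at)

lemma frechet_derivative_test_diff:
  assumes "test_function D f" "test_function D g"
  shows "frechet_derivative (\<lambda>x. f x - g x) (at x) v
    = frechet_derivative f (at x) v - frechet_derivative g (at x) v"
  by (rule frechet_derivative_eqI[OF has_derivative_diff[OF test_function_has_derivative test_function_has_derivative]])
    (use assms in auto)

lemma integration_by_parts:
  fixes u :: "'a::euclidean_space \<Rightarrow> 'b::euclidean_space" and \<phi> :: "'a \<Rightarrow> real"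
  assumes "test_function D \<phi>" "smooth u"
  shows "(\<integral>x. frechet_derivative \<phi> (at x) v *\<^sub>R u x \<partial>lborel)
    = - (\<integral>x. \<phi> x *\<^sub>R frechet_derivative u (at x) v \<partial>lborel)"
proof -
  let ?d = "\<lambda>x h. \<phi> x *\<^sub>R frechet_derivative u (at x) h + frechet_derivative \<phi> (at x) h *\<^sub>R u x"
  have c1: "Cc (\<lambda>x. \<phi> x *\<^sub>R frechet_derivative u (at x) v)"
    using assms by (intro Cc_scaleR_right test_function_Cc smooth_continuous smooth_derivative)
  have c2: "Cc (\<lambda>x. frechet_derivative \<phi> (at x) v *\<^sub>R u x)"
    using assms by (intro Cc_scaleR_right test_function_Cc[OF test_function_derivative] smooth_continuous)
  have "(\<integral>x. ?d x v \<partial>lborel) = 0"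
  proof (rule integral_derivative_eq_0[where f = "\<lambda>x. \<phi> x *\<^sub>R u x"])
    show "Cc (\<lambda>x. \<phi> x *\<^sub>R u x)" using assms by (intro Cc_scaleR_right test_function_Cc smooth_continuous)
    show "((\<lambda>x. \<phi> x *\<^sub>R u x) has_derivative ?d x) (at x)" for x
      by (rule has_derivative_scaleR[OF test_function_has_derivative[OF assms(1)] smooth_has_derivative[OF assms(2)]])
    show "Cc (\<lambda>x. ?d x v)" by (intro Cc_add c1 c2)
  qed
  then show ?thesis
    by (simp add: Bochner_Integration.integral_add Cc_integrable c1 c2 eq_neg_iff_add_eq_0 add.commute)
qed

subsection \<open>The Dirichlet integral\<close>

definition dirichlet :: "('a::euclidean_space \<Rightarrow> 'b::euclidean_space) \<Rightarrow> real" where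
  "dirichlet f = (\<integral>x. (\<Sum>b\<in>Basis. (norm (frechet_derivative f (at x) b))\<^sup>2) \<partial>lborel)"

lemma dirichlet_nonneg: "0 \<le> dirichlet f"
  unfolding dirichlet_def by (intro integral_nonneg_AE AE_I2 sum_nonneg) auto

lemma dirichlet_eq_l2:
  fixes f :: "'a::euclidean_space \<Rightarrow> 'b::euclidean_space"
  assumes "test_function D f"
  shows "dirichlet f = (\<Sum>b\<in>Basis. (l2 lborel (\<lambda>x. frechet_derivative f (at x) b))\<^sup>2)"
  unfolding dirichlet_def l2_sq
  by (intro Bochner_Integration.integral_sum sqint_integrable test_function_derivative_sqint[OF assms])

lemma dirichlet_integrable:
  fixes f :: "'a::euclidean_space \<Rightarrow> 'b::euclidean_space"
  assumes "test_function D f"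
  shows "integrable lborel (\<lambda>x. \<Sum>b\<in>Basis. (norm (frechet_derivative f (at x) b))\<^sup>2)"
  by (intro Bochner_Integration.integrable_sum sqint_integrable test_function_derivative_sqint[OF assms])

lemma derivative_norm_le:
  fixes f :: "'a::euclidean_space \<Rightarrow> 'b::euclidean_space"
  assumes "(f has_derivative f') (at x)"
  shows "(norm (f' v))\<^sup>2 \<le> (norm v)\<^sup>2 * (\<Sum>b\<in>Basis. (norm (f' b))\<^sup>2)"
proof -
  have lin: "linear f'" using assms has_derivative_linear by blast
  have "f' v = f' (\<Sum>b\<in>Basis. (v \<bullet> b) *\<^sub>R b)" by (simp add: euclidean_representation)
  also have "\<dots> = (\<Sum>b\<in>Basis. (v \<bullet> b) *\<^sub>R f' b)" by (simp add: linear_sum[OF lin] linear_cmul[OF lin])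
  finally have "norm (f' v) \<le> (\<Sum>b\<in>Basis. \<bar>v \<bullet> b\<bar> * norm (f' b))"
    by (metis (no_types, lifting) norm_scaleR norm_sum sum.cong)
  then have "(norm (f' v))\<^sup>2 \<le> (\<Sum>b\<in>Basis. \<bar>v \<bullet> b\<bar> * norm (f' b))\<^sup>2" by (intro power_mono) auto
  also have "\<dots> \<le> (\<Sum>b\<in>Basis. \<bar>v \<bullet> b\<bar>\<^sup>2) * (\<Sum>b\<in>Basis. (norm (f' b))\<^sup>2)"
    by (rule Cauchy_Schwarz_ineq_sum)
  also have "(\<Sum>b\<in>Basis. \<bar>v \<bullet> b\<bar>\<^sup>2) = (norm v)\<^sup>2"
    by (simp add: power2_norm_eq_inner power2_eq_square[symmetric] euclidean_inner[of v v])
  finally show ?thesis .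
qed

lemma dirichlet_translation:
  fixes f :: "'a::euclidean_space \<Rightarrow> 'b::euclidean_space"
  assumes "test_function D f"
  shows "(\<integral>x. (norm (f (x + v) - f x))\<^sup>2 \<partial>lborel) \<le> (norm v)\<^sup>2 * dirichlet f"
proof -
  have "(\<integral>x. (norm (f (x + v) - f x))\<^sup>2 \<partial>lborel) \<le> (\<integral>x. (norm (frechet_derivative f (at x) v))\<^sup>2 \<partial>lborel)"
    using assms by (intro translation_estimate test_function_Cc test_function_has_derivative test_function_derivative)
  also have "\<dots> \<le> (\<integral>x. (norm v)\<^sup>2 * (\<Sum>b\<in>Basis. (norm (frechet_derivative f (at x) b))\<^sup>2) \<partial>lborel)"
    by (intro integral_mono sqint_integrable test_function_derivative_sqint[OF assms]
        integrable_mult_right dirichlet_integrable[OF assms] derivative_norm_le[OF test_function_has_derivative[OF assms]])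
  also have "\<dots> = (norm v)\<^sup>2 * dirichlet f" by (simp add: dirichlet_def)
  finally show ?thesis .
qed

section \<open>The fundamental lemma of the calculus of variations\<close>

lemma flat0_tendsto_1:
  assumes "s > 0" shows "(\<lambda>n. flat 0 (real n * s)) \<longlonglongrightarrow> 1"
proof -
  have "(\<lambda>n. inverse (real n * s)) \<longlonglongrightarrow> 0"
    using tendsto_mult_right[OF lim_inverse_n, of "inverse s"] by (simp add: inverse_mult_distrib)
  then have "(\<lambda>n. exp (- inverse (real n * s))) \<longlonglongrightarrow> exp (- 0)" by (intro tendsto_intros)
  then have "(\<lambda>n. exp (- inverse (real n * s))) \<longlonglongrightarrow> 1" by simp
  then show ?thesis
    by (rule Lim_transform_eventually)
      (use assms in \<open>auto intro!: eventually_sequentiallyI[of 1] simp: flat_def\<close>)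
qed

text \<open>For s > 0 the factors exp (-1/(n s)) tend to 1, and they vanish for s \<le> 0, so their
  products converge to the indicator of the open box. Positivity of the member with index 1 serves
  later to produce a nonzero competitor.\<close>

lemma box_bump:
  fixes a b :: "'a::euclidean_space"
  assumes "cbox a b \<subseteq> D"
  obtains \<phi> :: "nat \<Rightarrow> 'a \<Rightarrow> real" where "\<And>n. test_function D (\<phi> n)"
    "\<And>n x. 0 \<le> \<phi> n x" "\<And>n x. \<phi> n x \<le> indicator (box a b) x"
    "\<And>x. (\<lambda>n. \<phi> n x) \<longlonglongrightarrow> indicator (box a b) x" "\<And>x. x \<in> box a b \<Longrightarrow> \<phi> 1 x > 0"
proof -
  define \<phi> where "\<phi> n x = (\<Prod>i\<in>Basis. flat 0 (real n * (x \<bullet> i - a \<bullet> i)) * flat 0 (real n * (b \<bullet> i - x \<bullet> i)))"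
    for n and x :: 'a
  have 0: "\<phi> n x = 0" if "x \<notin> box a b" for n x
  proof -
    from that obtain i where i: "i \<in> Basis" "x \<bullet> i \<le> a \<bullet> i \<or> b \<bullet> i \<le> x \<bullet> i" by (auto simp: mem_box not_less)
    then have "flat 0 (real n * (x \<bullet> i - a \<bullet> i)) * flat 0 (real n * (b \<bullet> i - x \<bullet> i)) = 0"
      by (auto intro!: flat0_bounds(4) mult_nonneg_nonpos)
    then show ?thesis unfolding \<phi>_def using i(1) by (intro prod_zero) auto
  qed
  have smooth: "smooth (\<phi> n)" for n
  proof -
    have "smooth (\<lambda>x::'a. flat 0 (real n * (x \<bullet> i - a \<bullet> i)))" "smooth (\<lambda>x::'a. flat 0 (real n * (b \<bullet> i - x \<bullet> i)))" for i
      by (intro smooth_compose[OF smooth_flat] smooth_mult smooth_diff smooth_const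
          smooth_linear[OF bounded_linear_inner_left])+
    then show ?thesis unfolding \<phi>_def by (intro smooth_prod smooth_mult) auto
  qed
  show thesis
  proof
    show "test_function D (\<phi> n)" for n
      by (rule test_functionI[OF smooth compact_cbox assms 0]) (meson box_subset_cbox subsetD)
    show "0 \<le> \<phi> n x" for n x unfolding \<phi>_def by (intro prod_nonneg) (simp add: flat0_bounds)
    have "\<phi> n x \<le> 1" for n x unfolding \<phi>_def
      by (intro prod_le_1 conjI mult_nonneg_nonneg mult_le_one flat0_bounds)
    then show "\<phi> n x \<le> indicator (box a b) x" for n x using 0 by (auto simp: indicator_def)
    show "\<phi> 1 x > 0" if "x \<in> box a b" for x
      unfolding \<phi>_def using that by (intro prod_pos) (auto simp: mem_box flat0_bounds)
    show "(\<lambda>n. \<phi> n x) \<longlonglongrightarrow> indicator (box a b) x" for x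
    proof (cases "x \<in> box a b")
      case True
      have "(\<lambda>n. \<phi> n x) \<longlonglongrightarrow> (\<Prod>i\<in>(Basis::'a set). 1 * 1)"
        unfolding \<phi>_def using True by (intro tendsto_prod tendsto_mult flat0_tendsto_1) (auto simp: mem_box)
      then show ?thesis using True by simp
    qed (simp add: 0)
  qed
qed

section \<open>Integrals of products and the real case of the fundamental lemma\<close>

lemma sqint_indicator:
  assumes "A \<in> sets M" "emeasure M A < \<infinity>" shows "sqint M (indicator A :: _ \<Rightarrow> real)"
  using assms by (intro sqint_bound[where h = "indicator A"]) (auto simp: indicator_def)

lemma sqint_integrable_product:
  fixes f :: "_ \<Rightarrow> real"
  assumes [measurable]: "sqint M f" "sqint M g"
  shows "integrable M (\<lambda>x. f x *\<^sub>R g x)"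
  by (rule Bochner_Integration.integrable_bound[OF sqint_mult_integrable[OF assms]]) auto

lemma l2_product_bound:
  fixes f :: "_ \<Rightarrow> real"
  assumes "sqint M f" "sqint M g"
  shows "norm (\<integral>x. f x *\<^sub>R g x \<partial>M) \<le> l2 M f * l2 M g"
proof -
  have "norm (\<integral>x. f x *\<^sub>R g x \<partial>M) \<le> (\<integral>x. norm (f x *\<^sub>R g x) \<partial>M)" by (rule integral_norm_bound)
  also have "\<dots> \<le> l2 M f * l2 M g" using cauchy_schwarz[OF assms] by simp
  finally show ?thesis .
qed

lemma l2_product_tendsto:
  fixes f :: "_ \<Rightarrow> real"
  assumes "sqint M f" "\<And>n. sqint M (g n)" "sqint M h" "(\<lambda>n. l2 M (\<lambda>x. g n x - h x)) \<longlonglongrightarrow> 0"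
  shows "(\<lambda>n. \<integral>x. f x *\<^sub>R g n x \<partial>M) \<longlonglongrightarrow> (\<integral>x. f x *\<^sub>R h x \<partial>M)"
proof -
  have "(\<lambda>n. (\<integral>x. f x *\<^sub>R g n x \<partial>M) - (\<integral>x. f x *\<^sub>R h x \<partial>M)) \<longlonglongrightarrow> 0"
  proof (rule Lim_null_comparison)
    have "norm ((\<integral>x. f x *\<^sub>R g n x \<partial>M) - (\<integral>x. f x *\<^sub>R h x \<partial>M)) \<le> l2 M f * l2 M (\<lambda>x. g n x - h x)" for n
      using l2_product_bound[OF assms(1) sqint_diff[OF assms(2,3)], of n] assms
      by (simp add: scaleR_diff_right Bochner_Integration.integral_diff sqint_integrable_product)
    then show "\<forall>\<^sub>F n in sequentially. norm ((\<integral>x. f x *\<^sub>R g n x \<partial>M) - (\<integral>x. f x *\<^sub>R h x \<partial>M))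
        \<le> l2 M f * l2 M (\<lambda>x. g n x - h x)" by simp
    show "(\<lambda>n. l2 M f * l2 M (\<lambda>x. g n x - h x)) \<longlonglongrightarrow> 0" using tendsto_mult_right_zero[OF assms(4)] .
  qed
  then show ?thesis by (simp add: LIM_zero_iff)
qed

lemma enn2real_cancel: "enn2real a = enn2real b \<Longrightarrow> a < \<infinity> \<Longrightarrow> b < \<infinity> \<Longrightarrow> a = b"
  by (cases a rule: ennreal_cases; cases b rule: ennreal_cases) auto

text \<open>Testing with bumps shows that the integral of f over every box with closure in D is 0.
  Hence the positive and the negative part of f, restricted to such a box, are densities of measures
  that agree on all boxes. Boxes are stable under intersection and generate the Borel sets, so the
  measures coincide and the two parts are equal almost everywhere, which forces f = 0. Countably
  many closed boxes cover D.\<close>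

lemma fundamental_lemma_real:
  fixes f :: "'a::euclidean_space \<Rightarrow> real"
  assumes f: "sqint lborel f" and D: "open D"
    and 0: "\<And>\<phi>::'a \<Rightarrow> real. test_function D \<phi> \<Longrightarrow> (\<integral>x. \<phi> x * f x \<partial>lborel) = 0"
  shows "AE x in lborel. x \<in> D \<longrightarrow> f x = 0"
proof -
  note [measurable] = sqint_borel[OF f]
  have int: "integrable lborel (\<lambda>x. indicator (box a b) x * f x)" for a b
    using sqint_integrable_product[OF sqint_indicator f, of "box a b"] emeasure_lborel_box_finite[of a b] by simp
  have box: "(\<integral>x. indicator (box a b) x * f x \<partial>lborel) = 0" if ab: "cbox a b \<subseteq> D" for a b
  proof -
    obtain \<phi> :: "nat \<Rightarrow> 'a \<Rightarrow> real" where \<phi>: "\<And>n. test_function D (\<phi> n)"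
      "\<And>n x. 0 \<le> \<phi> n x" "\<And>n x. \<phi> n x \<le> indicator (box a b) x"
      "\<And>x. (\<lambda>n. \<phi> n x) \<longlonglongrightarrow> indicator (box a b) x" by (rule box_bump[OF ab]) (rule that)
    note [measurable] = Cc_borel[OF test_function_Cc[OF \<phi>(1)]]
    have "(\<lambda>n. \<integral>x. \<phi> n x * f x \<partial>lborel) \<longlonglongrightarrow> (\<integral>x. indicator (box a b) x * f x \<partial>lborel)"
    proof (rule integral_dominated_convergence[where w = "\<lambda>x. norm (indicator (box a b) x * f x)"])
      show "integrable lborel (\<lambda>x. norm (indicator (box a b) x * f x))" using int by (rule integrable_norm)
      show "AE x in lborel. (\<lambda>n. \<phi> n x * f x) \<longlonglongrightarrow> indicator (box a b) x * f x"
        by (intro AE_I2 tendsto_mult_right \<phi>)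
      show "AE x in lborel. norm (\<phi> n x * f x) \<le> norm (indicator (box a b) x * f x)" for n
        by (intro AE_I2) (auto simp: abs_mult \<phi> intro!: mult_right_mono)
    qed measurable
    then show ?thesis using 0[OF \<phi>(1)] by (simp add: LIMSEQ_const_iff)
  qed
  have cb: "AE x in lborel. x \<in> cbox c d \<longrightarrow> f x = 0" if cd: "cbox c d \<subseteq> D" for c d
  proof -
    \<comment> \<open>Since \<open>ennreal\<close> truncates at 0, the values 1 and -1 of s select
      the positive and the negative part of f on the box.\<close>
    let ?g = "\<lambda>s x. ennreal (s * f x * indicator (box c d) x)"
    let ?M = "\<lambda>s. density lborel (?g s)"
    have fin: "(\<integral>\<^sup>+x. ?g s x * indicator A x \<partial>lborel) < \<infinity>" if "s \<in> {1,-1}" "A \<in> sets borel" for s A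
    proof -
      have "(\<integral>\<^sup>+x. ?g s x * indicator A x \<partial>lborel) \<le> (\<integral>\<^sup>+x. ennreal (norm (indicator (box c d) x * f x)) \<partial>lborel)"
        using that by (intro nn_integral_mono) (auto simp: indicator_def intro!: ennreal_leI)
      then show ?thesis using int[of c d] by (simp add: integrable_iff_bounded le_less_trans)
    qed
    have "?M 1 = ?M (-1)"
    proof (rule measure_eqI_generator_eq)
      let ?E = "range (\<lambda>(a, b). box a b::'a set)"
      show "Int_stable ?E" by (auto simp: Int_stable_def box_Int_box)
      show "?E \<subseteq> Pow UNIV" "sets (?M 1) = sigma_sets UNIV ?E" "sets (?M (-1)) = sigma_sets UNIV ?E"
        by (simp_all add: borel_eq_box)
      let ?A = "\<lambda>n::nat. box (- (real n *\<^sub>R One)) (real n *\<^sub>R One) :: 'a set"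
      show "range ?A \<subseteq> ?E" "(\<Union>i. ?A i) = UNIV" unfolding UN_box_eq_UNIV by auto
      show "emeasure (?M 1) (?A i) \<noteq> \<infinity>" for i
        using fin[of 1 "?A i"] by (simp add: emeasure_density)
      fix X assume "X \<in> ?E"
      then obtain l u where X: "X = box l u" by auto
      obtain a b where ab: "box l u \<inter> box c d = box a b" "cbox a b \<subseteq> D"
      \<comment> \<open>An empty open box can have a nonempty closed counterpart outside D. In the
        empty case, corners are therefore chosen for which the closed box is empty as well.\<close>
      proof (cases "box l u \<inter> box c d = {}")
        case True
        obtain i :: 'a where "i \<in> Basis" using nonempty_Basis by blast
        then have "cbox (0::'a) (- One) = {}" unfolding box_eq_empty by (intro bexI[of _ i]) auto
        then have "box (0::'a) (- One) = {}" "cbox (0::'a) (- One) = {}" using box_subset_cbox by blast+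
        then show thesis using that[of 0 "- One"] True by auto
      next
        case False
        obtain a b where ab: "box l u \<inter> box c d = box a b" using box_Int_box by blast
        then have "closure (box a b) \<subseteq> closure (box c d)" by (intro closure_mono) auto
        then have "cbox a b \<subseteq> cbox c d" using False ab by (subst (asm) (1 2) closure_box) auto
        then show thesis using ab cd that by blast
      qed
      have eq: "?g s x * indicator X x = ennreal (s * (indicator (box a b) x * f x))" for s x
        using ab(1) X by (auto simp: indicator_def)
      have "integral\<^sup>L lborel (\<lambda>x. indicator (box a b) x * f x) = 0" by (rule box[OF ab(2)])
      then have "enn2real (\<integral>\<^sup>+x. ?g 1 x * indicator X x \<partial>lborel) = enn2real (\<integral>\<^sup>+x. ?g (-1) x * indicator X x \<partial>lborel)"
        unfolding eq using real_lebesgue_integral_def[OF int, of a b] by simp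
      then have "(\<integral>\<^sup>+x. ?g 1 x * indicator X x \<partial>lborel) = (\<integral>\<^sup>+x. ?g (-1) x * indicator X x \<partial>lborel)"
        (is "?a = ?b")
      proof -
        assume eq: "enn2real ?a = enn2real ?b"
        have "X \<in> sets borel" using X by simp
        then have "?a < \<infinity>" "?b < \<infinity>" by (intro fin; blast)+
        then show "?a = ?b" by (rule enn2real_cancel[OF eq])
      qed
      then show "emeasure (?M 1) X = emeasure (?M (-1)) X" using X by (simp add: emeasure_density)
    qed
    then have "AE x in lborel. ?g 1 x = ?g (-1) x"
      by (intro sigma_finite_measure.density_unique[OF sigma_finite_lborel]; measurable)
    moreover have "AE x in lborel. x \<notin> cbox c d - box c d"
      by (rule AE_not_in[OF null_sets_cbox_Diff_box])
    ultimately show ?thesis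
    proof eventually_elim
      case (elim x)
      show ?case
      proof
        assume "x \<in> cbox c d"
        then have "x \<in> box c d" using elim by auto
        then have "ennreal (f x) = ennreal (- f x)" using elim by simp
        then show "f x = 0" by (cases "f x \<ge> 0") (auto simp: ennreal_neg ennreal_eq_0_iff dest: sym)
      qed
    qed
  qed
  obtain \<D> where \<D>: "countable \<D>" "\<D> \<subseteq> Pow D" "\<And>X. X \<in> \<D> \<Longrightarrow> \<exists>a b. X = cbox a b" "\<Union>\<D> = D"
    by (rule open_countable_Union_open_cbox[OF D]) (rule that)
  have "AE x in lborel. \<forall>X\<in>\<D>. x \<in> X \<longrightarrow> f x = 0"
  proof (rule AE_ball_countable'[OF _ \<D>(1)])
    fix X assume "X \<in> \<D>"
    then obtain a b where "X = cbox a b" "cbox a b \<subseteq> D" using \<D>(2,3) by blast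
    then show "AE x in lborel. x \<in> X \<longrightarrow> f x = 0" using cb by simp
  qed
  then show ?thesis by eventually_elim (use \<D>(4) in blast)
qed

section \<open>Weak derivatives\<close>

lemma L2_iff_sqint: "f \<in> L2 D \<longleftrightarrow> sqint (lebesgue_on D) f"
  by (simp add: L2_def sqint_def)

lemma borel_lebesgue_on:
  assumes "f \<in> borel_measurable borel" shows "f \<in> borel_measurable (lebesgue_on D)"
proof -
  have "f \<in> borel_measurable lebesgue" using assms by (intro measurable_completion) simp
  then show ?thesis by (rule measurable_restrict_space1)
qed

lemma integral_lebesgue_on:
  fixes f :: "'a::euclidean_space \<Rightarrow> 'b::{banach,second_countable_topology}"
  assumes [measurable]: "f \<in> borel_measurable borel" and D: "open D" and 0: "\<And>x. x \<notin> D \<Longrightarrow> f x = 0"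
  shows "(\<integral>x. f x \<partial>lebesgue_on D) = (\<integral>x. f x \<partial>lborel)"
    and "integrable (lebesgue_on D) f \<longleftrightarrow> integrable lborel f"
proof -
  have *: "(\<lambda>x. indicator D x *\<^sub>R f x) = f" using 0 by (auto simp: indicator_def)
  have D': "D \<inter> space lebesgue \<in> sets lebesgue" using D by (auto simp: borel_open)
  show "(\<integral>x. f x \<partial>lebesgue_on D) = (\<integral>x. f x \<partial>lborel)"
    using integral_restrict_space[OF D', of f] integral_completion[of f lborel] by (simp add: *)
  show "integrable (lebesgue_on D) f \<longleftrightarrow> integrable lborel f"
    using integrable_restrict_space[OF D', of f] integrable_completion[of f lborel] by (simp add: *)
qed

lemma sqint_lebesgue_on:
  assumes "sqint lborel f" "open D" "\<And>x. x \<notin> D \<Longrightarrow> f x = 0" shows "sqint (lebesgue_on D) f"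
proof -
  have f: "f \<in> borel_measurable borel" using sqint_borel[OF assms(1)] by simp
  have "integrable (lebesgue_on D) (\<lambda>x. (norm (f x))\<^sup>2) \<longleftrightarrow> integrable lborel (\<lambda>x. (norm (f x))\<^sup>2)"
    by (rule integral_lebesgue_on(2)[OF _ assms(2)]) (use f assms(3) in auto)
  then show ?thesis using sqint_integrable[OF assms(1)] borel_lebesgue_on[OF f] by (simp add: sqint_def)
qed

lemma l2_lebesgue_on:
  assumes "f \<in> borel_measurable borel" "open D" "\<And>x. x \<notin> D \<Longrightarrow> f x = 0"
  shows "l2 (lebesgue_on D) f = l2 lborel f"
proof -
  have "(\<integral>x. (norm (f x))\<^sup>2 \<partial>lebesgue_on D) = (\<integral>x. (norm (f x))\<^sup>2 \<partial>lborel)"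
    by (rule integral_lebesgue_on(1)[OF _ assms(2)]) (use assms in auto)
  then show ?thesis by (simp add: l2_def)
qed

lemma test_function_sqint_on:
  fixes f :: "'a::euclidean_space \<Rightarrow> 'b::euclidean_space"
  assumes "test_function D f" "open D" shows "sqint (lebesgue_on D) f"
  by (rule sqint_lebesgue_on) (use assms in \<open>auto intro: test_function_sqint test_function_zero_outside\<close>)

lemma test_function_derivative_sqint_on:
  fixes f :: "'a::euclidean_space \<Rightarrow> 'b::euclidean_space"
  assumes "test_function D f" "open D"
  shows "sqint (lebesgue_on D) (\<lambda>x. frechet_derivative f (at x) v)"
  by (rule test_function_sqint_on[OF test_function_derivative]) (use assms in auto)

lemma AE_lebesgue_on:
  assumes "open D" "AE x in lborel. x \<in> D \<longrightarrow> P x" shows "AE x in lebesgue_on D. P x"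
  using assms by (subst AE_restrict_space_iff) (auto intro!: AE_completion simp: borel_open)

text \<open>Bridge from classes on D to Borel functions on the whole space that vanish off D;
  translations and reflections act on the latter.\<close>

lemma lebesgue_on_representative_real:
  fixes f :: "'a::euclidean_space \<Rightarrow> real"
  assumes D: "open D" and f: "f \<in> borel_measurable (lebesgue_on D)"
  obtains g where "g \<in> borel_measurable borel" "\<And>x. x \<notin> D \<Longrightarrow> g x = 0" "AE x in lebesgue_on D. f x = g x"
proof -
  have "(\<lambda>x. if x \<in> D then f x else 0) \<in> borel_measurable lebesgue"
    using f D by (intro borel_measurable_if_I) (auto simp: borel_open)
  then obtain g where g: "g \<in> borel_measurable lborel" "AE x in lborel. (if x \<in> D then f x else 0) = g x"
    using completion_ex_borel_measurable_real by blast
  show thesis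
  proof (rule that[of "\<lambda>x. indicator D x * g x"])
    show "(\<lambda>x. indicator D x * g x) \<in> borel_measurable borel"
      using g(1) D by (auto intro!: borel_measurable_times borel_measurable_indicator borel_open)
    show "AE x in lebesgue_on D. f x = indicator D x * g x"
      by (rule AE_lebesgue_on[OF D]) (use g(2) in eventually_elim, auto)
  qed auto
qed

lemma fundamental_lemma:
  fixes f :: "'a::euclidean_space \<Rightarrow> complex"
  assumes D: "open D" and f: "sqint (lebesgue_on D) f"
    and 0: "\<And>\<phi>::'a \<Rightarrow> real. test_function D \<phi> \<Longrightarrow> (\<integral>x. \<phi> x *\<^sub>R f x \<partial>lebesgue_on D) = 0"
  shows "AE x in lebesgue_on D. f x = 0"
proof -
  have part: "AE x in lebesgue_on D. L (f x) = 0"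
    if L: "bounded_linear L" "\<And>z. \<bar>L z\<bar> \<le> norm z" for L :: "complex \<Rightarrow> real"
  proof -
    have [measurable]: "L \<in> borel_measurable borel"
      using L(1) by (intro borel_measurable_continuous_onI linear_continuous_on)
    have Lf: "sqint (lebesgue_on D) (\<lambda>x. L (f x))"
    proof (rule sqint_bound[OF _ sqint_integrable[OF f]])
      show "(\<lambda>x. L (f x)) \<in> borel_measurable (lebesgue_on D)" using sqint_borel[OF f] by measurable
      show "(norm (L (f x)))\<^sup>2 \<le> (norm (f x))\<^sup>2" for x using L(2) by (intro power_mono) auto
    qed
    obtain g where g: "g \<in> borel_measurable borel" "\<And>x. x \<notin> D \<Longrightarrow> g x = 0" "AE x in lebesgue_on D. L (f x) = g x"
      using lebesgue_on_representative_real[OF D sqint_borel[OF Lf]] by blast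
    note [measurable] = borel_lebesgue_on[OF g(1)] g(1) sqint_borel[OF Lf]
    have "integrable (lebesgue_on D) (\<lambda>x. (norm (g x))\<^sup>2)"
      by (rule integrable_cong_AE_imp[OF sqint_integrable[OF Lf]]) (use g(3) in auto)
    then have sg: "sqint lborel g"
      using integral_lebesgue_on(2)[of "\<lambda>x. (norm (g x))\<^sup>2" D] g D by (simp add: sqint_def)
    have "AE x in lborel. x \<in> D \<longrightarrow> g x = 0"
    proof (rule fundamental_lemma_real[OF sg D])
      fix \<phi> :: "'a \<Rightarrow> real" assume \<phi>: "test_function D \<phi>"
      note [measurable] = Cc_borel[OF test_function_Cc[OF \<phi>]] sqint_borel[OF test_function_sqint_on[OF \<phi> D]]
      have "(\<integral>x. \<phi> x * g x \<partial>lborel) = (\<integral>x. \<phi> x * g x \<partial>lebesgue_on D)"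
        using D g by (intro integral_lebesgue_on[symmetric]) auto
      also have "\<dots> = (\<integral>x. \<phi> x * L (f x) \<partial>lebesgue_on D)"
        by (rule integral_cong_AE) (use g(3) in auto)
      also have "\<dots> = (\<integral>x. L (\<phi> x *\<^sub>R f x) \<partial>lebesgue_on D)"
        using L(1) by (simp add: linear_cmul bounded_linear.linear)
      also have "\<dots> = L (\<integral>x. \<phi> x *\<^sub>R f x \<partial>lebesgue_on D)"
        by (rule integral_bounded_linear[OF L(1) sqint_integrable_product[OF test_function_sqint_on[OF \<phi> D] f]])
      finally show "(\<integral>x. \<phi> x * g x \<partial>lborel) = 0"
        using 0[OF \<phi>] L(1) by (simp add: linear_0 bounded_linear.linear)
    qed
    then have "AE x in lebesgue_on D. g x = 0" by (rule AE_lebesgue_on[OF D])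
    with g(3) show ?thesis by eventually_elim simp
  qed
  have "AE x in lebesgue_on D. Re (f x) = 0" "AE x in lebesgue_on D. Im (f x) = 0"
    by (rule part[OF bounded_linear_Re abs_Re_le_cmod] part[OF bounded_linear_Im abs_Im_le_cmod])+
  then show ?thesis by eventually_elim (simp add: complex_eq_iff)
qed

section \<open>Uniqueness of weak derivatives and the gradient integral\<close>

lemma weak_partial_unique:
  assumes D: "open D" and g: "g \<in> L2 D" "is_weak_partial D b u g" and h: "h \<in> L2 D" "is_weak_partial D b u h"
  shows "AE x in lebesgue_on D. g x = h x"
proof -
  have "AE x in lebesgue_on D. g x - h x = 0"
  proof (rule fundamental_lemma[OF D])
    show "sqint (lebesgue_on D) (\<lambda>x. g x - h x)" using g h by (auto simp: L2_iff_sqint intro: sqint_diff)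
    fix \<phi> :: "'a \<Rightarrow> real" assume \<phi>: "test_function D \<phi>"
    have "(\<integral>x. \<phi> x *\<^sub>R g x \<partial>lebesgue_on D) = (\<integral>x. \<phi> x *\<^sub>R h x \<partial>lebesgue_on D)"
      using g h \<phi> unfolding is_weak_partial_def by (metis neg_equal_iff_equal)
    then show "(\<integral>x. \<phi> x *\<^sub>R (g x - h x) \<partial>lebesgue_on D) = 0"
      using g(1) h(1) test_function_sqint_on[OF \<phi> D]
      by (simp add: scaleR_diff_right Bochner_Integration.integral_diff sqint_integrable_product L2_iff_sqint)
  qed
  then show ?thesis by eventually_elim simp
qed

lemma weak_partial_AE:
  assumes "open D" "g \<in> L2 D" "is_weak_partial D b u g"
  shows "weak_partial D b u \<in> L2 D" "is_weak_partial D b u (weak_partial D b u)"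
    "AE x in lebesgue_on D. weak_partial D b u x = g x"
proof -
  have *: "weak_partial D b u \<in> L2 D \<and> is_weak_partial D b u (weak_partial D b u)"
    unfolding weak_partial_def by (rule someI[of _ g]) (use assms in auto)
  then show "weak_partial D b u \<in> L2 D" "is_weak_partial D b u (weak_partial D b u)" by auto
  show "AE x in lebesgue_on D. weak_partial D b u x = g x"
    using weak_partial_unique[OF assms(1)] * assms(2,3) by blast
qed

lemma is_weak_partial_diff:
  assumes D: "open D" and "u \<in> L2 D" "v \<in> L2 D" "g \<in> L2 D" "h \<in> L2 D"
    and w: "is_weak_partial D b u g" "is_weak_partial D b v h"
  shows "is_weak_partial D b (\<lambda>x. u x - v x) (\<lambda>x. g x - h x)"
  unfolding is_weak_partial_def
proof (intro allI impI)
  fix \<phi> :: "'a \<Rightarrow> real" assume \<phi>: "test_function D \<phi>"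
  note sq = test_function_sqint_on[OF \<phi> D] test_function_derivative_sqint_on[OF \<phi> D]
    assms(2-5)[unfolded L2_iff_sqint]
  show "(\<integral>x. frechet_derivative \<phi> (at x) b *\<^sub>R (u x - v x) \<partial>lebesgue_on D) =
      - (\<integral>x. \<phi> x *\<^sub>R (g x - h x) \<partial>lebesgue_on D)"
    using w \<phi> sq
    by (simp add: scaleR_diff_right Bochner_Integration.integral_diff sqint_integrable_product is_weak_partial_def)
qed

lemma test_function_weak_partial:
  assumes D: "open D" and u: "test_function D u"
  shows "u \<in> L2 D" "(\<lambda>x. frechet_derivative u (at x) b) \<in> L2 D"
    "is_weak_partial D b u (\<lambda>x. frechet_derivative u (at x) b)"
proof -
  show "u \<in> L2 D" "(\<lambda>x. frechet_derivative u (at x) b) \<in> L2 D"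
    using test_function_sqint_on[OF u D] test_function_derivative_sqint_on[OF u D] by (auto simp: L2_iff_sqint)
  show "is_weak_partial D b u (\<lambda>x. frechet_derivative u (at x) b)"
    unfolding is_weak_partial_def
  proof (intro allI impI)
    fix \<phi> :: "'a \<Rightarrow> real" assume \<phi>: "test_function D \<phi>"
    note [measurable] = Cc_borel[OF test_function_Cc[OF u]] Cc_borel[OF test_function_Cc[OF \<phi>]]
      Cc_borel[OF test_function_Cc[OF test_function_derivative[OF u]]]
      Cc_borel[OF test_function_Cc[OF test_function_derivative[OF \<phi>]]]
    show "(\<integral>x. frechet_derivative \<phi> (at x) b *\<^sub>R u x \<partial>lebesgue_on D) =
       - (\<integral>x. \<phi> x *\<^sub>R frechet_derivative u (at x) b \<partial>lebesgue_on D)"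
      using integration_by_parts[OF \<phi> test_function_smooth[OF u], of b] D
        test_function_zero_outside[OF \<phi>] test_function_zero_outside[OF u]
      by (subst (1 2) integral_lebesgue_on(1)) auto
  qed
qed

lemma grad_norm_sq_eq:
  assumes D: "open D" and g: "\<And>b. b \<in> Basis \<Longrightarrow> g b \<in> L2 D" "\<And>b. b \<in> Basis \<Longrightarrow> is_weak_partial D b u (g b)"
  shows "(\<integral>x. grad_norm_sq D u x \<partial>lebesgue_on D) = (\<Sum>b\<in>Basis. (l2 (lebesgue_on D) (g b))\<^sup>2)"
proof -
  note w = weak_partial_AE[OF D g]
  have "(\<integral>x. grad_norm_sq D u x \<partial>lebesgue_on D) = (\<Sum>b\<in>Basis. (l2 (lebesgue_on D) (weak_partial D b u))\<^sup>2)"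
    unfolding grad_norm_sq_def l2_sq
    by (rule Bochner_Integration.integral_sum) (use w(1) in \<open>auto simp: L2_iff_sqint intro: sqint_integrable\<close>)
  also have "\<dots> = (\<Sum>b\<in>Basis. (l2 (lebesgue_on D) (g b))\<^sup>2)"
  proof (rule sum.cong[OF refl])
    fix b :: 'a assume b: "b \<in> Basis"
    have "l2 (lebesgue_on D) (weak_partial D b u) = l2 (lebesgue_on D) (g b)"
      using w[OF b b] g(1)[OF b] by (intro l2_cong_AE) (auto simp: L2_iff_sqint dest: sqint_borel)
    then show "(l2 (lebesgue_on D) (weak_partial D b u))\<^sup>2 = (l2 (lebesgue_on D) (g b))\<^sup>2" by simp
  qed
  finally show ?thesis .
qed

lemma dirichlet_eq_l2_on:
  fixes f :: "'a::euclidean_space \<Rightarrow> 'b::euclidean_space"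
  assumes D: "open D" and f: "test_function D f"
  shows "dirichlet f = (\<Sum>b\<in>Basis. (l2 (lebesgue_on D) (\<lambda>x. frechet_derivative f (at x) b))\<^sup>2)"
proof -
  have "l2 (lebesgue_on D) (\<lambda>x. frechet_derivative f (at x) b) = l2 lborel (\<lambda>x. frechet_derivative f (at x) b)" for b
    by (rule l2_lebesgue_on[OF Cc_borel D])
      (use f in \<open>auto intro: test_function_Cc[OF test_function_derivative] test_function_zero_outside[OF test_function_derivative]\<close>)
  then show ?thesis by (simp add: dirichlet_eq_l2[OF f])
qed

section \<open>Relaxation of the Dirichlet integral\<close>

text \<open>\<open>H10_le D u c\<close> expresses \<open>u \<in> H\<^sup>1\<^sub>0(D)\<close> and \<open>\<integral>|\<nabla>u|\<^sup>2 \<le> c\<close> without mentioning weak derivatives;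
  in this form the notion is closed under \<open>L\<^sup>2\<close> limits by construction.\<close>

definition H10_le :: "'a::euclidean_space set \<Rightarrow> ('a \<Rightarrow> real) \<Rightarrow> real \<Rightarrow> bool" where
  "H10_le D u c \<longleftrightarrow> sqint lborel u \<and>
     (\<forall>e>0. \<exists>\<phi>::'a \<Rightarrow> real. test_function D \<phi> \<and> l2 lborel (\<lambda>x. \<phi> x - u x) < e \<and> dirichlet \<phi> < c + e)"

lemma H10_le_sqint: "H10_le D u c \<Longrightarrow> sqint lborel u"
  by (simp add: H10_le_def)

lemma H10_le_approx:
  assumes "H10_le D u c" "e > 0"
  obtains \<phi> :: "'a::euclidean_space \<Rightarrow> real"
  where "test_function D \<phi>" "l2 lborel (\<lambda>x. \<phi> x - u x) < e" "dirichlet \<phi> < c + e"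
  using assms by (auto simp: H10_le_def)

lemma H10_le_sequence:
  assumes "H10_le D u c"
  obtains \<phi> :: "nat \<Rightarrow> 'a::euclidean_space \<Rightarrow> real" where "\<And>n. test_function D (\<phi> n)"
    "(\<lambda>n. l2 lborel (\<lambda>x. \<phi> n x - u x)) \<longlonglongrightarrow> 0" "\<And>n. dirichlet (\<phi> n) < c + 1 / real (Suc n)"
proof -
  have "\<exists>\<phi>::'a \<Rightarrow> real. test_function D \<phi> \<and> l2 lborel (\<lambda>x. \<phi> x - u x) < 1 / real (Suc n)
      \<and> dirichlet \<phi> < c + 1 / real (Suc n)" for n
    using assms unfolding H10_le_def by simp
  then obtain \<phi> :: "nat \<Rightarrow> 'a \<Rightarrow> real" where \<phi>: "\<And>n. test_function D (\<phi> n)"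
    "\<And>n. l2 lborel (\<lambda>x. \<phi> n x - u x) < 1 / real (Suc n)" "\<And>n. dirichlet (\<phi> n) < c + 1 / real (Suc n)"
    by metis
  have "(\<lambda>n. l2 lborel (\<lambda>x. \<phi> n x - u x)) \<longlonglongrightarrow> 0"
    by (rule Lim_null_comparison[OF _ LIMSEQ_Suc[OF lim_1_over_n]])
      (use \<phi>(2) in \<open>auto intro!: always_eventually less_imp_le simp del: of_nat_Suc\<close>)
  with \<phi> show thesis by (intro that) auto
qed

lemma H10_leI:
  fixes u :: "'a::euclidean_space \<Rightarrow> real"
  assumes u: "sqint lborel u" and \<phi>: "\<And>n. test_function D (\<phi> n)"
    and lim: "(\<lambda>n. l2 lborel (\<lambda>x. \<phi> n x - u x)) \<longlonglongrightarrow> 0"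
    and le: "\<And>n. dirichlet (\<phi> n) \<le> d n" "d \<longlonglongrightarrow> c"
  shows "H10_le D u c"
  unfolding H10_le_def
proof (intro conjI allI impI u)
  fix e :: real assume e: "e > 0"
  have "\<forall>\<^sub>F n in sequentially. l2 lborel (\<lambda>x. \<phi> n x - u x) < e" by (rule order_tendstoD(2)[OF lim e])
  moreover have "\<forall>\<^sub>F n in sequentially. d n < c + e" by (rule order_tendstoD(2)[OF le(2)]) (use e in simp)
  ultimately have "\<forall>\<^sub>F n in sequentially. l2 lborel (\<lambda>x. \<phi> n x - u x) < e \<and> dirichlet (\<phi> n) < c + e"
    by eventually_elim (use le(1) in \<open>auto intro: le_less_trans\<close>)
  then show "\<exists>\<phi>::'a \<Rightarrow> real. test_function D \<phi> \<and> l2 lborel (\<lambda>x. \<phi> x - u x) < e \<and> dirichlet \<phi> < c + e"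
    using \<phi> eventually_happens'[OF sequentially_bot] by blast
qed

lemma H10_le_closed:
  assumes w: "\<And>n. H10_le D (w n) (d n)" and u: "sqint lborel u"
    and lim: "(\<lambda>n. l2 lborel (\<lambda>x. w n x - u x)) \<longlonglongrightarrow> 0" "d \<longlonglongrightarrow> c"
  shows "H10_le D u c"
proof -
  have "\<exists>\<phi>::'a \<Rightarrow> real. test_function D \<phi> \<and> l2 lborel (\<lambda>x. \<phi> x - w n x) < 1 / real (Suc n)
      \<and> dirichlet \<phi> < d n + 1 / real (Suc n)" for n
    using w[of n] unfolding H10_le_def by simp
  then obtain \<phi> :: "nat \<Rightarrow> 'a \<Rightarrow> real" where \<phi>: "\<And>n. test_function D (\<phi> n)"
    "\<And>n. l2 lborel (\<lambda>x. \<phi> n x - w n x) < 1 / real (Suc n)" "\<And>n. dirichlet (\<phi> n) < d n + 1 / real (Suc n)"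
    by metis
  note z = LIMSEQ_Suc[OF lim_1_over_n]
  show ?thesis
  proof (rule H10_leI[OF u \<phi>(1) _ less_imp_le[OF \<phi>(3)]])
    have "(\<lambda>n. 1 / real (Suc n) + l2 lborel (\<lambda>x. w n x - u x)) \<longlonglongrightarrow> 0"
      using tendsto_add[OF z lim(1)] by simp
    then show "(\<lambda>n. l2 lborel (\<lambda>x. \<phi> n x - u x)) \<longlonglongrightarrow> 0"
    proof (rule Lim_null_comparison[rotated], intro always_eventually allI)
      fix n
      have "l2 lborel (\<lambda>x. \<phi> n x - u x) \<le> l2 lborel (\<lambda>x. \<phi> n x - w n x) + l2 lborel (\<lambda>x. w n x - u x)"
        by (rule l2_triangle_diff[OF test_function_sqint[OF \<phi>(1)] H10_le_sqint[OF w] u])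
      then show "norm (l2 lborel (\<lambda>x. \<phi> n x - u x)) \<le> 1 / real (Suc n) + l2 lborel (\<lambda>x. w n x - u x)"
        using \<phi>(2)[of n] by simp
    qed
    show "(\<lambda>n. d n + 1 / real (Suc n)) \<longlonglongrightarrow> c" using tendsto_add[OF lim(2) z] by simp
  qed
qed

lemma H10_le_nonneg:
  assumes "H10_le D u c" shows "0 \<le> c"
proof (rule field_le_epsilon)
  fix e :: real assume "e > 0"
  then obtain \<phi> :: "'a \<Rightarrow> real" where "dirichlet \<phi> < c + e" using assms by (auto simp: H10_le_def)
  then show "0 \<le> c + e" using dirichlet_nonneg[of \<phi>] by simp
qed

lemma H10_le_test:
  fixes \<phi> :: "'a::euclidean_space \<Rightarrow> real"
  assumes "test_function D \<phi>" shows "H10_le D \<phi> (dirichlet \<phi>)"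
  unfolding H10_le_def using assms test_function_sqint[OF assms]
  by (auto intro!: exI[of _ \<phi>] simp: l2_def)

subsection \<open>From \<open>H10\<close> to the relaxed class\<close>

lemma H10_approx:
  fixes D :: "'a::euclidean_space set"
  assumes D: "open D" and \<Phi>: "\<Phi> \<in> H10 D"
  obtains \<phi> :: "nat \<Rightarrow> 'a \<Rightarrow> complex" where "\<And>n. test_function D (\<phi> n)"
    "(\<lambda>n. l2 (lebesgue_on D) (\<lambda>x. \<phi> n x - \<Phi> x)) \<longlonglongrightarrow> 0"
    "(\<lambda>n. dirichlet (\<phi> n)) \<longlonglongrightarrow> (\<integral>x. grad_norm_sq D \<Phi> x \<partial>lebesgue_on D)"
proof -
  let ?M = "lebesgue_on D"
  obtain \<phi> :: "nat \<Rightarrow> 'a \<Rightarrow> complex" where \<phi>: "\<And>n. test_function D (\<phi> n)"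
    and lim: "(\<lambda>n. H1_norm D (\<lambda>x. \<Phi> x - \<phi> n x)) \<longlonglongrightarrow> 0" and H1: "\<Phi> \<in> H1 D"
    using \<Phi> unfolding H10_def by blast
  have L: "\<Phi> \<in> L2 D" using H1 by (simp add: H1_def)
  define g where "g b = weak_partial D b \<Phi>" for b
  have g: "g b \<in> L2 D" "is_weak_partial D b \<Phi> (g b)" if "b \<in> Basis" for b
    using H1 that weak_partial_AE(1,2)[OF D] unfolding H1_def g_def by blast+
  let ?p = "\<lambda>n b x. frechet_derivative (\<phi> n) (at x) b"
  note t = test_function_weak_partial[OF D \<phi>]
  have dL: "(\<lambda>x. g b x - ?p n b x) \<in> L2 D" if "b \<in> Basis" for b n
    using g(1)[OF that] t(2) by (auto simp: L2_iff_sqint intro: sqint_diff)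
  have "(H1_norm D (\<lambda>x. \<Phi> x - \<phi> n x))\<^sup>2 = (l2 ?M (\<lambda>x. \<Phi> x - \<phi> n x))\<^sup>2 + (\<Sum>b\<in>Basis. (l2 ?M (\<lambda>x. g b x - ?p n b x))\<^sup>2)" for n
  proof -
    have "(\<integral>x. grad_norm_sq D (\<lambda>x. \<Phi> x - \<phi> n x) x \<partial>?M) = (\<Sum>b\<in>Basis. (l2 ?M (\<lambda>x. g b x - ?p n b x))\<^sup>2)"
      by (rule grad_norm_sq_eq[OF D]) (use dL is_weak_partial_diff[OF D L t(1) g(1) t(2) g(2) t(3)] in auto)
    then show ?thesis unfolding H1_norm_def l2_sq[symmetric] by (simp add: sum_nonneg)
  qed
  then have le: "l2 ?M (\<lambda>x. \<Phi> x - \<phi> n x) \<le> H1_norm D (\<lambda>x. \<Phi> x - \<phi> n x)"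
    "b \<in> Basis \<Longrightarrow> l2 ?M (\<lambda>x. g b x - ?p n b x) \<le> H1_norm D (\<lambda>x. \<Phi> x - \<phi> n x)" for n b
  proof -
    assume eq: "\<And>n. (H1_norm D (\<lambda>x. \<Phi> x - \<phi> n x))\<^sup>2 = (l2 ?M (\<lambda>x. \<Phi> x - \<phi> n x))\<^sup>2 + (\<Sum>b\<in>Basis. (l2 ?M (\<lambda>x. g b x - ?p n b x))\<^sup>2)"
    have nn: "0 \<le> H1_norm D (\<lambda>x. \<Phi> x - \<phi> n x)"
      unfolding H1_norm_def by (intro real_sqrt_ge_zero add_nonneg_nonneg integral_nonneg_AE AE_I2)
        (auto simp: grad_norm_sq_def intro!: sum_nonneg)
    show "l2 ?M (\<lambda>x. \<Phi> x - \<phi> n x) \<le> H1_norm D (\<lambda>x. \<Phi> x - \<phi> n x)"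
      by (rule power2_le_imp_le[OF _ nn]) (simp add: eq sum_nonneg)
    show "l2 ?M (\<lambda>x. g b x - ?p n b x) \<le> H1_norm D (\<lambda>x. \<Phi> x - \<phi> n x)" if "b \<in> Basis"
      by (rule power2_le_imp_le[OF _ nn])
        (use member_le_sum[OF that, of "\<lambda>b. (l2 ?M (\<lambda>x. g b x - ?p n b x))\<^sup>2"] in \<open>simp add: eq add_increasing\<close>)
  qed
  show thesis
  proof (rule that[OF \<phi>])
    show "(\<lambda>n. l2 ?M (\<lambda>x. \<phi> n x - \<Phi> x)) \<longlonglongrightarrow> 0"
      by (rule Lim_null_comparison[OF _ lim]) (use le(1) in \<open>simp add: l2_diff_commute[of _ "\<phi> _"]\<close>)
    have "(\<lambda>n. l2 ?M (?p n b)) \<longlonglongrightarrow> l2 ?M (g b)" if b: "b \<in> Basis" for b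
    proof (rule l2_tendsto)
      show "(\<lambda>n. l2 ?M (\<lambda>x. ?p n b x - g b x)) \<longlonglongrightarrow> 0"
        by (rule Lim_null_comparison[OF _ lim])
          (use le(2)[OF b] in \<open>simp add: l2_diff_commute[of _ "\<lambda>x. frechet_derivative _ (at x) b"]\<close>)
    qed (use g(1)[OF b] t(2) in \<open>auto simp: L2_iff_sqint\<close>)
    then have "(\<lambda>n. \<Sum>b\<in>Basis. (l2 ?M (?p n b))\<^sup>2) \<longlonglongrightarrow> (\<Sum>b\<in>Basis. (l2 ?M (g b))\<^sup>2)"
      by (intro tendsto_intros)
    then show "(\<lambda>n. dirichlet (\<phi> n)) \<longlonglongrightarrow> (\<integral>x. grad_norm_sq D \<Phi> x \<partial>?M)"
      by (simp add: grad_norm_sq_eq[OF D g] dirichlet_eq_l2_on[OF D \<phi>])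
  qed
qed

text \<open>A smooth modulus. Subtracting e makes it vanish at 0, so that composing it with a test
  function does not enlarge the support.\<close>

definition smooth_norm :: "real \<Rightarrow> complex \<Rightarrow> real" where
  "smooth_norm e z = sqrt ((Re z)\<^sup>2 + (Im z)\<^sup>2 + e\<^sup>2) - e"

lemma smooth_norm_bounds:
  assumes "e > 0"
  shows "0 \<le> smooth_norm e z" "\<bar>smooth_norm e z - norm z\<bar> \<le> e"
proof -
  have "sqrt (e\<^sup>2) \<le> sqrt ((Re z)\<^sup>2 + (Im z)\<^sup>2 + e\<^sup>2)" by (intro real_sqrt_le_mono) auto
  then show "0 \<le> smooth_norm e z" using assms by (simp add: smooth_norm_def)
  have "norm z \<le> sqrt ((Re z)\<^sup>2 + (Im z)\<^sup>2 + e\<^sup>2)" unfolding cmod_def by (intro real_sqrt_le_mono) auto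
  moreover have "sqrt ((Re z)\<^sup>2 + (Im z)\<^sup>2 + e\<^sup>2) \<le> norm z + e"
    using sqrt_add_le_add_sqrt[of "(Re z)\<^sup>2 + (Im z)\<^sup>2" "e\<^sup>2"] assms by (simp add: cmod_def)
  ultimately show "\<bar>smooth_norm e z - norm z\<bar> \<le> e" unfolding smooth_norm_def by linarith
qed

text \<open>The diamagnetic inequality at the smooth level: the derivative of the regularised
  modulus is the real part of the product of the conjugate of \<phi> with its derivative, divided by
  sqrt (|\<phi>|^2 + e^2), and this is at most the modulus of the derivative.\<close>

lemma smooth_norm_test:
  fixes \<phi> :: "'a::euclidean_space \<Rightarrow> complex"
  assumes \<phi>: "test_function D \<phi>" and e: "e > 0"
  shows "test_function D (\<lambda>x. smooth_norm e (\<phi> x))" "dirichlet (\<lambda>x. smooth_norm e (\<phi> x)) \<le> dirichlet \<phi>"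
proof -
  obtain K where K: "compact K" "K \<subseteq> D" "\<And>x. x \<notin> K \<Longrightarrow> \<phi> x = 0"
    by (rule test_function_support[OF \<phi>]) (rule that)
  let ?q = "\<lambda>x. Re (\<phi> x) * Re (\<phi> x) + Im (\<phi> x) * Im (\<phi> x) + e\<^sup>2"
  have q: "?q x > 0" for x using e by (intro add_nonneg_pos) auto
  have eq: "smooth_norm e (\<phi> x) = sqrt (?q x) - e" for x by (simp add: smooth_norm_def power2_eq_square)
  note R = smooth_bounded_linear[OF bounded_linear_Re test_function_smooth[OF \<phi>]]
  note I = smooth_bounded_linear[OF bounded_linear_Im test_function_smooth[OF \<phi>]]
  have "smooth (\<lambda>x. smooth_norm e (\<phi> x))"
    unfolding eq using q by (intro smooth_diff smooth_const smooth_sqrt smooth_add smooth_mult R I) auto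
  then show T: "test_function D (\<lambda>x. smooth_norm e (\<phi> x))"
    by (rule test_functionI[OF _ K(1,2)]) (use K(3) e in \<open>simp add: smooth_norm_def\<close>)
  have "(norm (frechet_derivative (\<lambda>x. smooth_norm e (\<phi> x)) (at x) b))\<^sup>2 \<le> (norm (frechet_derivative \<phi> (at x) b))\<^sup>2" for x b
  proof -
    define d where "d = frechet_derivative \<phi> (at x) b"
    define p where "p = Re (\<phi> x) * Re d + Im (\<phi> x) * Im d"
    note D = test_function_has_derivative[OF \<phi>, of x]
    note DR = bounded_linear.has_derivative[OF bounded_linear_Re D]
    note DI = bounded_linear.has_derivative[OF bounded_linear_Im D]
    have aux: "(a * (2 * b) + c * (2 * d)) / (2 * s) = (a * b + c * d) / s" for a b c d s :: real
      by (subst (2) mult_divide_mult_cancel_left[of 2, symmetric]) (simp_all add: algebra_simps)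
    have "frechet_derivative (\<lambda>x. smooth_norm e (\<phi> x)) (at x) b = p / sqrt (?q x)"
      unfolding eq
      by (rule frechet_derivative_eqI[THEN trans, OF has_derivative_diff[OF has_derivative_real_sqrt[OF q
              has_derivative_add[OF has_derivative_add[OF has_derivative_mult[OF DR DR] has_derivative_mult[OF DI DI]] has_derivative_const]] has_derivative_const]])
        (simp add: p_def d_def field_simps aux)
    then have eq2: "(norm (frechet_derivative (\<lambda>x. smooth_norm e (\<phi> x)) (at x) b))\<^sup>2 = p\<^sup>2 / ?q x"
      using q[of x] by (simp add: power_divide)
    have "p\<^sup>2 \<le> ((Re (\<phi> x))\<^sup>2 + (Im (\<phi> x))\<^sup>2) * ((Re d)\<^sup>2 + (Im d)\<^sup>2)"
      \<comment> \<open>Lagrange's identity in the plane: the difference of the two sides is the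
        square of Re \<phi> Im d - Im \<phi> Re d.\<close>
      unfolding p_def using zero_le_power2[of "Re (\<phi> x) * Im d - Im (\<phi> x) * Re d"]
      by (simp add: power2_eq_square algebra_simps)
    also have "\<dots> \<le> ?q x * (norm d)\<^sup>2"
      unfolding cmod_power2 by (intro mult_right_mono) (auto simp: power2_eq_square)
    finally have "p\<^sup>2 / ?q x \<le> (norm d)\<^sup>2" by (subst pos_divide_le_eq[OF q]) (simp only: mult.commute)
    then show ?thesis unfolding eq2 d_def .
  qed
  then show "dirichlet (\<lambda>x. smooth_norm e (\<phi> x)) \<le> dirichlet \<phi>"
    unfolding dirichlet_def
    by (intro integral_mono dirichlet_integrable[OF T] dirichlet_integrable[OF \<phi>] sum_mono)
qed

lemma finite_measure_lebesgue_on: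
  assumes "open D" "bounded D" shows "finite_measure (lebesgue_on D)"
proof
  have D: "D \<in> lmeasurable" using assms by (simp add: bounded_set_imp_lmeasurable borel_open)
  then have "emeasure (lebesgue_on D) D = emeasure lebesgue D" by (intro emeasure_restrict_space) auto
  with D show "emeasure (lebesgue_on D) (space (lebesgue_on D)) \<noteq> \<infinity>"
    by (metis fmeasurableD2 infinity_ennreal_def space_lebesgue_on)
qed

text \<open>The regularised moduli of approximating test functions converge to |\<Phi>| and do not
  have larger Dirichlet integrals. Boundedness of D enters because the regularisation error is only
  uniformly small: an error e has norm e times the square root of the volume of D.\<close>

lemma H10_norm_relaxed:
  fixes D :: "'a::euclidean_space set"
  assumes D: "open D" "bounded D" and \<Phi>: "\<Phi> \<in> H10 D"
  obtains u :: "'a \<Rightarrow> real" where "u \<in> borel_measurable borel" "\<And>x. 0 \<le> u x" "\<And>x. x \<notin> D \<Longrightarrow> u x = 0"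
    "AE x in lebesgue_on D. norm (\<Phi> x) = u x" "H10_le D u (\<integral>x. grad_norm_sq D \<Phi> x \<partial>lebesgue_on D)"
proof -
  let ?M = "lebesgue_on D"
  interpret finite_measure ?M by (rule finite_measure_lebesgue_on[OF D])
  have s\<Phi>: "sqint ?M \<Phi>" using \<Phi> by (simp add: H10_def H1_def L2_iff_sqint)
  note [measurable] = sqint_borel[OF s\<Phi>]
  have sn: "sqint ?M (\<lambda>x. norm (\<Phi> x))"
    by (rule sqint_bound[OF _ sqint_integrable[OF s\<Phi>]]) auto
  obtain u0 where u0: "u0 \<in> borel_measurable borel" "\<And>x. x \<notin> D \<Longrightarrow> u0 x = 0" "AE x in ?M. norm (\<Phi> x) = u0 x"
    by (rule lebesgue_on_representative_real[OF D(1) sqint_borel[OF sn]]) (rule that)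
  define u where "u x = max 0 (u0 x)" for x
  have u: "u \<in> borel_measurable borel" "\<And>x. 0 \<le> u x" "\<And>x. x \<notin> D \<Longrightarrow> u x = 0"
    using u0 by (auto simp: u_def[abs_def])
  have AE: "AE x in ?M. norm (\<Phi> x) = u x"
    using u0(3) by eventually_elim (metis max.absorb2 norm_ge_zero u_def)
  note [measurable] = u(1) borel_lebesgue_on[OF u(1), of D]
  have "integrable ?M (\<lambda>x. (norm (u x))\<^sup>2)"
    by (rule integrable_cong_AE_imp[OF sqint_integrable[OF sn]]) (use AE in auto)
  then have su: "sqint lborel u"
    using integral_lebesgue_on(2)[of "\<lambda>x. (norm (u x))\<^sup>2" D] u D by (simp add: sqint_def)
  obtain \<phi> :: "nat \<Rightarrow> 'a \<Rightarrow> complex" where \<phi>: "\<And>n. test_function D (\<phi> n)"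
    "(\<lambda>n. l2 ?M (\<lambda>x. \<phi> n x - \<Phi> x)) \<longlonglongrightarrow> 0"
    "(\<lambda>n. dirichlet (\<phi> n)) \<longlonglongrightarrow> (\<integral>x. grad_norm_sq D \<Phi> x \<partial>?M)"
    by (rule H10_approx[OF D(1) \<Phi>]) (rule that)
  let ?e = "\<lambda>n. 1 / real (Suc n)"
  let ?\<psi> = "\<lambda>n x. smooth_norm (?e n) (\<phi> n x)"
  have \<psi>: "test_function D (?\<psi> n)" "dirichlet (?\<psi> n) \<le> dirichlet (\<phi> n)" for n
    using smooth_norm_test[OF \<phi>(1), of "?e n" n] by auto
  have sc: "sqint ?M (\<lambda>x. c)" for c :: real by (simp add: sqint_def)
  have bd: "l2 lborel (\<lambda>x. ?\<psi> n x - u x) \<le> ?e n * l2 ?M (\<lambda>x. 1::real) + l2 ?M (\<lambda>x. \<phi> n x - \<Phi> x)" for n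
  proof -
    note [measurable] = Cc_borel[OF test_function_Cc[OF \<psi>(1)]] sqint_borel[OF test_function_sqint_on[OF \<psi>(1) D(1)]]
      sqint_borel[OF test_function_sqint_on[OF \<phi>(1) D(1)]]
    have s1: "sqint ?M (\<lambda>x. norm (\<phi> n x))"
      by (rule sqint_bound[OF _ sqint_integrable[OF test_function_sqint_on[OF \<phi>(1)[of n] D(1)]]]) auto
    have "l2 lborel (\<lambda>x. ?\<psi> n x - u x) = l2 ?M (\<lambda>x. ?\<psi> n x - u x)"
      by (rule l2_lebesgue_on[symmetric, OF borel_measurable_diff[OF Cc_borel[OF test_function_Cc[OF \<psi>(1)]] u(1)] D(1)])
        (use u(3) test_function_zero_outside[OF \<psi>(1)] in auto)
    also have "\<dots> = l2 ?M (\<lambda>x. ?\<psi> n x - norm (\<Phi> x))"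
    proof (rule l2_cong_AE)
      show "(\<lambda>x. ?\<psi> n x - u x) \<in> borel_measurable ?M" "(\<lambda>x. ?\<psi> n x - norm (\<Phi> x)) \<in> borel_measurable ?M"
        by measurable
      show "AE x in ?M. ?\<psi> n x - u x = ?\<psi> n x - norm (\<Phi> x)" using AE by eventually_elim simp
    qed
    also have "\<dots> \<le> l2 ?M (\<lambda>x. ?\<psi> n x - norm (\<phi> n x)) + l2 ?M (\<lambda>x. norm (\<phi> n x) - norm (\<Phi> x))"
      by (rule l2_triangle_diff[OF test_function_sqint_on[OF \<psi>(1) D(1)] s1 sn])
    also have "l2 ?M (\<lambda>x. ?\<psi> n x - norm (\<phi> n x)) \<le> l2 ?M (\<lambda>x. ?e n)"
      using smooth_norm_bounds(2)[of "?e n"]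
      by (intro l2_mono sqint_diff test_function_sqint_on[OF \<psi>(1) D(1)] s1 sc) auto
    also have "l2 ?M (\<lambda>x. ?e n) = ?e n * l2 ?M (\<lambda>x. 1::real)"
      using l2_scaleR[of ?M "?e n" "\<lambda>x. 1::real"] by simp
    also have "l2 ?M (\<lambda>x. norm (\<phi> n x) - norm (\<Phi> x)) \<le> l2 ?M (\<lambda>x. \<phi> n x - \<Phi> x)"
    proof (rule l2_mono)
      show "sqint ?M (\<lambda>x. norm (\<phi> n x) - norm (\<Phi> x))" by (rule sqint_diff[OF s1 sn])
      show "sqint ?M (\<lambda>x. \<phi> n x - \<Phi> x)" by (rule sqint_diff[OF test_function_sqint_on[OF \<phi>(1) D(1)] s\<Phi>])
      show "AE x in ?M. norm (norm (\<phi> n x) - norm (\<Phi> x)) \<le> norm (\<phi> n x - \<Phi> x)"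
        using norm_triangle_ineq3 by auto
    qed
    finally show ?thesis by simp
  qed
  have "H10_le D u (\<integral>x. grad_norm_sq D \<Phi> x \<partial>?M)"
  proof (rule H10_leI[OF su \<psi>(1) _ \<psi>(2) \<phi>(3)])
    have "(\<lambda>n. ?e n * l2 ?M (\<lambda>x. 1::real) + l2 ?M (\<lambda>x. \<phi> n x - \<Phi> x)) \<longlonglongrightarrow> 0 * l2 ?M (\<lambda>x. 1::real) + 0"
      by (intro tendsto_intros \<phi>(2) LIMSEQ_Suc[OF lim_1_over_n])
    then have "(\<lambda>n. ?e n * l2 ?M (\<lambda>x. 1::real) + l2 ?M (\<lambda>x. \<phi> n x - \<Phi> x)) \<longlonglongrightarrow> 0" by simp
    then show "(\<lambda>n. l2 lborel (\<lambda>x. ?\<psi> n x - u x)) \<longlonglongrightarrow> 0"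
      by (rule Lim_null_comparison[rotated]) (use bd in auto)
  qed
  with u AE show thesis by (rule that)
qed

subsection \<open>From the relaxed class to \<open>H10\<close>\<close>

lemma dirichlet_parallelogram:
  fixes f g :: "'a::euclidean_space \<Rightarrow> real"
  assumes f: "test_function D f" and g: "test_function D g"
  shows "dirichlet (\<lambda>x. f x - g x) = 2 * dirichlet f + 2 * dirichlet g - 4 * dirichlet (\<lambda>x. (1/2) *\<^sub>R (f x + g x))"
proof -
  have d: "frechet_derivative (\<lambda>x. f x - g x) (at x) b = frechet_derivative f (at x) b - frechet_derivative g (at x) b"
    "frechet_derivative (\<lambda>x. (1/2) *\<^sub>R (f x + g x)) (at x) b
      = (1/2) *\<^sub>R (frechet_derivative f (at x) b + frechet_derivative g (at x) b)" for x b
    by (rule frechet_derivative_test_diff[OF f g],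
        rule frechet_derivative_eqI[OF has_derivative_scaleR_right[OF has_derivative_add[OF
          test_function_has_derivative[OF f] test_function_has_derivative[OF g]]]])
  have t: "test_function D (\<lambda>x. f x - g x)" "test_function D (\<lambda>x. (1/2) *\<^sub>R (f x + g x))"
    by (intro test_function_diff test_function_scaleR test_function_add f g)+
  have "dirichlet (\<lambda>x. f x - g x) + 4 * dirichlet (\<lambda>x. (1/2) *\<^sub>R (f x + g x)) =
    (\<integral>x. (\<Sum>b\<in>Basis. (norm (frechet_derivative (\<lambda>x. f x - g x) (at x) b))\<^sup>2)
      + 4 * (\<Sum>b\<in>Basis. (norm (frechet_derivative (\<lambda>x. (1/2) *\<^sub>R (f x + g x)) (at x) b))\<^sup>2) \<partial>lborel)"
    unfolding dirichlet_def
    by (subst Bochner_Integration.integral_add) (use dirichlet_integrable[OF t(1)] dirichlet_integrable[OF t(2)] in auto)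
  also have "\<dots> = (\<integral>x. 2 * (\<Sum>b\<in>Basis. (norm (frechet_derivative f (at x) b))\<^sup>2)
      + 2 * (\<Sum>b\<in>Basis. (norm (frechet_derivative g (at x) b))\<^sup>2) \<partial>lborel)"
  proof -
    have "(norm (a - b))\<^sup>2 + 4 * (norm ((1/2) *\<^sub>R (a + b)))\<^sup>2 = 2 * (norm a)\<^sup>2 + 2 * (norm b)\<^sup>2" for a b :: real
      by (simp add: power2_eq_square field_simps)
    then show ?thesis by (simp only: d sum_distrib_left sum.distrib[symmetric])
  qed
  also have "\<dots> = 2 * dirichlet f + 2 * dirichlet g"
    unfolding dirichlet_def
    by (subst Bochner_Integration.integral_add) (use dirichlet_integrable[OF f] dirichlet_integrable[OF g] in auto)
  finally show ?thesis by simp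
qed

text \<open>Almost minimisers of the Dirichlet integral among test functions that are \<open>L\<^sup>2\<close>-close to \<open>u\<close>
  form a Cauchy sequence by the parallelogram identity; this replaces weak compactness.\<close>

lemma H10_le_cauchy:
  fixes D :: "'a::euclidean_space set"
  assumes u: "H10_le D u c"
  obtains v :: "nat \<Rightarrow> 'a \<Rightarrow> real" where "\<And>n. test_function D (v n)"
    "(\<lambda>n. l2 lborel (\<lambda>x. v n x - u x)) \<longlonglongrightarrow> 0" "\<And>n. dirichlet (v n) < c + 1 / real (Suc n)"
    "\<And>e. e > 0 \<Longrightarrow> \<exists>N. \<forall>m\<ge>N. \<forall>n\<ge>N. dirichlet (\<lambda>x. v m x - v n x) < e"
proof -
  let ?e = "\<lambda>n. 1 / real (Suc n)"
  define A where "A n = {\<phi>::'a \<Rightarrow> real. test_function D \<phi> \<and> l2 lborel (\<lambda>x. \<phi> x - u x) < ?e n}" for n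
  define d where "d n = (INF \<phi>\<in>A n. dirichlet \<phi>)" for n
  have bdd: "bdd_below (dirichlet ` A n)" for n
    by (rule bdd_belowI[of _ 0]) (auto simp: dirichlet_nonneg)
  have ne: "A n \<noteq> {}" for n
    using u by (auto simp: A_def H10_le_def simp del: of_nat_Suc dest!: spec[of _ "?e n"])
  have mono: "A m \<subseteq> A n" if "n \<le> m" for m n
  proof -
    have "?e m \<le> ?e n" using that by (simp add: frac_le)
    then show ?thesis by (auto simp: A_def)
  qed
  have dmono: "incseq d"
    unfolding incseq_def d_def by (intro allI impI cINF_superset_mono ne bdd mono) auto
  have dc: "d n \<le> c" for n
  proof (rule field_le_epsilon)
    fix e :: real assume "e > 0"
    then obtain \<phi> :: "'a \<Rightarrow> real" where \<phi>: "test_function D \<phi>" "l2 lborel (\<lambda>x. \<phi> x - u x) < min e (?e n)" "dirichlet \<phi> < c + min e (?e n)"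
      using H10_le_approx[OF u, of "min e (?e n)"] by auto
    then have "d n \<le> dirichlet \<phi>" unfolding d_def by (intro cINF_lower bdd) (auto simp: A_def)
    with \<phi> show "d n \<le> c + e" by auto
  qed
  have "\<exists>\<phi>\<in>A n. dirichlet \<phi> < d n + ?e n" for n
    using cINF_less_iff[OF ne bdd, of n "d n + ?e n"] by (simp add: d_def)
  then obtain v where v: "\<And>n. v n \<in> A n" "\<And>n. dirichlet (v n) < d n + ?e n" by metis
  have vt: "test_function D (v n)" "l2 lborel (\<lambda>x. v n x - u x) < ?e n" for n using v(1)[of n] by (auto simp: A_def)
  \<comment> \<open>\<open>A n\<close> contains the midpoint of \<open>v m\<close> and
    \<open>v n\<close>, being convex and decreasing in n, so the midpoint has Dirichlet integral at
    least \<open>d n\<close>. The parallelogram identity then bounds that of the difference; it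
    becomes small because the increasing sequence d is bounded by c and so converges.\<close>
  have est: "dirichlet (\<lambda>x. v m x - v n x) \<le> 2 * (d m - d n) + 4 * ?e n" if "n \<le> m" for m n
  proof -
    have su: "sqint lborel u" by (rule H10_le_sqint[OF u])
    have "l2 lborel (\<lambda>x. (1/2) *\<^sub>R (v m x - u x) + (1/2) *\<^sub>R (v n x - u x)) \<le> (1/2) * l2 lborel (\<lambda>x. v m x - u x) + (1/2) * l2 lborel (\<lambda>x. v n x - u x)"
      using l2_triangle[OF sqint_scaleR[OF sqint_diff[OF test_function_sqint[OF vt(1)] su]] sqint_scaleR[OF sqint_diff[OF test_function_sqint[OF vt(1)] su]], of "1/2" m "1/2" n]
      by (simp only: l2_scaleR)
    also have "\<dots> < ?e n" using vt(2)[of m] vt(2)[of n] that frac_le[of 1 1 "real (Suc n)" "real (Suc m)"] by simp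
    also have "(\<lambda>x. (1/2) *\<^sub>R (v m x - u x) + (1/2) *\<^sub>R (v n x - u x)) = (\<lambda>x. (1/2) *\<^sub>R (v m x + v n x) - u x)"
      by (auto simp: field_simps)
    finally have "(\<lambda>x. (1/2) *\<^sub>R (v m x + v n x)) \<in> A n"
      using vt(1) by (auto simp: A_def simp del: real_scaleR_def intro!: test_function_scaleR test_function_add)
    then have "d n \<le> dirichlet (\<lambda>x. (1/2) *\<^sub>R (v m x + v n x))" unfolding d_def by (intro cINF_lower bdd)
    then have "dirichlet (\<lambda>x. v m x - v n x) \<le> 2 * dirichlet (v m) + 2 * dirichlet (v n) - 4 * d n"
      using dirichlet_parallelogram[OF vt(1) vt(1), of m n] by linarith
    also have "\<dots> \<le> 2 * (d m + ?e m) + 2 * (d n + ?e n) - 4 * d n" using v(2)[of m] v(2)[of n] by simp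
    also have "\<dots> \<le> 2 * (d m - d n) + 4 * ?e n" using that frac_le[of 1 1 "real (Suc n)" "real (Suc m)"] by simp
    finally show ?thesis .
  qed
  obtain l where l: "d \<longlonglongrightarrow> l" "\<And>n. d n \<le> l"
    using incseq_convergent[OF dmono, of c] dc by blast
  show thesis
  proof (rule that[OF vt(1)])
    show "(\<lambda>n. l2 lborel (\<lambda>x. v n x - u x)) \<longlonglongrightarrow> 0"
      by (rule Lim_null_comparison[OF _ LIMSEQ_Suc[OF lim_1_over_n]])
        (use vt(2) in \<open>auto intro!: always_eventually less_imp_le simp del: of_nat_Suc\<close>)
    show "dirichlet (v n) < c + ?e n" for n using v(2)[of n] dc[of n] by simp
    fix e :: real assume e: "e > 0"
    have "(\<lambda>n. 2 * (l - d n) + 4 * ?e n) \<longlonglongrightarrow> 2 * (l - l) + 4 * 0"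
      by (intro tendsto_intros l(1) LIMSEQ_Suc[OF lim_1_over_n])
    then have "\<forall>\<^sub>F n in sequentially. 2 * (l - d n) + 4 * ?e n < e" by (rule order_tendstoD) (use e in simp)
    then obtain N where N: "\<And>n. n \<ge> N \<Longrightarrow> 2 * (l - d n) + 4 * ?e n < e" by (auto simp: eventually_sequentially)
    have *: "dirichlet (\<lambda>x. v m x - v n x) < e" if "n \<ge> N" "n \<le> m" for m n
      using est[OF that(2)] N[OF that(1)] l(2)[of m] by argo
    have sym: "dirichlet (\<lambda>x. v m x - v n x) = dirichlet (\<lambda>x. v n x - v m x)" for m n
      unfolding dirichlet_def by (simp add: frechet_derivative_test_diff[OF vt(1) vt(1)] power2_commute)
    have "dirichlet (\<lambda>x. v m x - v n x) < e" if "n \<ge> N" "m \<ge> N" for m n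
      using *[of n m] *[of m n] sym[of m n] that by (cases "n \<le> m") auto
    then show "\<exists>N. \<forall>m\<ge>N. \<forall>n\<ge>N. dirichlet (\<lambda>x. v m x - v n x) < e" by blast
  qed
qed

text \<open>Along the sequence of \<open>H10_le_cauchy\<close> the gradients converge in L^2 by
  completeness. Passing to the limit in the integration by parts formula identifies their limits as
  weak derivatives of u, so the convergence is in the norm of \<open>H1\<close>, and the bound c +
  1/(n+1) for the Dirichlet integrals becomes c.\<close>

lemma relaxed_H10:
  fixes D :: "'a::euclidean_space set"
  assumes D: "open D" and u: "H10_le D u c" and out: "\<And>x. x \<notin> D \<Longrightarrow> u x = 0"
  shows "(\<lambda>x. complex_of_real (u x)) \<in> H10 D"
    "(\<integral>x. grad_norm_sq D (\<lambda>x. complex_of_real (u x)) x \<partial>lebesgue_on D) \<le> c"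
proof -
  let ?M = "lebesgue_on D"
  let ?u = "\<lambda>x. complex_of_real (u x)"
  obtain v :: "nat \<Rightarrow> 'a \<Rightarrow> real" where v: "\<And>n. test_function D (v n)"
    "(\<lambda>n. l2 lborel (\<lambda>x. v n x - u x)) \<longlonglongrightarrow> 0" "\<And>n. dirichlet (v n) < c + 1 / real (Suc n)"
    "\<And>e. e > 0 \<Longrightarrow> \<exists>N. \<forall>m\<ge>N. \<forall>n\<ge>N. dirichlet (\<lambda>x. v m x - v n x) < e"
    by (rule H10_le_cauchy[OF u]) (rule that)
  let ?v = "\<lambda>n x. complex_of_real (v n x)"
  let ?p = "\<lambda>n b x. frechet_derivative (v n) (at x) b"
  have vt: "test_function D (?v n)" for n by (rule test_function_bounded_linear[OF v(1) bounded_linear_of_real])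
  have pv: "frechet_derivative (?v n) (at x) b = complex_of_real (?p n b x)" for n x b
    by (rule frechet_derivative_eqI[OF bounded_linear.has_derivative[OF bounded_linear_of_real test_function_has_derivative[OF v(1)]]])
  have cplx: "sqint ?M (\<lambda>x. complex_of_real (f x))" if "sqint ?M f" for f
  proof (rule sqint_bound[OF _ sqint_integrable[OF that]])
    note [measurable] = sqint_borel[OF that]
    show "(\<lambda>x. complex_of_real (f x)) \<in> borel_measurable ?M" by measurable
  qed simp
  have cl2: "l2 ?M (\<lambda>x. complex_of_real (f x)) = l2 ?M f" for f by (simp add: l2_def)
  have su: "sqint ?M u" by (rule sqint_lebesgue_on[OF H10_le_sqint[OF u] D out])
  have limu: "(\<lambda>n. l2 ?M (\<lambda>x. ?v n x - ?u x)) \<longlonglongrightarrow> 0"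
  proof -
    have "l2 ?M (\<lambda>x. ?v n x - ?u x) = l2 lborel (\<lambda>x. v n x - u x)" for n
    proof -
      have "l2 ?M (\<lambda>x. ?v n x - ?u x) = l2 ?M (\<lambda>x. v n x - u x)"
        using cl2[of "\<lambda>x. v n x - u x"] by simp
      also have "\<dots> = l2 lborel (\<lambda>x. v n x - u x)"
      proof (rule l2_lebesgue_on[OF _ D])
        note [measurable] = Cc_borel[OF test_function_Cc[OF v(1)]] sqint_borel[OF H10_le_sqint[OF u]]
        show "(\<lambda>x. v n x - u x) \<in> borel_measurable borel" by measurable
      qed (use out test_function_zero_outside[OF v(1)] in auto)
      finally show ?thesis .
    qed
    with v(2) show ?thesis by simp
  qed
  have "\<exists>g. sqint ?M g \<and> (\<lambda>n. l2 ?M (\<lambda>x. ?p n b x - g x)) \<longlonglongrightarrow> 0" if b: "b \<in> Basis" for b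
  proof -
    have C: "\<exists>N. \<forall>m\<ge>N. \<forall>n\<ge>N. l2 ?M (\<lambda>x. ?p m b x - ?p n b x) < e" if e: "e > 0" for e
    proof -
      obtain N where N: "\<And>m n. m \<ge> N \<Longrightarrow> n \<ge> N \<Longrightarrow> dirichlet (\<lambda>x. v m x - v n x) < e\<^sup>2"
        using v(4)[of "e\<^sup>2"] e by auto
      have "l2 ?M (\<lambda>x. ?p m b x - ?p n b x) < e" if "m \<ge> N" "n \<ge> N" for m n
      proof (rule power2_less_imp_less)
        have "(l2 ?M (\<lambda>x. ?p m b x - ?p n b x))\<^sup>2 \<le> (\<Sum>b\<in>Basis. (l2 ?M (\<lambda>x. ?p m b x - ?p n b x))\<^sup>2)"
          by (rule member_le_sum[OF b]) auto
        also have "\<dots> = dirichlet (\<lambda>x. v m x - v n x)"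
          by (simp add: dirichlet_eq_l2_on[OF D test_function_diff[OF v(1) v(1)]] frechet_derivative_test_diff[OF v(1) v(1)])
        finally show "(l2 ?M (\<lambda>x. ?p m b x - ?p n b x))\<^sup>2 < e\<^sup>2" using N[OF that] by simp
      qed (use e in simp)
      then show ?thesis by blast
    qed
    show ?thesis
    proof (rule l2_complete[of ?M "\<lambda>n. ?p n b"])
      show "sqint ?M (?p n b)" for n by (rule test_function_derivative_sqint_on[OF v(1) D])
      show "\<exists>N. \<forall>m\<ge>N. \<forall>n\<ge>N. l2 ?M (\<lambda>x. ?p m b x - ?p n b x) < e" if "e > 0" for e by (rule C[OF that])
      fix g assume "sqint ?M g" "(\<lambda>n. l2 ?M (\<lambda>x. ?p n b x - g x)) \<longlonglongrightarrow> 0"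
      then show ?thesis by blast
    qed
  qed
  then have "\<forall>b\<in>Basis. \<exists>g. sqint ?M g \<and> (\<lambda>n. l2 ?M (\<lambda>x. ?p n b x - g x)) \<longlonglongrightarrow> 0" ..
  from bchoice[OF this] obtain g
    where g0: "\<forall>b\<in>Basis. sqint ?M (g b) \<and> (\<lambda>n. l2 ?M (\<lambda>x. ?p n b x - g b x)) \<longlonglongrightarrow> 0" ..
  have g: "sqint ?M (g b)" "(\<lambda>n. l2 ?M (\<lambda>x. ?p n b x - g b x)) \<longlonglongrightarrow> 0" if "b \<in> Basis" for b
    using bspec[OF g0 that] by (rule conjunct1, rule conjunct2)
  let ?g = "\<lambda>b x. complex_of_real (g b x)"
  have gL: "?g b \<in> L2 D" if "b \<in> Basis" for b using cplx[OF g(1)[OF that]] by (simp add: L2_iff_sqint)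
  have limg: "(\<lambda>n. l2 ?M (\<lambda>x. frechet_derivative (?v n) (at x) b - ?g b x)) \<longlonglongrightarrow> 0" if "b \<in> Basis" for b
    using g(2)[OF that] cl2[of "\<lambda>x. ?p _ b x - g b x"] by (simp add: pv)
  have uL: "?u \<in> L2 D" using cplx[OF su] by (simp add: L2_iff_sqint)
  note t = test_function_weak_partial[OF D vt]
  have weak: "is_weak_partial D b ?u (?g b)" if b: "b \<in> Basis" for b
    unfolding is_weak_partial_def
  proof (intro allI impI)
    fix \<phi> :: "'a \<Rightarrow> real" assume \<phi>: "test_function D \<phi>"
    have 1: "(\<lambda>n. \<integral>x. frechet_derivative \<phi> (at x) b *\<^sub>R ?v n x \<partial>?M) \<longlonglongrightarrow> (\<integral>x. frechet_derivative \<phi> (at x) b *\<^sub>R ?u x \<partial>?M)"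
      using t(1) uL by (intro l2_product_tendsto limu test_function_derivative_sqint_on[OF \<phi> D]) (auto simp: L2_iff_sqint)
    have "(\<lambda>n. \<integral>x. \<phi> x *\<^sub>R frechet_derivative (?v n) (at x) b \<partial>?M) \<longlonglongrightarrow> (\<integral>x. \<phi> x *\<^sub>R ?g b x \<partial>?M)"
      using t(2) gL[OF b] by (intro l2_product_tendsto limg[OF b] test_function_sqint_on[OF \<phi> D]) (auto simp: L2_iff_sqint)
    then have "(\<lambda>n. - (\<integral>x. \<phi> x *\<^sub>R frechet_derivative (?v n) (at x) b \<partial>?M)) \<longlonglongrightarrow> - (\<integral>x. \<phi> x *\<^sub>R ?g b x \<partial>?M)"
      by (rule tendsto_minus)
    moreover have "- (\<integral>x. \<phi> x *\<^sub>R frechet_derivative (?v n) (at x) b \<partial>?M) = (\<integral>x. frechet_derivative \<phi> (at x) b *\<^sub>R ?v n x \<partial>?M)" for n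
      using t(3)[of b n] \<phi> by (simp add: is_weak_partial_def)
    ultimately have "(\<lambda>n. \<integral>x. frechet_derivative \<phi> (at x) b *\<^sub>R ?v n x \<partial>?M) \<longlonglongrightarrow> - (\<integral>x. \<phi> x *\<^sub>R ?g b x \<partial>?M)"
      by (simp only:)
    then show "(\<integral>x. frechet_derivative \<phi> (at x) b *\<^sub>R ?u x \<partial>?M) = - (\<integral>x. \<phi> x *\<^sub>R ?g b x \<partial>?M)"
      by (rule LIMSEQ_unique[OF 1])
  qed
  have H1: "?u \<in> H1 D" using uL gL weak by (auto simp: H1_def)
  have "(\<lambda>n. H1_norm D (\<lambda>x. ?u x - ?v n x)) \<longlonglongrightarrow> 0"
  proof -
    have "H1_norm D (\<lambda>x. ?u x - ?v n x) = sqrt ((l2 ?M (\<lambda>x. ?v n x - ?u x))\<^sup>2 + (\<Sum>b\<in>Basis. (l2 ?M (\<lambda>x. frechet_derivative (?v n) (at x) b - ?g b x))\<^sup>2))" for n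
    proof -
      have "(\<integral>x. grad_norm_sq D (\<lambda>x. ?u x - ?v n x) x \<partial>?M) = (\<Sum>b\<in>Basis. (l2 ?M (\<lambda>x. ?g b x - frechet_derivative (?v n) (at x) b))\<^sup>2)"
        using gL t(2) is_weak_partial_diff[OF D uL t(1) gL t(2) weak t(3)]
        by (intro grad_norm_sq_eq[OF D]) (auto simp: L2_iff_sqint intro: sqint_diff)
      then show ?thesis
        unfolding H1_norm_def l2_sq[symmetric]
        by (simp only: l2_diff_commute[of ?M ?u] l2_diff_commute[of ?M "?g _"])
    qed
    moreover have "(\<lambda>n. sqrt ((l2 ?M (\<lambda>x. ?v n x - ?u x))\<^sup>2 + (\<Sum>b\<in>Basis. (l2 ?M (\<lambda>x. frechet_derivative (?v n) (at x) b - ?g b x))\<^sup>2)))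
        \<longlonglongrightarrow> sqrt (0\<^sup>2 + (\<Sum>b\<in>(Basis::'a set). 0\<^sup>2))"
      by (intro tendsto_intros limu limg)
    ultimately show ?thesis by simp
  qed
  with H1 vt show "?u \<in> H10 D" unfolding H10_def by (intro CollectI conjI exI[of _ ?v]) auto
  have "(\<lambda>n. \<Sum>b\<in>Basis. (l2 ?M (\<lambda>x. ?p n b x))\<^sup>2) \<longlonglongrightarrow> (\<Sum>b\<in>Basis. (l2 ?M (g b))\<^sup>2)"
    by (intro tendsto_intros l2_tendsto g test_function_derivative_sqint_on[OF v(1) D])
  then have "(\<lambda>n. dirichlet (v n)) \<longlonglongrightarrow> (\<integral>x. grad_norm_sq D ?u x \<partial>?M)"
    by (simp add: grad_norm_sq_eq[OF D gL weak] dirichlet_eq_l2_on[OF D v(1)] cl2)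
  moreover have "(\<lambda>n. c + 1 / real (Suc n)) \<longlonglongrightarrow> c + 0"
    by (intro tendsto_intros LIMSEQ_Suc[OF lim_1_over_n])
  ultimately show "(\<integral>x. grad_norm_sq D ?u x \<partial>?M) \<le> c"
    using v(3) by (intro LIMSEQ_le[of "\<lambda>n. dirichlet (v n)" _ "\<lambda>n. c + 1 / real (Suc n)"]) (auto intro: less_imp_le simp del: of_nat_Suc)
qed

section \<open>A Sobolev inequality in dimension at most three\<close>

text \<open>The space is an abstract \<open>euclidean_space\<close>, so iterated integrals have to
  be introduced: the image of the product of one-dimensional Lebesgue measures under the coordinate
  map is identified as \<open>lborel\<close> by its values on boxes. The next two lemmas do the same
  in dimensions two and three.\<close>

lemma nn_integral_lborel_dim1:
  fixes f :: "'a::euclidean_space \<Rightarrow> ennreal"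
  assumes [measurable]: "f \<in> borel_measurable borel" and B: "(Basis :: 'a set) = {b}"
  shows "(\<integral>\<^sup>+x. f x \<partial>lborel) = (\<integral>\<^sup>+x. f (x *\<^sub>R b) \<partial>lborel)"
proof -
  have "b \<in> Basis" by (simp add: B)
  then have b: "b \<bullet> b = 1" by (rule inner_same_Basis)
  have "lborel = distr lborel borel (\<lambda>x. x *\<^sub>R b)"
  proof (rule lborel_eqI)
    fix l u :: 'a assume "\<And>b. b \<in> Basis \<Longrightarrow> l \<bullet> b \<le> u \<bullet> b"
    moreover have "(\<lambda>x. x *\<^sub>R b) -` box l u = {l \<bullet> b<..<u \<bullet> b}"
      by (auto simp: mem_box B b)
    ultimately show "emeasure (distr lborel borel (\<lambda>x. x *\<^sub>R b)) (box l u) = (\<Prod>b\<in>Basis. (u - l) \<bullet> b)"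
      by (simp add: emeasure_distr B inner_diff_left)
  qed simp
  then have "(\<integral>\<^sup>+x. f x \<partial>lborel) = (\<integral>\<^sup>+x. f x \<partial>distr lborel borel (\<lambda>x. x *\<^sub>R b))" by simp
  then show ?thesis by (simp add: nn_integral_distr)
qed

lemma nn_integral_lborel_dim2:
  fixes f :: "'a::euclidean_space \<Rightarrow> ennreal"
  assumes [measurable]: "f \<in> borel_measurable borel" and B: "(Basis :: 'a set) = {b, c}" "b \<noteq> c"
  shows "(\<integral>\<^sup>+x. f x \<partial>lborel) = (\<integral>\<^sup>+x. \<integral>\<^sup>+y. f (x *\<^sub>R b + y *\<^sub>R c) \<partial>lborel \<partial>lborel)"
proof -
  have m: "b \<in> Basis" "c \<in> Basis" by (simp_all add: B(1))
  have i: "b \<bullet> b = 1" "c \<bullet> c = 1" "b \<bullet> c = 0" "c \<bullet> b = 0"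
    using B(2) by (auto simp: inner_Basis m)
  let ?L = "\<lambda>(x, y). x *\<^sub>R b + y *\<^sub>R c"
  let ?M = "lborel \<Otimes>\<^sub>M lborel :: (real \<times> real) measure"
  have [measurable]: "?L \<in> borel_measurable ?M" by measurable
  have "lborel = distr ?M borel ?L"
  proof (rule lborel_eqI)
    fix l u :: 'a assume le: "\<And>b. b \<in> Basis \<Longrightarrow> l \<bullet> b \<le> u \<bullet> b"
    have pre: "?L -` box l u \<inter> space ?M = {l \<bullet> b<..<u \<bullet> b} \<times> {l \<bullet> c<..<u \<bullet> c}"
      by (auto simp: mem_box B i inner_add_left space_pair_measure)
    have "emeasure (distr ?M borel ?L) (box l u) = emeasure lborel {l \<bullet> b<..<u \<bullet> b} * emeasure lborel {l \<bullet> c<..<u \<bullet> c}"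
      by (subst emeasure_distr) (simp_all add: pre lborel.emeasure_pair_measure_Times)
    then show "emeasure (distr ?M borel ?L) (box l u) = (\<Prod>b\<in>Basis. (u - l) \<bullet> b)"
      using le[OF m(1)] le[OF m(2)] B(2) by (simp add: B(1) inner_diff_left ennreal_mult)
  qed simp
  then have "(\<integral>\<^sup>+x. f x \<partial>lborel) = (\<integral>\<^sup>+x. f x \<partial>distr ?M borel ?L)" by simp
  also have "\<dots> = (\<integral>\<^sup>+p. f (?L p) \<partial>?M)" by (simp add: nn_integral_distr)
  also have "\<dots> = (\<integral>\<^sup>+x. \<integral>\<^sup>+y. f (?L (x, y)) \<partial>lborel \<partial>lborel)"
    by (rule lborel.nn_integral_fst[symmetric]) measurable
  finally show ?thesis by simp
qed

lemma nn_integral_lborel_dim3: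
  fixes f :: "'a::euclidean_space \<Rightarrow> ennreal"
  assumes [measurable]: "f \<in> borel_measurable borel" and B: "(Basis :: 'a set) = {b, c, d}" "distinct [b, c, d]"
  shows "(\<integral>\<^sup>+x. f x \<partial>lborel) = (\<integral>\<^sup>+x. \<integral>\<^sup>+y. \<integral>\<^sup>+z. f (x *\<^sub>R b + y *\<^sub>R c + z *\<^sub>R d) \<partial>lborel \<partial>lborel \<partial>lborel)"
proof -
  have m: "b \<in> Basis" "c \<in> Basis" "d \<in> Basis" by (simp_all add: B(1))
  have i: "b \<bullet> b = 1" "c \<bullet> c = 1" "d \<bullet> d = 1" "b \<bullet> c = 0" "c \<bullet> b = 0" "b \<bullet> d = 0" "d \<bullet> b = 0" "c \<bullet> d = 0" "d \<bullet> c = 0"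
    using B(2) by (auto simp: inner_Basis m)
  let ?L = "\<lambda>(x, y, z). x *\<^sub>R b + y *\<^sub>R c + z *\<^sub>R d"
  let ?N = "lborel \<Otimes>\<^sub>M lborel :: (real \<times> real) measure"
  let ?M = "lborel \<Otimes>\<^sub>M ?N :: (real \<times> real \<times> real) measure"
  have N: "sigma_finite_measure ?N" unfolding lborel_prod by (rule sigma_finite_lborel)
  have [measurable]: "?L \<in> borel_measurable ?M" by measurable
  have "lborel = distr ?M borel ?L"
  proof (rule lborel_eqI)
    fix l u :: 'a assume le: "\<And>b. b \<in> Basis \<Longrightarrow> l \<bullet> b \<le> u \<bullet> b"
    have pre: "?L -` box l u \<inter> space ?M = {l \<bullet> b<..<u \<bullet> b} \<times> {l \<bullet> c<..<u \<bullet> c} \<times> {l \<bullet> d<..<u \<bullet> d}"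
      by (auto simp: mem_box B i inner_add_left space_pair_measure)
    have "emeasure (distr ?M borel ?L) (box l u)
        = emeasure lborel {l \<bullet> b<..<u \<bullet> b} * (emeasure lborel {l \<bullet> c<..<u \<bullet> c} * emeasure lborel {l \<bullet> d<..<u \<bullet> d})"
      by (subst emeasure_distr) (simp_all add: pre sigma_finite_measure.emeasure_pair_measure_Times[OF N] lborel.emeasure_pair_measure_Times)
    then show "emeasure (distr ?M borel ?L) (box l u) = (\<Prod>b\<in>Basis. (u - l) \<bullet> b)"
      using le[OF m(1)] le[OF m(2)] le[OF m(3)] B(2) by (simp add: B(1) inner_diff_left ennreal_mult)
  qed simp
  then have "(\<integral>\<^sup>+x. f x \<partial>lborel) = (\<integral>\<^sup>+x. f x \<partial>distr ?M borel ?L)" by simp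
  also have "\<dots> = (\<integral>\<^sup>+p. f (?L p) \<partial>?M)" by (simp add: nn_integral_distr)
  also have "\<dots> = (\<integral>\<^sup>+x. \<integral>\<^sup>+q. f (?L (x, q)) \<partial>?N \<partial>lborel)"
    by (rule sigma_finite_measure.nn_integral_fst[OF N, symmetric]) measurable
  also have "\<dots> = (\<integral>\<^sup>+x. \<integral>\<^sup>+y. \<integral>\<^sup>+z. f (?L (x, y, z)) \<partial>lborel \<partial>lborel \<partial>lborel)"
  proof (rule nn_integral_cong)
    fix x :: real
    show "(\<integral>\<^sup>+q. f (?L (x, q)) \<partial>?N) = (\<integral>\<^sup>+y. \<integral>\<^sup>+z. f (?L (x, y, z)) \<partial>lborel \<partial>lborel)"
      by (rule lborel.nn_integral_fst[symmetric]) measurable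
  qed
  finally show ?thesis by simp
qed

text \<open>Cauchy-Schwarz twice: first in (x, y), separating c from the z-integral of a b, and then
  in z, separating a from b. What remains of the second step is a product of an integral over (y, z)
  and one over (x, z).\<close>

lemma loomis_whitney:
  fixes a b c :: "real \<Rightarrow> real \<Rightarrow> ennreal"
  assumes [measurable]: "case_prod a \<in> borel_measurable (lborel \<Otimes>\<^sub>M lborel)" "case_prod b \<in> borel_measurable (lborel \<Otimes>\<^sub>M lborel)"
    "case_prod c \<in> borel_measurable (lborel \<Otimes>\<^sub>M lborel)"
  shows "(\<integral>\<^sup>+x. \<integral>\<^sup>+y. \<integral>\<^sup>+z. a y z * b x z * c x y \<partial>lborel \<partial>lborel \<partial>lborel)\<^sup>2
    \<le> (\<integral>\<^sup>+y. \<integral>\<^sup>+z. (a y z)\<^sup>2 \<partial>lborel \<partial>lborel) * (\<integral>\<^sup>+x. \<integral>\<^sup>+z. (b x z)\<^sup>2 \<partial>lborel \<partial>lborel)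
      * (\<integral>\<^sup>+x. \<integral>\<^sup>+y. (c x y)\<^sup>2 \<partial>lborel \<partial>lborel)"
proof -
  let ?N = "lborel \<Otimes>\<^sub>M lborel :: (real \<times> real) measure"
  define w where "w x y = (\<integral>\<^sup>+z. a y z * b x z \<partial>lborel)" for x y
  have [measurable]: "case_prod w \<in> borel_measurable ?N" unfolding w_def by measurable
  have "(\<integral>\<^sup>+x. \<integral>\<^sup>+y. \<integral>\<^sup>+z. a y z * b x z * c x y \<partial>lborel \<partial>lborel \<partial>lborel) = (\<integral>\<^sup>+x. \<integral>\<^sup>+y. w x y * c x y \<partial>lborel \<partial>lborel)"
    unfolding w_def by (intro nn_integral_cong nn_integral_multc) measurable
  also have "\<dots> = (\<integral>\<^sup>+p. case_prod w p * case_prod c p \<partial>?N)"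
    by (subst lborel.nn_integral_fst[symmetric]) (auto simp: case_prod_beta)
  finally have "(\<integral>\<^sup>+x. \<integral>\<^sup>+y. \<integral>\<^sup>+z. a y z * b x z * c x y \<partial>lborel \<partial>lborel \<partial>lborel)\<^sup>2
      \<le> (\<integral>\<^sup>+p. (case_prod w p)\<^sup>2 \<partial>?N) * (\<integral>\<^sup>+p. (case_prod c p)\<^sup>2 \<partial>?N)"
    using Cauchy_Schwarz_nn_integral[of "case_prod w" ?N "case_prod c"] by simp
  also have "(\<integral>\<^sup>+p. (case_prod c p)\<^sup>2 \<partial>?N) = (\<integral>\<^sup>+x. \<integral>\<^sup>+y. (c x y)\<^sup>2 \<partial>lborel \<partial>lborel)"
    by (subst lborel.nn_integral_fst[symmetric]) auto
  also have "(\<integral>\<^sup>+p. (case_prod w p)\<^sup>2 \<partial>?N) = (\<integral>\<^sup>+x. \<integral>\<^sup>+y. (w x y)\<^sup>2 \<partial>lborel \<partial>lborel)"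
    by (subst lborel.nn_integral_fst[symmetric]) auto
  also have "\<dots> \<le> (\<integral>\<^sup>+x. \<integral>\<^sup>+y. (\<integral>\<^sup>+z. (a y z)\<^sup>2 \<partial>lborel) * (\<integral>\<^sup>+z. (b x z)\<^sup>2 \<partial>lborel) \<partial>lborel \<partial>lborel)"
    unfolding w_def by (intro nn_integral_mono Cauchy_Schwarz_nn_integral) measurable
  also have "\<dots> = (\<integral>\<^sup>+x. (\<integral>\<^sup>+y. \<integral>\<^sup>+z. (a y z)\<^sup>2 \<partial>lborel \<partial>lborel) * (\<integral>\<^sup>+z. (b x z)\<^sup>2 \<partial>lborel) \<partial>lborel)"
    by (intro nn_integral_cong nn_integral_multc) measurable
  also have "\<dots> = (\<integral>\<^sup>+y. \<integral>\<^sup>+z. (a y z)\<^sup>2 \<partial>lborel \<partial>lborel) * (\<integral>\<^sup>+x. \<integral>\<^sup>+z. (b x z)\<^sup>2 \<partial>lborel \<partial>lborel)"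
    by (rule nn_integral_cmult) measurable
  finally show ?thesis by (simp add: mult_right_mono)
qed

section \<open>Bounds along coordinate lines\<close>

lemma compact_support_le_integral_derivative:
  fixes g g' :: "real \<Rightarrow> real"
  assumes d: "\<And>t. (g has_real_derivative g' t) (at t)" and c: "continuous_on UNIV g'"
    and s: "\<And>t. \<bar>t\<bar> > R \<Longrightarrow> g t = 0"
  shows "ennreal \<bar>g t\<bar> \<le> (\<integral>\<^sup>+s. ennreal \<bar>g' s\<bar> \<partial>lborel)"
proof -
  \<comment> \<open>A starting point to the left of the support and of t; the absolute value covers
    negative R.\<close>
  define a where "a = min t (- \<bar>R\<bar> - 1)"
  have a: "a \<le> t" "g a = 0" using s[of a] by (auto simp: a_def)
  have [measurable]: "g' \<in> borel_measurable borel" by (rule borel_measurable_continuous_onI[OF c])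
  have c': "continuous_on {a..t} g'" by (rule continuous_on_subset[OF c]) auto
  have "integrable lborel (\<lambda>x. indicator {a..t} x *\<^sub>R g' x)"
    by (rule borel_integrable_compact[OF compact_Icc c'])
  then have i: "integrable lborel (\<lambda>x. g' x * indicator {a..t} x)" by (simp add: mult.commute)
  have "(\<integral>x. g' x * indicator {a..t} x \<partial>lborel) = g t - g a"
    using c by (intro integral_FTC_Icc_real a d) (auto simp: continuous_on_eq_continuous_at)
  then have "\<bar>g t\<bar> \<le> (\<integral>x. \<bar>g' x * indicator {a..t} x\<bar> \<partial>lborel)"
    using integral_abs_bound[of lborel "\<lambda>x. g' x * indicator {a..t} x"] a(2) by simp
  then have "ennreal \<bar>g t\<bar> \<le> (\<integral>\<^sup>+x. ennreal \<bar>g' x * indicator {a..t} x\<bar> \<partial>lborel)"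
    using i by (subst nn_integral_eq_integral) (auto intro: ennreal_leI)
  also have "\<dots> \<le> (\<integral>\<^sup>+s. ennreal \<bar>g' s\<bar> \<partial>lborel)"
    by (intro nn_integral_mono ennreal_leI) (auto simp: indicator_def)
  finally show ?thesis .
qed

definition grad_norm :: "('a::euclidean_space \<Rightarrow> real) \<Rightarrow> 'a \<Rightarrow> real" where
  "grad_norm \<phi> x = sqrt (\<Sum>b\<in>Basis. (norm (frechet_derivative \<phi> (at x) b))\<^sup>2)"

lemma power2_grad_norm: "(grad_norm \<phi> x)\<^sup>2 = (\<Sum>b\<in>Basis. (norm (frechet_derivative \<phi> (at x) b))\<^sup>2)"
  by (simp add: grad_norm_def sum_nonneg)

lemma Cc_grad_norm:
  assumes "test_function D \<phi>" shows "Cc (grad_norm \<phi>)"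
proof -
  have "Cc (\<lambda>x. \<Sum>b\<in>Basis. (norm (frechet_derivative \<phi> (at x) b))\<^sup>2)"
    using assms by (intro Cc_sum Cc_norm_power test_function_Cc[OF test_function_derivative]) auto
  from Cc_compose[OF this, of sqrt] show ?thesis
    unfolding grad_norm_def[abs_def] by (simp add: continuous_on_real_sqrt)
qed

text \<open>Gagliardo's device: the fundamental theorem of calculus is applied to a power of \<phi>.
  The surplus factor |\<phi>|^p is paid for afterwards by Cauchy-Schwarz, at the price of the
  integral of \<phi>^(2p).\<close>

lemma line_bound:
  fixes \<phi> :: "'a::euclidean_space \<Rightarrow> real"
  assumes \<phi>: "test_function D \<phi>" and b: "b \<in> Basis"
  shows "ennreal (\<bar>\<phi> (t *\<^sub>R b + w)\<bar> ^ Suc p)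
    \<le> (\<integral>\<^sup>+s. ennreal (real (Suc p) * \<bar>\<phi> (s *\<^sub>R b + w)\<bar> ^ p * grad_norm \<phi> (s *\<^sub>R b + w)) \<partial>lborel)"
proof -
  let ?g' = "\<lambda>s. real (Suc p) * \<phi> (s *\<^sub>R b + w) ^ p * frechet_derivative \<phi> (at (s *\<^sub>R b + w)) b"
  obtain R where R: "R > 0" "\<And>x. norm x > R \<Longrightarrow> \<phi> x = 0"
    by (rule Cc_support_ball[OF test_function_Cc[OF \<phi>]]) (rule that)
  have "ennreal \<bar>\<phi> (t *\<^sub>R b + w) ^ Suc p\<bar> \<le> (\<integral>\<^sup>+s. ennreal \<bar>?g' s\<bar> \<partial>lborel)"
  proof (rule compact_support_le_integral_derivative[where R = "R + norm w" and t = t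
        and g = "\<lambda>s. \<phi> (s *\<^sub>R b + w) ^ Suc p" and g' = ?g'])
    fix s
    have "((\<lambda>s. \<phi> (s *\<^sub>R b + w)) has_derivative (\<lambda>h. frechet_derivative \<phi> (at (s *\<^sub>R b + w)) (h *\<^sub>R b))) (at s)"
      by (rule has_derivative_compose[OF _ test_function_has_derivative[OF \<phi>]]) (auto intro!: derivative_eq_intros)
    moreover have "frechet_derivative \<phi> (at (s *\<^sub>R b + w)) (h *\<^sub>R b) = frechet_derivative \<phi> (at (s *\<^sub>R b + w)) b * h" for h
      using linear_cmul[OF linear_frechet_derivative[OF smooth_differentiable[OF test_function_smooth[OF \<phi>]]]]
      by (simp add: mult.commute)
    ultimately have "((\<lambda>s. \<phi> (s *\<^sub>R b + w)) has_real_derivative frechet_derivative \<phi> (at (s *\<^sub>R b + w)) b) (at s)"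
      by (simp add: has_field_derivative_def)
    from DERIV_power[OF this, of "Suc p"] show "((\<lambda>s. \<phi> (s *\<^sub>R b + w) ^ Suc p) has_real_derivative ?g' s) (at s)"
      by (simp add: ac_simps)
  next
    have c: "continuous_on UNIV (\<lambda>s. s *\<^sub>R b + w)" by (intro continuous_intros)
    have "continuous_on UNIV (\<lambda>s. \<phi> (s *\<^sub>R b + w))"
      by (rule continuous_on_compose2[OF smooth_continuous[OF test_function_smooth[OF \<phi>]] c]) simp
    moreover have "continuous_on UNIV (\<lambda>s. frechet_derivative \<phi> (at (s *\<^sub>R b + w)) b)"
      by (rule continuous_on_compose2[OF smooth_continuous[OF smooth_derivative[OF test_function_smooth[OF \<phi>]]] c]) simp
    ultimately show "continuous_on UNIV ?g'" by (intro continuous_intros)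
  next
    fix s assume s: "R + norm w < \<bar>s\<bar>"
    have "\<bar>s\<bar> \<le> norm (s *\<^sub>R b + w) + norm w"
      using norm_triangle_ineq4[of "s *\<^sub>R b + w" w] b by simp
    then show "\<phi> (s *\<^sub>R b + w) ^ Suc p = 0" using s R by simp
  qed
  also have "\<dots> \<le> (\<integral>\<^sup>+s. ennreal (real (Suc p) * \<bar>\<phi> (s *\<^sub>R b + w)\<bar> ^ p * grad_norm \<phi> (s *\<^sub>R b + w)) \<partial>lborel)"
  proof (intro nn_integral_mono ennreal_leI)
    fix s
    have "\<bar>frechet_derivative \<phi> (at x) b\<bar> \<le> grad_norm \<phi> x" for x
      unfolding grad_norm_def
      by (rule real_le_rsqrt) (use member_le_sum[OF b, of "\<lambda>b. (norm (frechet_derivative \<phi> (at x) b))\<^sup>2"] in simp)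
    then show "\<bar>?g' s\<bar> \<le> real (Suc p) * \<bar>\<phi> (s *\<^sub>R b + w)\<bar> ^ p * grad_norm \<phi> (s *\<^sub>R b + w)"
      by (simp add: abs_mult power_abs mult_left_mono)
  qed
  finally show ?thesis by (simp add: power_abs del: power_Suc)
qed

lemma gradient_product_bound:
  fixes \<phi> :: "'a::euclidean_space \<Rightarrow> real"
  assumes \<phi>: "test_function D \<phi>" and p: "p > 0"
  shows "Cc (\<lambda>x. c * \<bar>\<phi> x\<bar> ^ p * grad_norm \<phi> x)"
    "(\<integral>x. c * \<bar>\<phi> x\<bar> ^ p * grad_norm \<phi> x \<partial>lborel)\<^sup>2 \<le> c\<^sup>2 * (\<integral>x. \<phi> x ^ (2 * p) \<partial>lborel) * dirichlet \<phi>"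
proof -
  have cp: "Cc (\<lambda>x. \<bar>\<phi> x\<bar> ^ p)" using Cc_norm_power[OF test_function_Cc[OF \<phi>] p] by simp
  note cg = Cc_grad_norm[OF \<phi>]
  have c: "Cc (\<lambda>x. \<bar>\<phi> x\<bar> ^ p * grad_norm \<phi> x)" by (rule Cc_mult[OF cp cg])
  then show "Cc (\<lambda>x. c * \<bar>\<phi> x\<bar> ^ p * grad_norm \<phi> x)"
    using Cc_compose[OF c, of "\<lambda>x. c * x"] by (simp add: continuous_intros mult.assoc)
  have g: "0 \<le> grad_norm \<phi> x" for x by (simp add: grad_norm_def sum_nonneg)
  have le: "(\<integral>x. \<bar>\<phi> x\<bar> ^ p * grad_norm \<phi> x \<partial>lborel) \<le> l2 lborel (\<lambda>x. \<bar>\<phi> x\<bar> ^ p) * l2 lborel (grad_norm \<phi>)"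
    using cauchy_schwarz[OF Cc_sqint[OF cp] Cc_sqint[OF cg]] g by simp
  have "(\<integral>x. \<bar>\<phi> x\<bar> ^ p * grad_norm \<phi> x \<partial>lborel)\<^sup>2 \<le> (l2 lborel (\<lambda>x. \<bar>\<phi> x\<bar> ^ p) * l2 lborel (grad_norm \<phi>))\<^sup>2"
    by (intro power_mono le integral_nonneg_AE AE_I2) (auto simp: g)
  also have "\<dots> = (\<integral>x. \<phi> x ^ (2 * p) \<partial>lborel) * dirichlet \<phi>"
  proof -
    have "(l2 lborel (grad_norm \<phi>))\<^sup>2 = dirichlet \<phi>"
      unfolding l2_sq dirichlet_def power2_grad_norm[symmetric] by simp
    then show ?thesis
      by (simp add: power_mult_distrib l2_sq power_mult[symmetric] mult.commute[of p] power_even_abs)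
  qed
  finally have "c\<^sup>2 * (\<integral>x. \<bar>\<phi> x\<bar> ^ p * grad_norm \<phi> x \<partial>lborel)\<^sup>2 \<le> c\<^sup>2 * ((\<integral>x. \<phi> x ^ (2 * p) \<partial>lborel) * dirichlet \<phi>)"
    by (intro mult_left_mono) auto
  then show "(\<integral>x. c * \<bar>\<phi> x\<bar> ^ p * grad_norm \<phi> x \<partial>lborel)\<^sup>2 \<le> c\<^sup>2 * (\<integral>x. \<phi> x ^ (2 * p) \<partial>lborel) * dirichlet \<phi>"
    by (simp add: mult.assoc power_mult_distrib)
qed

lemma nn_integral_gradient_product:
  fixes \<phi> :: "'a::euclidean_space \<Rightarrow> real"
  assumes \<phi>: "test_function D \<phi>" and p: "p > 0" and c: "c \<ge> 0"
  shows "(\<integral>\<^sup>+x. ennreal (c * \<bar>\<phi> x\<bar> ^ p * grad_norm \<phi> x) \<partial>lborel) = ennreal (\<integral>x. c * \<bar>\<phi> x\<bar> ^ p * grad_norm \<phi> x \<partial>lborel)"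
  by (intro nn_integral_eq_integral Cc_integrable gradient_product_bound(1)[OF \<phi> p] AE_I2)
    (use c in \<open>simp add: grad_norm_def sum_nonneg\<close>)

lemma nn_integral_Cc_power:
  fixes \<phi> :: "'a::euclidean_space \<Rightarrow> real"
  assumes "Cc \<phi>" "even n" "n > 0"
  shows "(\<integral>\<^sup>+x. ennreal (\<phi> x ^ n) \<partial>lborel) = ennreal (\<integral>x. \<phi> x ^ n \<partial>lborel)"
  by (intro nn_integral_eq_integral Cc_integrable Cc_power assms AE_I2) (simp add: assms zero_le_even_power)

text \<open>With p = 3 the line bound gives \<phi>^4 \<le> I at every point, hence P \<le> I N,
  while I^2 \<le> 16 P G. So P^2 \<le> 16 P G N^2, and P cancels, being finite for a test function.
  The choice p = 3 makes the integral from Cauchy-Schwarz equal to P itself.\<close>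

lemma sobolev_dim1:
  fixes \<phi> :: "'a::euclidean_space \<Rightarrow> real"
  assumes \<phi>: "test_function D \<phi>" and dim: "DIM('a) = 1"
  shows "(\<integral>x. \<phi> x ^ 6 \<partial>lborel) \<le> 16 * dirichlet \<phi> * (\<integral>x. \<phi> x ^ 2 \<partial>lborel)\<^sup>2"
proof -
  define P N G where "P = (\<integral>x. \<phi> x ^ 6 \<partial>lborel)" and "N = (\<integral>x. \<phi> x ^ 2 \<partial>lborel)" and "G = dirichlet \<phi>"
  obtain b :: 'a where B: "Basis = {b}" using dim card_1_singletonE by metis
  let ?H = "\<lambda>x. real (Suc 3) * \<bar>\<phi> x\<bar> ^ 3 * grad_norm \<phi> x"
  note H = gradient_product_bound(1)[OF \<phi>, of 3 "real (Suc 3)"]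
  note [measurable] = Cc_borel[OF H] Cc_borel[OF test_function_Cc[OF \<phi>]]
  define I where "I = (\<integral>x. ?H x \<partial>lborel)"
  have nn: "0 \<le> P" "0 \<le> N" "0 \<le> G" "0 \<le> I"
    by (auto simp: P_def N_def G_def I_def dirichlet_nonneg grad_norm_def sum_nonneg intro!: integral_nonneg_AE)
  have I: "(\<integral>\<^sup>+s. ennreal (?H (s *\<^sub>R b)) \<partial>lborel) = ennreal I"
  proof -
    have "(\<integral>\<^sup>+x. ennreal (?H x) \<partial>lborel) = ennreal I"
      unfolding I_def by (rule nn_integral_gradient_product[OF \<phi>]) auto
    moreover have "(\<lambda>x. ennreal (?H x)) \<in> borel_measurable borel" by measurable
    ultimately show ?thesis using nn_integral_lborel_dim1[OF _ B, of "\<lambda>x. ennreal (?H x)"] by (simp only:)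
  qed
  have pt: "\<phi> x ^ 4 \<le> I" for x
  proof -
    have x: "(x \<bullet> b) *\<^sub>R b = x" using euclidean_representation[of x] by (simp add: B)
    have "b \<in> Basis" by (simp add: B)
    then have "ennreal (\<bar>\<phi> x\<bar> ^ Suc 3) \<le> ennreal I"
      using line_bound[OF \<phi>, of b "x \<bullet> b" 0 3] I x by simp
    then show ?thesis using nn by (simp add: power_even_abs)
  qed
  have "P \<le> (\<integral>x. I * \<phi> x ^ 2 \<partial>lborel)"
    unfolding P_def
  proof (rule integral_mono)
    note C\<phi> = test_function_Cc[OF \<phi>]
    show "integrable lborel (\<lambda>x. \<phi> x ^ 6)" "integrable lborel (\<lambda>x. I * \<phi> x ^ 2)"
      using Cc_integrable[OF Cc_power[OF C\<phi>, of 6]] Cc_integrable[OF Cc_power[OF C\<phi>, of 2]] by simp_all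
    fix x
    have "\<phi> x ^ 6 = \<phi> x ^ 4 * \<phi> x ^ 2" by (simp add: power_add[symmetric])
    then show "\<phi> x ^ 6 \<le> I * \<phi> x ^ 2" using mult_right_mono[OF pt[of x], of "\<phi> x ^ 2"] by simp
  qed
  then have "P \<le> I * N" by (simp add: N_def)
  then have "P\<^sup>2 \<le> (I * N)\<^sup>2" using nn by (intro power_mono) auto
  also have "\<dots> \<le> (16 * P * G) * N\<^sup>2"
    using gradient_product_bound(2)[OF \<phi>, of 3 "real (Suc 3)"]
    by (auto simp: power_mult_distrib I_def P_def G_def intro!: mult_right_mono)
  finally have "P * P \<le> P * (16 * G * N\<^sup>2)" by (simp add: power2_eq_square ac_simps)
  then have "P \<le> 16 * G * N\<^sup>2" using nn by (cases "P = 0") auto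
  then show ?thesis by (simp add: P_def N_def G_def)
qed

text \<open>With p = 2 each of the two coordinate directions bounds |\<phi>|^3 by a function of the
  other coordinate; the product of the two bounds separates, so P \<le> I^2 \<le> 9 Q G. Since Q^2
  \<le> N P by Cauchy-Schwarz, P^2 \<le> 81 G^2 N P and P cancels.\<close>

lemma sobolev_dim2:
  fixes \<phi> :: "'a::euclidean_space \<Rightarrow> real"
  assumes \<phi>: "test_function D \<phi>" and dim: "DIM('a) = 2"
  shows "(\<integral>x. \<phi> x ^ 6 \<partial>lborel) \<le> 81 * (dirichlet \<phi>)\<^sup>2 * (\<integral>x. \<phi> x ^ 2 \<partial>lborel)"
proof -
  define P N G Q where "P = (\<integral>x. \<phi> x ^ 6 \<partial>lborel)" and "N = (\<integral>x. \<phi> x ^ 2 \<partial>lborel)" and "G = dirichlet \<phi>"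
    and "Q = (\<integral>x. \<phi> x ^ 4 \<partial>lborel)"
  obtain b c :: 'a where B: "Basis = {b, c}" "b \<noteq> c" using dim by (auto simp: card_2_iff)
  have m: "c \<in> Basis" by (simp add: B(1))
  let ?H = "\<lambda>x. real (Suc 2) * \<bar>\<phi> x\<bar> ^ 2 * grad_norm \<phi> x"
  note H = gradient_product_bound(1)[OF \<phi>, of 2 "real (Suc 2)"]
  note C\<phi> = test_function_Cc[OF \<phi>]
  note [measurable] = Cc_borel[OF H] Cc_borel[OF C\<phi>]
  define I where "I = (\<integral>x. ?H x \<partial>lborel)"
  have nn: "0 \<le> P" "0 \<le> N" "0 \<le> G" "0 \<le> I" "0 \<le> Q"
    by (auto simp: P_def N_def G_def Q_def I_def dirichlet_nonneg grad_norm_def sum_nonneg intro!: integral_nonneg_AE)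
  have I: "(\<integral>\<^sup>+x. ennreal (?H x) \<partial>lborel) = ennreal I"
    unfolding I_def by (rule nn_integral_gradient_product[OF \<phi>]) auto
  define A where "A y = (\<integral>\<^sup>+s. ennreal (?H (s *\<^sub>R b + y *\<^sub>R c)) \<partial>lborel)" for y
  define A' where "A' x = (\<integral>\<^sup>+s. ennreal (?H (x *\<^sub>R b + s *\<^sub>R c)) \<partial>lborel)" for x
  have [measurable]: "A \<in> borel_measurable borel" "A' \<in> borel_measurable borel"
    unfolding A_def A'_def by measurable
  have IA': "(\<integral>\<^sup>+x. A' x \<partial>lborel) = ennreal I"
    unfolding A'_def I[symmetric] by (rule nn_integral_lborel_dim2[OF _ B, symmetric]) measurable
  have "(\<integral>\<^sup>+x. ennreal (?H x) \<partial>lborel) = (\<integral>\<^sup>+y. \<integral>\<^sup>+x. ennreal (?H (y *\<^sub>R c + x *\<^sub>R b)) \<partial>lborel \<partial>lborel)"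
  proof (rule nn_integral_lborel_dim2)
    show "(\<lambda>x. ennreal (?H x)) \<in> borel_measurable borel" by measurable
  qed (use B in auto)
  then have IA: "(\<integral>\<^sup>+y. A y \<partial>lborel) = ennreal I" unfolding A_def I by (simp add: add.commute)
  have "ennreal P = (\<integral>\<^sup>+x. \<integral>\<^sup>+y. ennreal (\<phi> (x *\<^sub>R b + y *\<^sub>R c) ^ 6) \<partial>lborel \<partial>lborel)"
    unfolding P_def nn_integral_Cc_power[OF C\<phi>, of 6, simplified, symmetric]
    by (rule nn_integral_lborel_dim2[OF _ B]) measurable
  also have "\<dots> \<le> (\<integral>\<^sup>+x. \<integral>\<^sup>+y. A' x * A y \<partial>lborel \<partial>lborel)"
  proof (intro nn_integral_mono)
    fix x y
    have "ennreal (\<bar>\<phi> (x *\<^sub>R b + y *\<^sub>R c)\<bar> ^ Suc 2) \<le> A y"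
      unfolding A_def using B by (intro line_bound[OF \<phi>]) auto
    moreover have "ennreal (\<bar>\<phi> (x *\<^sub>R b + y *\<^sub>R c)\<bar> ^ Suc 2) \<le> A' x"
      unfolding A'_def using line_bound[OF \<phi> m, of y "x *\<^sub>R b" 2] by (simp add: add.commute)
    moreover have "\<phi> (x *\<^sub>R b + y *\<^sub>R c) ^ 6 = \<bar>\<phi> (x *\<^sub>R b + y *\<^sub>R c)\<bar> ^ Suc 2 * \<bar>\<phi> (x *\<^sub>R b + y *\<^sub>R c)\<bar> ^ Suc 2"
      by (subst power_add[symmetric]) (simp add: power_even_abs)
    ultimately show "ennreal (\<phi> (x *\<^sub>R b + y *\<^sub>R c) ^ 6) \<le> A' x * A y"
      by (simp only: ennreal_mult abs_ge_zero zero_le_power) (rule mult_mono; simp)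
  qed
  also have "\<dots> = ennreal (I * I)"
    by (simp add: nn_integral_cmult nn_integral_multc IA IA' ennreal_mult nn)
  finally have PI: "P \<le> I\<^sup>2" using nn by (simp add: power2_eq_square)
  have IQ: "I\<^sup>2 \<le> 9 * Q * G" using gradient_product_bound(2)[OF \<phi>, of 2 "real (Suc 2)"] by (simp add: I_def Q_def G_def)
  have "Q \<le> l2 lborel \<phi> * l2 lborel (\<lambda>x. \<phi> x ^ 3)"
  proof -
    have "\<phi> x ^ 4 = norm (\<phi> x) * norm (\<phi> x ^ 3)" for x
      by (simp add: power_abs[symmetric] abs_mult[symmetric] power_Suc[symmetric] del: power_Suc)
    then show ?thesis using cauchy_schwarz[OF Cc_sqint[OF C\<phi>] Cc_sqint[OF Cc_power[OF C\<phi>, of 3]]] by (simp add: Q_def)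
  qed
  then have "Q\<^sup>2 \<le> (l2 lborel \<phi> * l2 lborel (\<lambda>x. \<phi> x ^ 3))\<^sup>2" using nn by (intro power_mono) auto
  then have QNP: "Q\<^sup>2 \<le> N * P" by (simp add: power_mult_distrib l2_sq N_def P_def power_mult[symmetric])
  have "P\<^sup>2 \<le> (9 * Q * G)\<^sup>2" using PI IQ nn by (intro power_mono) auto
  also have "\<dots> = 81 * G\<^sup>2 * Q\<^sup>2" by (simp add: power_mult_distrib)
  also have "\<dots> \<le> 81 * G\<^sup>2 * (N * P)" using QNP by (intro mult_left_mono) auto
  finally have "P * P \<le> P * (81 * G\<^sup>2 * N)" by (simp add: power2_eq_square ac_simps)
  then have "P \<le> 81 * G\<^sup>2 * N" using nn by (cases "P = 0") auto
  then show ?thesis by (simp add: P_def N_def G_def)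
qed

text \<open>With p = 3 each direction bounds \<phi>^4 by a function of the other two coordinates, so
  \<phi>^6 is at most the product of three square roots. This is the shape of the Loomis-Whitney
  inequality, which gives P^2 \<le> I^3. With I^2 \<le> 16 P G this becomes P^4 \<le> 4096 P^3
  G^3.\<close>

lemma sobolev_dim3:
  fixes \<phi> :: "'a::euclidean_space \<Rightarrow> real"
  assumes \<phi>: "test_function D \<phi>" and dim: "DIM('a) = 3"
  shows "(\<integral>x. \<phi> x ^ 6 \<partial>lborel) \<le> 4096 * (dirichlet \<phi>) ^ 3"
proof -
  define P G where "P = (\<integral>x. \<phi> x ^ 6 \<partial>lborel)" and "G = dirichlet \<phi>"
  obtain b c d :: 'a where B: "Basis = {b, c, d}" "distinct [b, c, d]" using dim by (auto simp: card_3_iff)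
  let ?H = "\<lambda>x. real (Suc 3) * \<bar>\<phi> x\<bar> ^ 3 * grad_norm \<phi> x"
  note H = gradient_product_bound(1)[OF \<phi>, of 3 "real (Suc 3)"]
  note C\<phi> = test_function_Cc[OF \<phi>]
  note [measurable] = Cc_borel[OF H] Cc_borel[OF C\<phi>]
  define I where "I = (\<integral>x. ?H x \<partial>lborel)"
  have Hnn: "0 \<le> ?H x" for x by (simp add: grad_norm_def sum_nonneg)
  have nn: "0 \<le> P" "0 \<le> G" "0 \<le> I"
    by (auto simp: P_def G_def I_def dirichlet_nonneg grad_norm_def sum_nonneg intro!: integral_nonneg_AE)
  have I: "(\<integral>\<^sup>+x. ennreal (?H x) \<partial>lborel) = ennreal I"
    unfolding I_def by (rule nn_integral_gradient_product[OF \<phi>]) auto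
  \<comment> \<open>A square root on \<open>ennreal\<close>. It is correct only at finite arguments
    because \<open>enn2real\<close> sends infinity to 0; finiteness of the line integrals is
    provided by \<open>slice\<close>.\<close>
  define r where "r A = ennreal (sqrt (enn2real A))" for A
  have [measurable]: "r \<in> borel_measurable borel" unfolding r_def by measurable
  have r_sq: "(r A)\<^sup>2 = A" if "A < \<infinity>" for A
    using that by (cases A rule: ennreal_cases) (auto simp: r_def ennreal_power)
  have r_ge: "ennreal (t\<^sup>2) \<le> r A" if "A < \<infinity>" "ennreal (t ^ 4) \<le> A" for A and t :: real
  proof -
    from that obtain a where a: "A = ennreal a" "a \<ge> 0" by (cases A rule: ennreal_cases) auto
    with that have "(t\<^sup>2)\<^sup>2 \<le> a" by (simp add: power_mult[symmetric])
    then show ?thesis using a by (simp add: r_def real_le_rsqrt)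
  qed
  have slice: "(\<integral>\<^sup>+s. ennreal (?H (s *\<^sub>R e + w)) \<partial>lborel) < \<infinity>" if "e \<in> Basis" for e w
  proof -
    have "Cc (\<lambda>s. ?H (s *\<^sub>R e + w))"
    proof -
      obtain R where R: "\<And>x. norm x > R \<Longrightarrow> ?H x = 0" by (rule Cc_support_ball[OF H]) auto
      have "?H (s *\<^sub>R e + w) = 0" if "s \<notin> cball 0 (R + norm w)" for s
      proof -
        have "\<bar>s\<bar> \<le> norm (s *\<^sub>R e + w) + norm w"
          using norm_triangle_ineq4[of "s *\<^sub>R e + w" w] \<open>e \<in> Basis\<close> by simp
        then show ?thesis using that by (intro R) auto
      qed
      moreover have "continuous_on UNIV (\<lambda>s. ?H (s *\<^sub>R e + w))"
        by (rule continuous_on_compose2[OF Cc_continuous[OF H]]) (auto intro!: continuous_intros)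
      ultimately show ?thesis unfolding Cc_def using compact_cball by blast
    qed
    from Cc_integrable[OF this] show ?thesis using Hnn by (subst nn_integral_eq_integral) (auto simp: less_top[symmetric])
  qed
  have em: "(\<lambda>x. ennreal (?H x)) \<in> borel_measurable borel" by measurable
  have m: "b \<in> Basis" "c \<in> Basis" "d \<in> Basis" by (simp_all add: B(1))
  define X where "X y z = (\<integral>\<^sup>+s. ennreal (?H (s *\<^sub>R b + (y *\<^sub>R c + z *\<^sub>R d))) \<partial>lborel)" for y z
  define Y where "Y x z = (\<integral>\<^sup>+s. ennreal (?H (s *\<^sub>R c + (x *\<^sub>R b + z *\<^sub>R d))) \<partial>lborel)" for x z
  define Z where "Z x y = (\<integral>\<^sup>+s. ennreal (?H (s *\<^sub>R d + (x *\<^sub>R b + y *\<^sub>R c))) \<partial>lborel)" for x y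
  have [measurable]: "case_prod X \<in> borel_measurable (lborel \<Otimes>\<^sub>M lborel)" "case_prod Y \<in> borel_measurable (lborel \<Otimes>\<^sub>M lborel)"
    "case_prod Z \<in> borel_measurable (lborel \<Otimes>\<^sub>M lborel)"
    unfolding X_def Y_def Z_def by measurable
  have fin: "X y z < \<infinity>" "Y y z < \<infinity>" "Z y z < \<infinity>" for y z
    unfolding X_def Y_def Z_def by (rule slice, simp add: B(1))+
  have IX: "(\<integral>\<^sup>+y. \<integral>\<^sup>+z. X y z \<partial>lborel \<partial>lborel) = ennreal I"
  proof -
    have "(\<integral>\<^sup>+x. ennreal (?H x) \<partial>lborel) = (\<integral>\<^sup>+y. \<integral>\<^sup>+z. \<integral>\<^sup>+s. ennreal (?H (y *\<^sub>R c + z *\<^sub>R d + s *\<^sub>R b)) \<partial>lborel \<partial>lborel \<partial>lborel)"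
      by (rule nn_integral_lborel_dim3[OF em]) (use B in auto)
    then show ?thesis unfolding X_def I by (simp add: ac_simps)
  qed
  have IY: "(\<integral>\<^sup>+y. \<integral>\<^sup>+z. Y y z \<partial>lborel \<partial>lborel) = ennreal I"
  proof -
    have "(\<integral>\<^sup>+x. ennreal (?H x) \<partial>lborel) = (\<integral>\<^sup>+y. \<integral>\<^sup>+z. \<integral>\<^sup>+s. ennreal (?H (y *\<^sub>R b + z *\<^sub>R d + s *\<^sub>R c)) \<partial>lborel \<partial>lborel \<partial>lborel)"
      by (rule nn_integral_lborel_dim3[OF em]) (use B in auto)
    then show ?thesis unfolding Y_def I by (simp add: ac_simps)
  qed
  have IZ: "(\<integral>\<^sup>+y. \<integral>\<^sup>+z. Z y z \<partial>lborel \<partial>lborel) = ennreal I"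
  proof -
    have "(\<integral>\<^sup>+x. ennreal (?H x) \<partial>lborel) = (\<integral>\<^sup>+y. \<integral>\<^sup>+z. \<integral>\<^sup>+s. ennreal (?H (y *\<^sub>R b + z *\<^sub>R c + s *\<^sub>R d)) \<partial>lborel \<partial>lborel \<partial>lborel)"
      by (rule nn_integral_lborel_dim3[OF em]) (use B in auto)
    then show ?thesis unfolding Z_def I by (simp add: ac_simps)
  qed
  have "ennreal P = (\<integral>\<^sup>+x. \<integral>\<^sup>+y. \<integral>\<^sup>+z. ennreal (\<phi> (x *\<^sub>R b + y *\<^sub>R c + z *\<^sub>R d) ^ 6) \<partial>lborel \<partial>lborel \<partial>lborel)"
    unfolding P_def nn_integral_Cc_power[OF C\<phi>, of 6, simplified, symmetric]
    by (rule nn_integral_lborel_dim3[OF _ B]) measurable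
  also have "\<dots> \<le> (\<integral>\<^sup>+x. \<integral>\<^sup>+y. \<integral>\<^sup>+z. r (X y z) * r (Y x z) * r (Z x y) \<partial>lborel \<partial>lborel \<partial>lborel)"
  proof (intro nn_integral_mono)
    fix x y z
    let ?t = "\<phi> (x *\<^sub>R b + y *\<^sub>R c + z *\<^sub>R d)"
    have 1: "ennreal (?t\<^sup>2) \<le> r (X y z)"
      using line_bound[OF \<phi> m(1), of x "y *\<^sub>R c + z *\<^sub>R d" 3]
      by (intro r_ge fin) (simp add: X_def ac_simps power_even_abs del: power_Suc)
    have 2: "ennreal (?t\<^sup>2) \<le> r (Y x z)"
      using line_bound[OF \<phi> m(2), of y "x *\<^sub>R b + z *\<^sub>R d" 3]
      by (intro r_ge fin) (simp add: Y_def ac_simps power_even_abs del: power_Suc)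
    have 3: "ennreal (?t\<^sup>2) \<le> r (Z x y)"
      using line_bound[OF \<phi> m(3), of z "x *\<^sub>R b + y *\<^sub>R c" 3]
      by (intro r_ge fin) (simp add: Z_def ac_simps power_even_abs del: power_Suc)
    have "ennreal (?t ^ 6) = ennreal (?t\<^sup>2) * ennreal (?t\<^sup>2) * ennreal (?t\<^sup>2)"
      by (simp add: ennreal_mult[symmetric] power_add[symmetric])
    also have "\<dots> \<le> r (X y z) * r (Y x z) * r (Z x y)" by (intro mult_mono 1 2 3) auto
    finally show "ennreal (?t ^ 6) \<le> r (X y z) * r (Y x z) * r (Z x y)" .
  qed
  finally have "(ennreal P)\<^sup>2 \<le> (\<integral>\<^sup>+x. \<integral>\<^sup>+y. \<integral>\<^sup>+z. r (X y z) * r (Y x z) * r (Z x y) \<partial>lborel \<partial>lborel \<partial>lborel)\<^sup>2"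
    by (intro power_mono) auto
  also have "\<dots> \<le> (\<integral>\<^sup>+y. \<integral>\<^sup>+z. (r (X y z))\<^sup>2 \<partial>lborel \<partial>lborel) * (\<integral>\<^sup>+x. \<integral>\<^sup>+z. (r (Y x z))\<^sup>2 \<partial>lborel \<partial>lborel)
      * (\<integral>\<^sup>+x. \<integral>\<^sup>+y. (r (Z x y))\<^sup>2 \<partial>lborel \<partial>lborel)"
    by (rule loomis_whitney) measurable
  also have "\<dots> = ennreal (I ^ 3)"
    by (simp only: r_sq fin IX IY IZ ennreal_mult[symmetric] nn mult_nonneg_nonneg) (simp add: eval_nat_numeral mult.assoc)
  finally have PI: "P\<^sup>2 \<le> I ^ 3" using nn by (simp add: ennreal_power)
  have IG: "I\<^sup>2 \<le> 16 * P * G" using gradient_product_bound(2)[OF \<phi>, of 3 "real (Suc 3)"] by (simp add: I_def P_def G_def)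
  have "(P\<^sup>2)\<^sup>2 \<le> (I ^ 3)\<^sup>2" using PI by (intro power_mono) auto
  also have "\<dots> = (I\<^sup>2) ^ 3" by (simp add: power_mult[symmetric])
  also have "\<dots> \<le> (16 * P * G) ^ 3" using IG by (intro power_mono) auto
  also have "\<dots> = P ^ 3 * (4096 * G ^ 3)" by (simp add: power_mult_distrib)
  also have "(P\<^sup>2)\<^sup>2 = P ^ 3 * P" by (simp add: eval_nat_numeral)
  finally have "P ^ 3 * P \<le> P ^ 3 * (4096 * G ^ 3)" .
  then have "P \<le> 4096 * G ^ 3" using nn by (cases "P = 0") auto
  then show ?thesis by (simp add: P_def G_def)
qed

text \<open>All three bounds are homogeneous of degree three in mass and Dirichlet integral, so the
  cube of the sum dominates each of them and the largest constant serves for all dimensions.\<close>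

lemma sobolev:
  fixes \<phi> :: "'a::euclidean_space \<Rightarrow> real"
  assumes \<phi>: "test_function D \<phi>" and dim: "DIM('a) \<in> {1, 2, 3}"
  shows "(\<integral>x. \<phi> x ^ 6 \<partial>lborel) \<le> 4096 * ((\<integral>x. \<phi> x ^ 2 \<partial>lborel) + dirichlet \<phi>) ^ 3"
proof -
  define N G where "N = (\<integral>x. \<phi> x ^ 2 \<partial>lborel)" and "G = dirichlet \<phi>"
  have nn: "0 \<le> N" "0 \<le> G" by (auto simp: N_def G_def dirichlet_nonneg intro!: integral_nonneg_AE)
  have e: "(N + G) ^ 3 = N ^ 3 + 3 * (N\<^sup>2 * G) + 3 * (N * G\<^sup>2) + G ^ 3"
    by (simp add: eval_nat_numeral algebra_simps)
  have "0 \<le> N ^ 3" "0 \<le> N\<^sup>2 * G" "0 \<le> N * G\<^sup>2" "0 \<le> G ^ 3" using nn by auto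
  then have "16 * G * N\<^sup>2 \<le> 4096 * (N + G) ^ 3" "81 * G\<^sup>2 * N \<le> 4096 * (N + G) ^ 3" "4096 * G ^ 3 \<le> 4096 * (N + G) ^ 3"
    unfolding e by (auto simp: algebra_simps)
  then show ?thesis
    using dim sobolev_dim1[OF \<phi>] sobolev_dim2[OF \<phi>] sobolev_dim3[OF \<phi>]
    unfolding N_def G_def by force
qed

lemma H10_le_integrable_power6:
  fixes u :: "'a::euclidean_space \<Rightarrow> real"
  assumes u: "H10_le D u c" and dim: "DIM('a) \<in> {1, 2, 3}"
  shows "integrable lborel (\<lambda>x. u x ^ 6)"
proof -
  obtain \<phi> :: "nat \<Rightarrow> 'a \<Rightarrow> real" where \<phi>: "\<And>n. test_function D (\<phi> n)"
    "(\<lambda>n. l2 lborel (\<lambda>x. \<phi> n x - u x)) \<longlonglongrightarrow> 0" "\<And>n. dirichlet (\<phi> n) < c + 1 / real (Suc n)"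
    by (rule H10_le_sequence[OF u]) (rule that)
  note su = H10_le_sqint[OF u]
  note [measurable] = sqint_borel[OF su] Cc_borel[OF test_function_Cc[OF \<phi>(1)]]
  obtain r :: "nat \<Rightarrow> nat" where r: "strict_mono r" "AE x in lborel. (\<lambda>n. \<phi> (r n) x) \<longlonglongrightarrow> u x"
    by (rule l2_AE_subseq[OF test_function_sqint[OF \<phi>(1)] su \<phi>(2)]) (rule that)
  have "(\<lambda>n. l2 lborel (\<phi> n)) \<longlonglongrightarrow> l2 lborel u" by (rule l2_tendsto[OF test_function_sqint[OF \<phi>(1)] su \<phi>(2)])
  then have "Bseq (\<lambda>n. l2 lborel (\<phi> n))" using convergent_imp_Bseq convergent_def by blast
  then obtain B where B: "\<And>n. norm (l2 lborel (\<phi> n)) \<le> B" unfolding Bseq_def by blast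
  define C where "C = 4096 * (B\<^sup>2 + (c + 1)) ^ 3"
  have bd: "(\<integral>\<^sup>+x. ennreal (\<phi> n x ^ 6) \<partial>lborel) \<le> ennreal C" for n
  proof -
    have "(l2 lborel (\<phi> n))\<^sup>2 \<le> B\<^sup>2" using B[of n] by (intro power_mono) auto
    then have "(\<integral>x. \<phi> n x ^ 2 \<partial>lborel) \<le> B\<^sup>2" by (simp add: l2_sq)
    moreover have "dirichlet (\<phi> n) \<le> c + 1"
    proof -
      have "1 / real (Suc n) \<le> 1" by simp
      then show ?thesis using \<phi>(3)[of n] by linarith
    qed
    moreover have "0 \<le> (\<integral>x. \<phi> n x ^ 2 \<partial>lborel)" by simp
    ultimately have "4096 * ((\<integral>x. \<phi> n x ^ 2 \<partial>lborel) + dirichlet (\<phi> n)) ^ 3 \<le> C"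
      unfolding C_def using dirichlet_nonneg[of "\<phi> n"] by (intro mult_left_mono power_mono add_mono) auto
    with sobolev[OF \<phi>(1) dim, of n] show ?thesis
      using nn_integral_Cc_power[OF test_function_Cc[OF \<phi>(1)], of 6 n] by (simp add: ennreal_leI)
  qed
  have "(\<integral>\<^sup>+x. ennreal (u x ^ 6) \<partial>lborel) = (\<integral>\<^sup>+x. liminf (\<lambda>n. ennreal (\<phi> (r n) x ^ 6)) \<partial>lborel)"
  proof (rule nn_integral_cong_AE)
    show "AE x in lborel. ennreal (u x ^ 6) = liminf (\<lambda>n. ennreal (\<phi> (r n) x ^ 6))"
      using r(2)
    proof eventually_elim
      case (elim x)
      have "(\<lambda>n. ennreal (\<phi> (r n) x ^ 6)) \<longlonglongrightarrow> ennreal (u x ^ 6)" by (intro tendsto_intros elim)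
      then show ?case by (rule lim_imp_Liminf[OF trivial_limit_sequentially, symmetric])
    qed
  qed
  also have "\<dots> \<le> liminf (\<lambda>n. \<integral>\<^sup>+x. ennreal (\<phi> (r n) x ^ 6) \<partial>lborel)"
    by (rule nn_integral_liminf) measurable
  also have "\<dots> \<le> ennreal C" by (intro Liminf_le) (auto simp: bd)
  also have "\<dots> < \<infinity>" by simp
  finally show ?thesis by (simp add: integrable_iff_bounded)
qed

section \<open>Ball averages and Rellich compactness\<close>

lemma sqint_shift:
  fixes f :: "'a::euclidean_space \<Rightarrow> real"
  assumes "sqint lborel f"
  shows "sqint lborel (\<lambda>x. f (x + z))" "l2 lborel (\<lambda>x. f (x + z)) = l2 lborel f"
proof -
  note [measurable] = sqint_borel[OF assms]
  have "integrable (distr lborel borel ((+) z)) (\<lambda>x. (norm (f x))\<^sup>2)"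
    using sqint_integrable[OF assms] by (simp add: lborel_distr_plus)
  then have "integrable lborel (\<lambda>x. (norm (f (z + x)))\<^sup>2)" by (subst (asm) integrable_distr_eq) auto
  then show "sqint lborel (\<lambda>x. f (x + z))" by (simp add: sqint_def add.commute)
  show "l2 lborel (\<lambda>x. f (x + z)) = l2 lborel f"
    unfolding l2_def by (subst lborel_integral_shift) auto
qed

lemma H10_le_translation:
  fixes u :: "'a::euclidean_space \<Rightarrow> real"
  assumes "H10_le D u c"
  shows "l2 lborel (\<lambda>x. u (x + z) - u x) \<le> norm z * sqrt c"
proof -
  obtain \<phi> :: "nat \<Rightarrow> 'a \<Rightarrow> real" where \<phi>: "\<And>n. test_function D (\<phi> n)"
    "(\<lambda>n. l2 lborel (\<lambda>x. \<phi> n x - u x)) \<longlonglongrightarrow> 0" "\<And>n. dirichlet (\<phi> n) < c + 1 / real (Suc n)"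
    by (rule H10_le_sequence[OF assms]) (rule that)
  note su = H10_le_sqint[OF assms] and s\<phi> = test_function_sqint[OF \<phi>(1)]
  let ?d = "\<lambda>n. l2 lborel (\<lambda>x. \<phi> n x - u x)"
  have "l2 lborel (\<lambda>x. u (x + z) - u x) \<le> 2 * ?d n + norm z * sqrt (c + 1 / real (Suc n))" for n
  proof -
    have "l2 lborel (\<lambda>x. u (x + z) - u x) \<le> l2 lborel (\<lambda>x. u (x + z) - \<phi> n (x + z)) + l2 lborel (\<lambda>x. \<phi> n (x + z) - u x)"
      by (intro l2_triangle_diff sqint_shift su s\<phi>)
    also have "l2 lborel (\<lambda>x. u (x + z) - \<phi> n (x + z)) = ?d n"
      using sqint_shift(2)[OF sqint_diff[OF su s\<phi>], of z n] by (simp add: l2_diff_commute[of lborel u])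
    also have "l2 lborel (\<lambda>x. \<phi> n (x + z) - u x) \<le> l2 lborel (\<lambda>x. \<phi> n (x + z) - \<phi> n x) + ?d n"
      by (intro l2_triangle_diff sqint_shift su s\<phi>)
    also have "l2 lborel (\<lambda>x. \<phi> n (x + z) - \<phi> n x) \<le> norm z * sqrt (c + 1 / real (Suc n))"
    proof -
      have "(l2 lborel (\<lambda>x. \<phi> n (x + z) - \<phi> n x))\<^sup>2 \<le> (norm z)\<^sup>2 * dirichlet (\<phi> n)"
        unfolding l2_sq by (rule dirichlet_translation[OF \<phi>(1)])
      also have "\<dots> \<le> (norm z)\<^sup>2 * (c + 1 / real (Suc n))"
        using \<phi>(3)[of n] by (intro mult_left_mono) auto
      finally have "l2 lborel (\<lambda>x. \<phi> n (x + z) - \<phi> n x) \<le> sqrt ((norm z)\<^sup>2 * (c + 1 / real (Suc n)))"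
        by (rule real_le_rsqrt)
      then show ?thesis by (simp add: real_sqrt_mult)
    qed
    finally show ?thesis by simp
  qed
  moreover have "(\<lambda>n. 2 * ?d n + norm z * sqrt (c + 1 / real (Suc n))) \<longlonglongrightarrow> 2 * 0 + norm z * sqrt (c + 0)"
    by (intro tendsto_intros \<phi>(2) LIMSEQ_Suc[OF lim_1_over_n])
  ultimately show ?thesis by (intro LIMSEQ_le_const) auto
qed

text \<open>Convolution with the normalised indicator of a ball. No smoothness is asked of it:
  Lipschitz continuity suffices for compactness, and the symmetry of the ball under reflections is
  used when minimisers are shown to be radial.\<close>

definition ball_avg :: "real \<Rightarrow> ('a::euclidean_space \<Rightarrow> real) \<Rightarrow> 'a \<Rightarrow> real" where
  "ball_avg r u x = (\<integral>z. indicator (ball 0 r) z *\<^sub>R u (x + z) \<partial>lborel) / measure lborel (ball (0::'a) r)"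

lemma sqint_ball: "sqint lborel (indicator (ball 0 r) :: 'a::euclidean_space \<Rightarrow> real)"
  by (rule sqint_indicator) (use emeasure_lborel_ball_finite in auto)

lemma l2_ball: "(l2 lborel (indicator (ball 0 r) :: 'a::euclidean_space \<Rightarrow> real))\<^sup>2 = measure lborel (ball (0::'a) r)"
proof -
  have "(norm (indicator (ball 0 r) x :: real))\<^sup>2 = indicator (ball 0 r) x" for x :: 'a by (simp add: indicator_def)
  then show ?thesis unfolding l2_sq using emeasure_lborel_ball_finite[of "0::'a" r] by simp
qed

lemma ball_avg_diff:
  fixes u v :: "'a::euclidean_space \<Rightarrow> real"
  assumes "sqint lborel u" "sqint lborel v" and r: "r > 0"
  shows "\<bar>ball_avg r u x - ball_avg r v y\<bar> \<le> l2 lborel (\<lambda>z. u (x + z) - v (y + z)) / sqrt (measure lborel (ball (0::'a) r))"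
proof -
  let ?V = "measure lborel (ball (0::'a) r)"
  have V: "?V > 0" using content_ball_pos[OF r] .
  have s: "sqint lborel (\<lambda>z. u (x + z))" "sqint lborel (\<lambda>z. v (y + z))"
    using sqint_shift(1)[OF assms(1), of x] sqint_shift(1)[OF assms(2), of y] by (simp_all add: add.commute)
  have "ball_avg r u x - ball_avg r v y = (\<integral>z. indicator (ball 0 r) z *\<^sub>R (u (x + z) - v (y + z)) \<partial>lborel) / ?V"
    unfolding ball_avg_def diff_divide_distrib[symmetric]
    by (subst Bochner_Integration.integral_diff[symmetric])
      (auto intro!: sqint_integrable_product sqint_ball s simp: scaleR_diff_right simp del: real_scaleR_def)
  moreover have "\<bar>\<integral>z. indicator (ball 0 r) z *\<^sub>R (u (x + z) - v (y + z)) \<partial>lborel\<bar>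
      \<le> sqrt ?V * l2 lborel (\<lambda>z. u (x + z) - v (y + z))"
  proof -
    have "sqrt ?V = l2 lborel (indicator (ball 0 r) :: 'a \<Rightarrow> real)" by (simp add: l2_ball[symmetric])
    then show ?thesis using l2_product_bound[OF sqint_ball sqint_diff[OF s], of r] by simp
  qed
  ultimately have "\<bar>ball_avg r u x - ball_avg r v y\<bar> \<le> sqrt ?V * l2 lborel (\<lambda>z. u (x + z) - v (y + z)) / ?V"
    using V by (simp add: divide_right_mono)
  also have "\<dots> = l2 lborel (\<lambda>z. u (x + z) - v (y + z)) / sqrt ?V"
    using V real_sqrt_mult_self[of ?V] by (simp add: field_simps)
  finally show ?thesis .
qed

lemma ball_avg_bound:
  fixes u :: "'a::euclidean_space \<Rightarrow> real"
  assumes "sqint lborel u" "r > 0"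
  shows "\<bar>ball_avg r u x\<bar> \<le> l2 lborel u / sqrt (measure lborel (ball (0::'a) r))"
  using ball_avg_diff[OF assms(1) sqint_zero assms(2), of x] sqint_shift(2)[OF assms(1), of x]
  by (simp add: ball_avg_def add.commute)

text \<open>Cauchy-Schwarz over the ball turns the L^2 bound for translations into a pointwise
  one.\<close>

lemma ball_avg_lipschitz:
  fixes u :: "'a::euclidean_space \<Rightarrow> real"
  assumes u: "H10_le D u c" and r: "r > 0"
  shows "\<bar>ball_avg r u x - ball_avg r u y\<bar> \<le> norm (x - y) * (sqrt c / sqrt (measure lborel (ball (0::'a) r)))"
proof -
  note su = H10_le_sqint[OF u]
  have d: "sqint lborel (\<lambda>z. u (z + (x - y)) - u z)" by (intro sqint_diff sqint_shift su)
  have "l2 lborel (\<lambda>z. u (x + z) - u (y + z)) = l2 lborel (\<lambda>z. u (z + (x - y)) - u z)"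
    using sqint_shift(2)[OF d, of y] by (simp add: algebra_simps)
  also have "\<dots> \<le> norm (x - y) * sqrt c" by (rule H10_le_translation[OF u])
  finally have "l2 lborel (\<lambda>z. u (x + z) - u (y + z)) / sqrt (measure lborel (ball (0::'a) r))
     \<le> norm (x - y) * sqrt c / sqrt (measure lborel (ball (0::'a) r))"
    by (intro divide_right_mono) auto
  with ball_avg_diff[OF su su r, of x y] show ?thesis by simp
qed

lemma borel_measurable_ball_avg [measurable]:
  fixes u :: "'a::euclidean_space \<Rightarrow> real"
  assumes [measurable]: "u \<in> borel_measurable borel"
  shows "ball_avg r u \<in> borel_measurable borel"
proof -
  have [measurable]: "ball (0::'a) r \<in> sets borel" by simp
  have "(\<lambda>p. indicator (ball 0 r) (snd p) *\<^sub>R u (fst p + snd p)) \<in> borel_measurable (borel \<Otimes>\<^sub>M (borel :: 'a measure))"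
    by measurable
  then have "(\<lambda>(x, z). indicator (ball 0 r) z *\<^sub>R u (x + z)) \<in> borel_measurable (borel \<Otimes>\<^sub>M (lborel :: 'a measure))"
    using measurable_cong_sets[OF sets_pair_measure_cong[OF refl sets_lborel] refl] by (auto simp: case_prod_beta)
  from lborel.borel_measurable_lebesgue_integral[OF this] show ?thesis
    unfolding ball_avg_def by (intro borel_measurable_divide borel_measurable_const)
qed

text \<open>By Cauchy-Schwarz, the squared error at x is at most the mean over |z| < r of the
  squared difference between u (x + z) and u x. Exchanging the integrals leaves the mean of squared
  translation differences, each of them at most r^2 c.\<close>

lemma ball_avg_approx:
  fixes u :: "'a::euclidean_space \<Rightarrow> real"
  assumes u: "H10_le D u c" and r: "r > 0"
  shows "sqint lborel (ball_avg r u)" "l2 lborel (\<lambda>x. ball_avg r u x - u x) \<le> r * sqrt c"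
proof -
  let ?V = "measure lborel (ball (0::'a) r)"
  have V: "?V > 0" using content_ball_pos[OF r] .
  note su = H10_le_sqint[OF u]
  have [measurable]: "u \<in> borel_measurable borel" using sqint_borel[OF su] by simp
  have c: "c \<ge> 0" by (rule H10_le_nonneg[OF u])
  let ?h = "\<lambda>x z. indicator (ball 0 r) z * (u (x + z) - u x)"
  have pt: "ennreal ((ball_avg r u x - u x)\<^sup>2) \<le> (\<integral>\<^sup>+z. ennreal ((?h x z)\<^sup>2 / ?V) \<partial>lborel)" for x
  proof -
    have i1: "integrable lborel (\<lambda>z. indicator (ball 0 r) z *\<^sub>R u (x + z))"
      using sqint_shift(1)[OF su, of x] by (intro sqint_integrable_product sqint_ball) (simp add: add.commute)
    have i2: "integrable lborel (\<lambda>z::'a. indicator (ball 0 r) z *\<^sub>R u x)"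
      using emeasure_lborel_ball_finite[of "0::'a" r] by (intro integrable_scaleR_left integrable_real_indicator) auto
    have c0: "(\<integral>z. indicator (ball (0::'a) r) z *\<^sub>R u x \<partial>lborel) = ?V * u x"
      using emeasure_lborel_ball_finite[of "0::'a" r] by simp
    have eq: "ball_avg r u x - u x = (\<integral>z. ?h x z \<partial>lborel) / ?V"
    proof -
      have "(\<integral>z. ?h x z \<partial>lborel) = (\<integral>z. indicator (ball 0 r) z *\<^sub>R u (x + z) \<partial>lborel) - ?V * u x"
        using Bochner_Integration.integral_diff[OF i1 i2] c0 by (simp add: right_diff_distrib)
      then show ?thesis using V by (simp add: ball_avg_def field_simps)
    qed
    have ih: "sqint lborel (?h x)"
    proof -
      have 1: "sqint lborel (\<lambda>z. indicator (ball 0 r) z * u (x + z))"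
        by (rule sqint_bound[OF _ sqint_integrable[OF sqint_shift(1)[OF su, of x]]]) (auto simp: indicator_def add.commute)
      have 2: "sqint lborel (\<lambda>z. indicator (ball 0 r) z * u x)"
        using sqint_scaleR[OF sqint_ball, of "u x" r] by (simp add: mult.commute)
      show ?thesis using sqint_diff[OF 1 2] by (simp add: right_diff_distrib)
    qed
    have "\<bar>\<integral>z. ?h x z \<partial>lborel\<bar> \<le> l2 lborel (indicator (ball 0 r) :: 'a \<Rightarrow> real) * l2 lborel (?h x)"
    proof -
      have "(\<lambda>z. indicator (ball 0 r) z *\<^sub>R ?h x z) = ?h x" by (auto simp: indicator_def)
      then show ?thesis using l2_product_bound[OF sqint_ball ih, of r] by (simp only: real_norm_def)
    qed
    then have "(\<integral>z. ?h x z \<partial>lborel)\<^sup>2 \<le> (l2 lborel (indicator (ball 0 r) :: 'a \<Rightarrow> real) * l2 lborel (?h x))\<^sup>2"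
      by (subst power2_abs[symmetric]) (rule power_mono, auto)
    also have "\<dots> = ?V * (\<integral>z. (?h x z)\<^sup>2 \<partial>lborel)"
      by (subst power_mult_distrib, subst l2_ball, subst l2_sq) simp
    finally have "(ball_avg r u x - u x)\<^sup>2 \<le> (\<integral>z. (?h x z)\<^sup>2 / ?V \<partial>lborel)"
      unfolding eq using V by (simp add: power_divide field_simps power2_eq_square)
    moreover have "integrable lborel (\<lambda>z. (?h x z)\<^sup>2 / ?V)" using sqint_integrable[OF ih] by simp
    ultimately show ?thesis using V by (subst nn_integral_eq_integral) (auto intro!: ennreal_leI)
  qed
  have "(\<integral>\<^sup>+x. ennreal ((ball_avg r u x - u x)\<^sup>2) \<partial>lborel) \<le> (\<integral>\<^sup>+x. \<integral>\<^sup>+z. ennreal ((?h x z)\<^sup>2 / ?V) \<partial>lborel \<partial>lborel)"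
    by (intro nn_integral_mono pt)
  also have "\<dots> = (\<integral>\<^sup>+z. \<integral>\<^sup>+x. ennreal ((?h x z)\<^sup>2 / ?V) \<partial>lborel \<partial>lborel)"
  proof (rule lborel_pair.Fubini')
    have [measurable]: "ball (0::'a) r \<in> sets borel" by simp
    define V where "V = ?V"
    have "(\<lambda>p. ennreal ((?h (snd p) (fst p))\<^sup>2 / V)) \<in> borel_measurable (borel \<Otimes>\<^sub>M borel)" by measurable
    then show "(\<lambda>(z, x). ennreal ((?h x z)\<^sup>2 / ?V)) \<in> borel_measurable (lborel \<Otimes>\<^sub>M lborel)"
      using measurable_cong_sets[OF sets_pair_measure_cong[OF sets_lborel sets_lborel] refl]
      by (auto simp: case_prod_beta V_def)
  qed
  also have "\<dots> \<le> (\<integral>\<^sup>+z. ennreal (r\<^sup>2 * c / ?V) * indicator (ball (0::'a) r) z \<partial>lborel)"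
  proof (intro nn_integral_mono)
    fix z :: 'a
    show "(\<integral>\<^sup>+x. ennreal ((?h x z)\<^sup>2 / ?V) \<partial>lborel) \<le> ennreal (r\<^sup>2 * c / ?V) * indicator (ball 0 r) z"
    proof (cases "z \<in> ball 0 r")
      case True
      have d: "sqint lborel (\<lambda>x. u (x + z) - u x)" by (intro sqint_diff sqint_shift su)
      have "(l2 lborel (\<lambda>x. u (x + z) - u x))\<^sup>2 \<le> (norm z * sqrt c)\<^sup>2"
        by (intro power_mono H10_le_translation[OF u]) auto
      also have "\<dots> \<le> r\<^sup>2 * c"
        using True c by (auto simp: power_mult_distrib intro!: mult_right_mono power_mono)
      finally have "(\<integral>x. (u (x + z) - u x)\<^sup>2 \<partial>lborel) \<le> r\<^sup>2 * c" by (simp add: l2_sq)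
      then have "(\<integral>x. (u (x + z) - u x)\<^sup>2 / ?V \<partial>lborel) \<le> r\<^sup>2 * c / ?V" using V by (simp add: divide_right_mono)
      moreover have "integrable lborel (\<lambda>x. (u (x + z) - u x)\<^sup>2 / ?V)" using sqint_integrable[OF d] by simp
      ultimately show ?thesis using True by (simp add: nn_integral_eq_integral ennreal_leI)
    qed auto
  qed
  also have "\<dots> = ennreal (r\<^sup>2 * c)"
  proof -
    have "emeasure lborel (ball (0::'a) r) = ennreal ?V"
      using emeasure_lborel_ball_finite[of "0::'a" r] by (simp add: emeasure_eq_ennreal_measure less_top)
    then show ?thesis using V c by (simp add: nn_integral_cmult_indicator ennreal_mult[symmetric])
  qed
  finally have fin: "(\<integral>\<^sup>+x. ennreal ((ball_avg r u x - u x)\<^sup>2) \<partial>lborel) \<le> ennreal (r\<^sup>2 * c)" .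
  then have sd: "sqint lborel (\<lambda>x. ball_avg r u x - u x)"
    by (auto simp: sqint_def integrable_iff_bounded intro: le_less_trans)
  show "sqint lborel (ball_avg r u)" using sqint_add[OF sd su] by simp
  have "(l2 lborel (\<lambda>x. ball_avg r u x - u x))\<^sup>2 \<le> r\<^sup>2 * c"
    using fin sqint_integrable[OF sd] c by (simp add: nn_integral_eq_integral l2_sq)
  then have "l2 lborel (\<lambda>x. ball_avg r u x - u x) \<le> sqrt (r\<^sup>2 * c)" by (rule real_le_rsqrt)
  then show "l2 lborel (\<lambda>x. ball_avg r u x - u x) \<le> r * sqrt c" using r by (simp add: real_sqrt_mult)
qed

lemma ball_avg_zero:
  assumes "\<And>z. norm z < r \<Longrightarrow> u (x + z) = 0" shows "ball_avg r u x = 0"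
proof -
  have "(\<lambda>z. indicator (ball 0 r) z *\<^sub>R u (x + z)) = (\<lambda>z. 0)" using assms by (auto simp: indicator_def)
  then show ?thesis by (simp add: ball_avg_def del: real_scaleR_def)
qed

text \<open>Sign and vanishing off D are required at every point, so that later arguments can use
  them pointwise.\<close>

definition H10_pos :: "'a::euclidean_space set \<Rightarrow> ('a \<Rightarrow> real) \<Rightarrow> real \<Rightarrow> bool" where
  "H10_pos D u c \<longleftrightarrow> H10_le D u c \<and> (\<forall>x. 0 \<le> u x) \<and> (\<forall>x. x \<notin> D \<longrightarrow> u x = 0)"

lemma H10_posD:
  assumes "H10_pos D u c"
  shows "H10_le D u c" "0 \<le> u x" "x \<notin> D \<Longrightarrow> u x = 0" "sqint lborel u" "u \<in> borel_measurable borel"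
proof -
  show "H10_le D u c" "0 \<le> u x" "x \<notin> D \<Longrightarrow> u x = 0" using assms by (auto simp: H10_pos_def)
  then show "sqint lborel u" by (blast intro: H10_le_sqint)
  then show "u \<in> borel_measurable borel" using sqint_borel by fastforce
qed

text \<open>For fixed r the averages are uniformly bounded, equi-Lipschitz and supported in a common
  ball, so Arzela-Ascoli applies to them. In the bound, the term 2 sqrt C r is twice the distance
  from a function to its average, and the remaining r absorbs the distance between averages.\<close>

lemma rellich_subsequence:
  fixes u :: "nat \<Rightarrow> 'a::euclidean_space \<Rightarrow> real"
  assumes D: "bounded D" and u: "\<And>n. H10_pos D (u n) (c n)"
    and C: "\<And>n. l2 lborel (u n) \<le> C" "\<And>n. c n \<le> C" and r: "0 < r" "r \<le> 1"
  obtains k where "strict_mono (k :: nat \<Rightarrow> nat)"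
    "\<exists>N. \<forall>m\<ge>N. \<forall>n\<ge>N. l2 lborel (\<lambda>x. u (k m) x - u (k n) x) \<le> (2 * sqrt C + 1) * r"
proof -
  let ?V = "measure lborel (ball (0::'a) r)"
  have V: "?V > 0" using content_ball_pos[OF r(1)] .
  have C0: "C \<ge> 0" using C(1)[of 0] l2_nonneg[of lborel "u 0"] by linarith
  have c0: "c n \<ge> 0" for n by (rule H10_le_nonneg[OF H10_posD(1)[OF u]])
  obtain R where R: "R > 0" "\<And>x. x \<in> D \<Longrightarrow> norm x \<le> R" using D by (auto simp: bounded_pos)
  \<comment> \<open>Averaging over radius r \<le> 1 enlarges the support by at most 1.\<close>
  let ?S = "cball (0::'a) (R + 1)"
  let ?A = "\<lambda>n. ball_avg r (u n)"
  define L where "L = sqrt C / sqrt ?V"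
  have L: "L \<ge> 0" using C0 by (simp add: L_def)
  have lip: "\<bar>?A n x - ?A n y\<bar> \<le> norm (x - y) * L" for n x y
  proof -
    have "sqrt (c n) / sqrt ?V \<le> L" unfolding L_def using C(2)[of n] by (intro divide_right_mono) auto
    then have "norm (x - y) * (sqrt (c n) / sqrt ?V) \<le> norm (x - y) * L" by (intro mult_left_mono) auto
    with ball_avg_lipschitz[OF H10_posD(1)[OF u] r(1), of n x y] show ?thesis by linarith
  qed
  have bd: "norm (?A n x) \<le> C / sqrt ?V" for n x
    using ball_avg_bound[OF H10_posD(4)[OF u] r(1), of n x] C(1)[of n]
    by (smt (verit) divide_right_mono real_norm_def real_sqrt_ge_zero V)
  have out: "?A n x = 0" if "x \<notin> ?S" for n x
  proof (rule ball_avg_zero)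
    fix z :: 'a assume "norm z < r"
    then have "norm (x + z) > R" using that r(2) norm_triangle_ineq4[of "x + z" z] by simp
    then have "x + z \<notin> D" using R(2) by force
    then show "u n (x + z) = 0" by (rule H10_posD(3)[OF u])
  qed
  obtain g k where k: "strict_mono (k :: nat \<Rightarrow> nat)"
    and g: "\<And>e. 0 < e \<Longrightarrow> \<exists>N. \<forall>n x. n \<ge> N \<and> x \<in> ?S \<longrightarrow> norm (?A (k n) x - g x) < e"
  proof (rule Arzela_Ascoli[of ?S ?A "C / sqrt ?V"])
    show "compact ?S" by simp
    show "norm (?A n x) \<le> C / sqrt ?V" for n x by (rule bd)
    fix x and e :: real assume e: "0 < e"
    have "norm (?A n x - ?A n y) < e" if "norm (x - y) < e / (L + 1)" for n y
    proof -
      have "norm (?A n x - ?A n y) \<le> norm (x - y) * L" using lip by simp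
      also have "\<dots> \<le> norm (x - y) * (L + 1)" by (intro mult_left_mono) auto
      also have "\<dots> < e" using that L by (simp add: field_simps)
      finally show ?thesis .
    qed
    then show "\<exists>d. 0 < d \<and> (\<forall>n y. y \<in> ?S \<and> norm (x - y) < d \<longrightarrow> norm (?A n x - ?A n y) < e)"
      using e L by (intro exI[of _ "e / (L + 1)"]) auto
  qed (rule that)
  define W where "W = measure lborel ?S"
  have Sfin: "emeasure lborel ?S < \<infinity>" by (rule emeasure_lborel_cball_finite)
  \<comment> \<open>Chosen so that a uniform distance 2 e on a set of volume W has L^2 norm at most
    r; the added 1 keeps the denominator positive.\<close>
  define e where "e = r / (2 * (sqrt W + 1))"
  have sW: "sqrt W \<ge> 0" by (simp add: W_def)
  have e: "e > 0" unfolding e_def using r(1) sW by (intro divide_pos_pos mult_pos_pos add_nonneg_pos) auto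
  obtain N where N: "\<And>n x. n \<ge> N \<Longrightarrow> x \<in> ?S \<Longrightarrow> norm (?A (k n) x - g x) < e" using g[OF e] by blast
  have "l2 lborel (\<lambda>x. u (k m) x - u (k n) x) \<le> (2 * sqrt C + 1) * r" if mn: "m \<ge> N" "n \<ge> N" for m n
  proof -
    note su = H10_posD(4)[OF u] and sa = ball_avg_approx(1)[OF H10_posD(1)[OF u] r(1)]
    have ap: "l2 lborel (\<lambda>x. ?A n x - u n x) \<le> r * sqrt C" for n
      using ball_avg_approx(2)[OF H10_posD(1)[OF u] r(1), of n] C(2)[of n] r(1)
      by (meson mult_left_mono order_trans real_sqrt_le_mono less_imp_le)
    have "l2 lborel (\<lambda>x. ?A (k m) x - ?A (k n) x) \<le> l2 lborel (\<lambda>x. (2 * e) *\<^sub>R indicator ?S x :: real)"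
    proof (rule l2_mono)
      show "sqint lborel (\<lambda>x. (2 * e) *\<^sub>R indicator ?S x :: real)"
        by (intro sqint_scaleR sqint_indicator Sfin) auto
      show "AE x in lborel. norm (?A (k m) x - ?A (k n) x) \<le> norm ((2 * e) *\<^sub>R indicator ?S x :: real)"
      proof (intro AE_I2)
        fix x
        show "norm (?A (k m) x - ?A (k n) x) \<le> norm ((2 * e) *\<^sub>R indicator ?S x :: real)"
        proof (cases "x \<in> ?S")
          case True
          then show ?thesis using N[OF mn(1) True] N[OF mn(2) True] e by (simp add: abs_less_iff abs_le_iff)
        qed (simp add: out)
      qed
    qed (intro sqint_diff sa)
    also have "\<dots> = 2 * e * sqrt W"
    proof -
      have "(norm (indicator ?S x :: real))\<^sup>2 = indicator ?S x" for x by (simp add: indicator_def)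
      then have "l2 lborel (indicator ?S :: 'a \<Rightarrow> real) = sqrt W" using Sfin by (simp add: l2_def W_def)
      then show ?thesis using e by (simp add: l2_scaleR del: real_scaleR_def)
    qed
    also have "2 * e * sqrt W = r * (sqrt W / (sqrt W + 1))"
    proof -
      have "2 * (r / (2 * t)) * sqrt W = r * (sqrt W / t)" for t by simp
      then show ?thesis by (simp only: e_def)
    qed
    also have "\<dots> \<le> r * 1"
    proof (rule mult_left_mono)
      have "sqrt W + 1 > 0" using sW by linarith
      then show "sqrt W / (sqrt W + 1) \<le> 1" by (simp only: divide_le_eq_1_pos)
    qed (use r in simp)
    finally have A: "l2 lborel (\<lambda>x. ?A (k m) x - ?A (k n) x) \<le> r" by simp
    have "l2 lborel (\<lambda>x. u (k m) x - u (k n) x) \<le> l2 lborel (\<lambda>x. u (k m) x - ?A (k m) x) + l2 lborel (\<lambda>x. ?A (k m) x - u (k n) x)"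
      by (rule l2_triangle_diff[OF su sa su])
    also have "l2 lborel (\<lambda>x. ?A (k m) x - u (k n) x) \<le> l2 lborel (\<lambda>x. ?A (k m) x - ?A (k n) x) + l2 lborel (\<lambda>x. ?A (k n) x - u (k n) x)"
      by (rule l2_triangle_diff[OF sa sa su])
    finally show ?thesis using A ap[of "k m"] ap[of "k n"]
      by (simp add: l2_diff_commute[of lborel "u (k m)"] algebra_simps)
  qed
  with k show thesis by (intro that) blast+
qed

text \<open>A diagonal sequence over the radii 1/(j+1) is Cauchy in L^2. A further subsequence makes
  the bounds converge inside the interval from 0 to C, and closedness of the relaxed class does the
  rest.\<close>

lemma rellich:
  fixes u :: "nat \<Rightarrow> 'a::euclidean_space \<Rightarrow> real"
  assumes D: "open D" "bounded D" and u: "\<And>n. H10_pos D (u n) (c n)"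
    and C: "\<And>n. l2 lborel (u n) \<le> C" "\<And>n. c n \<le> C"
  obtains k v d where "strict_mono (k :: nat \<Rightarrow> nat)" "H10_pos D v d"
    "(\<lambda>n. l2 lborel (\<lambda>x. u (k n) x - v x)) \<longlonglongrightarrow> 0" "(\<lambda>n. c (k n)) \<longlonglongrightarrow> d"
proof -
  define P where "P j s \<longleftrightarrow> (\<exists>N. \<forall>m\<ge>N. \<forall>n\<ge>N. l2 lborel (\<lambda>x. u (s m) x - u (s n) x) \<le> (2 * sqrt C + 1) * (1 / real (Suc j)))"
    for j :: nat and s :: "nat \<Rightarrow> nat"
  interpret subseqs P
  proof
    fix j and s :: "nat \<Rightarrow> nat" assume "strict_mono s"
    obtain k where "strict_mono (k :: nat \<Rightarrow> nat)"
      "\<exists>N. \<forall>m\<ge>N. \<forall>n\<ge>N. l2 lborel (\<lambda>x. u (s (k m)) x - u (s (k n)) x) \<le> (2 * sqrt C + 1) * (1 / real (Suc j))"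
      by (rule rellich_subsequence[OF D(2), of "\<lambda>n. u (s n)" "\<lambda>n. c (s n)" C "1 / real (Suc j)"])
        (use u C in auto)
    then show "\<exists>r'. strict_mono r' \<and> P j (s \<circ> r')" by (auto simp: P_def)
  qed
  \<comment> \<open>Each tail of the diagonal sequence is a subsequence of one of the chosen
    subsequences, so \<open>P j\<close> has to be inherited by subsequences.\<close>
  have stable: "P j (s \<circ> r)" if r: "strict_mono r" and P: "P j s" for r s j
  proof -
    obtain N where N: "\<And>m n. m \<ge> N \<Longrightarrow> n \<ge> N \<Longrightarrow> l2 lborel (\<lambda>x. u (s m) x - u (s n) x) \<le> (2 * sqrt C + 1) * (1 / real (Suc j))"
      using P unfolding P_def by blast
    have "r m \<ge> N" if "m \<ge> N" for m using seq_suble[OF r, of m] that by linarith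
    then show ?thesis unfolding P_def o_def using N by blast
  qed
  have cauchy: "\<exists>N. \<forall>m\<ge>N. \<forall>n\<ge>N. l2 lborel (\<lambda>x. u (diagseq m) x - u (diagseq n) x) < e" if e: "e > 0" for e
  proof -
    obtain j where j: "(2 * sqrt C + 1) / e < real j" using reals_Archimedean2 by blast
    have "P j (diagseq \<circ> ((+) (Suc j)))" by (rule diagseq_holds[OF stable])
    then obtain N where N: "\<And>m n. m \<ge> N \<Longrightarrow> n \<ge> N \<Longrightarrow>
        l2 lborel (\<lambda>x. u (diagseq (Suc j + m)) x - u (diagseq (Suc j + n)) x) \<le> (2 * sqrt C + 1) * (1 / real (Suc j))"
      unfolding P_def o_def by blast
    have "l2 lborel (\<lambda>x. u (diagseq m) x - u (diagseq n) x) < e" if "m \<ge> N + Suc j" "n \<ge> N + Suc j" for m n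
    proof -
      have "l2 lborel (\<lambda>x. u (diagseq m) x - u (diagseq n) x) \<le> (2 * sqrt C + 1) * (1 / real (Suc j))"
        using N[of "m - Suc j" "n - Suc j"] that by simp
      also have "\<dots> < e"
      proof -
        have "2 * sqrt C + 1 < e * real j" using j e by (simp add: field_simps)
        then have "2 * sqrt C + 1 < e * real (Suc j)" using e by (simp add: algebra_simps)
        then show ?thesis by (simp add: divide_less_eq del: of_nat_Suc)
      qed
      finally show ?thesis .
    qed
    then show ?thesis by blast
  qed
  obtain w where w: "sqint lborel w" "(\<lambda>n. l2 lborel (\<lambda>x. u (diagseq n) x - w x)) \<longlonglongrightarrow> 0"
  proof (rule l2_complete[of lborel "\<lambda>n. u (diagseq n)"])
    show "sqint lborel (u (diagseq n))" for n by (rule H10_posD(4)[OF u])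
    show "\<exists>N. \<forall>m\<ge>N. \<forall>n\<ge>N. l2 lborel (\<lambda>x. u (diagseq m) x - u (diagseq n) x) < e" if "e > 0" for e
      by (rule cauchy[OF that])
  qed (rule that)
  have "c n \<in> {0..C}" for n using C(2)[of n] H10_le_nonneg[OF H10_posD(1)[OF u]] by auto
  then have "\<forall>n. c (diagseq n) \<in> {0..C}" by blast
  then obtain d r where r: "strict_mono (r :: nat \<Rightarrow> nat)" "((\<lambda>n. c (diagseq n)) \<circ> r) \<longlonglongrightarrow> d"
    by (rule seq_compactE[OF compact_imp_seq_compact[OF compact_Icc]]) (rule that)
  \<comment> \<open>The limit w has the required sign and zeros only up to a null set. Its pointwise
    projection v has them everywhere, and is no farther from \<open>u n\<close> because
    \<open>u n\<close> is fixed by the same 1-Lipschitz projection.\<close>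
  define v where "v x = indicator D x * max 0 (w x)" for x
  note [measurable] = sqint_borel[OF w(1)] borel_open[OF D(1)]
  have sv: "sqint lborel v"
    by (rule sqint_bound[OF _ sqint_integrable[OF w(1)]]) (auto simp: v_def[abs_def] indicator_def max_def)
  have le: "l2 lborel (\<lambda>x. u n x - v x) \<le> l2 lborel (\<lambda>x. u n x - w x)" for n
  proof (intro l2_mono sqint_diff H10_posD(4)[OF u] sv w AE_I2)
    fix x
    show "norm (u n x - v x) \<le> norm (u n x - w x)"
      using H10_posD(2)[OF u[of n], of x] H10_posD(3)[OF u[of n], of x]
      by (cases "x \<in> D") (auto simp: v_def indicator_def max_def abs_if)
  qed
  have limv: "(\<lambda>n. l2 lborel (\<lambda>x. u (diagseq (r n)) x - v x)) \<longlonglongrightarrow> 0"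
    by (rule Lim_null_comparison[OF _ LIMSEQ_subseq_LIMSEQ[OF w(2) r(1)]]) (use le in \<open>simp add: o_def\<close>)
  have limc: "(\<lambda>n. c (diagseq (r n))) \<longlonglongrightarrow> d" using r(2) by (simp add: o_def)
  have "H10_le D v d"
    by (rule H10_le_closed[OF _ sv limv limc]) (rule H10_posD(1)[OF u])
  then have "H10_pos D v d" by (auto simp: H10_pos_def v_def)
  then show thesis
    using strict_mono_o[OF subseq_diagseq r(1)] limv limc by (intro that[of "diagseq \<circ> r" v d]) (auto simp: o_def)
qed

section \<open>Operations on the relaxed class\<close>

lemma H10_le_cong_AE:
  fixes u v :: "'a::euclidean_space \<Rightarrow> real"
  assumes u: "H10_le D u c" and v: "v \<in> borel_measurable borel" and eq: "AE x in lborel. u x = v x"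
  shows "H10_le D v c"
proof -
  note su = H10_le_sqint[OF u]
  note [measurable] = v sqint_borel[OF su]
  have "integrable lborel (\<lambda>x. (norm (v x))\<^sup>2)"
    by (rule integrable_cong_AE_imp[OF sqint_integrable[OF su]]) (use eq in auto)
  then have sv: "sqint lborel v" by (simp add: sqint_def)
  have "l2 lborel (\<lambda>x. u x - v x) = 0"
    using l2_cong_AE[of "\<lambda>x. u x - v x" lborel "\<lambda>x. 0"] eq by (simp add: l2_def)
  then show ?thesis by (intro H10_le_closed[where w = "\<lambda>n. u" and d = "\<lambda>n. c", OF u sv]) auto
qed

lemma H10_le_scaleR:
  fixes u :: "'a::euclidean_space \<Rightarrow> real"
  assumes u: "H10_le D u c"
  shows "H10_le D (\<lambda>x. t *\<^sub>R u x) (t\<^sup>2 * c)"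
proof -
  obtain \<phi> :: "nat \<Rightarrow> 'a \<Rightarrow> real" where \<phi>: "\<And>n. test_function D (\<phi> n)"
    "(\<lambda>n. l2 lborel (\<lambda>x. \<phi> n x - u x)) \<longlonglongrightarrow> 0" "\<And>n. dirichlet (\<phi> n) < c + 1 / real (Suc n)"
    by (rule H10_le_sequence[OF u]) (rule that)
  have d: "dirichlet (\<lambda>x. t *\<^sub>R \<phi> n x) = t\<^sup>2 * dirichlet (\<phi> n)" for n
  proof -
    have "frechet_derivative (\<lambda>x. t *\<^sub>R \<phi> n x) (at x) b = t *\<^sub>R frechet_derivative (\<phi> n) (at x) b" for x b
      by (rule frechet_derivative_eqI[OF has_derivative_scaleR_right[OF test_function_has_derivative[OF \<phi>(1)]]])
    then have "(\<Sum>b\<in>Basis. (norm (frechet_derivative (\<lambda>x. t *\<^sub>R \<phi> n x) (at x) b))\<^sup>2)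
        = t\<^sup>2 * (\<Sum>b\<in>Basis. (norm (frechet_derivative (\<phi> n) (at x) b))\<^sup>2)" for x
      by (simp only: norm_scaleR power_mult_distrib power2_abs sum_distrib_left)
    then show ?thesis unfolding dirichlet_def by (simp only: integral_mult_right_zero)
  qed
  show ?thesis
  proof (rule H10_leI[OF sqint_scaleR[OF H10_le_sqint[OF u]] test_function_scaleR[OF \<phi>(1)]])
    have "l2 lborel (\<lambda>x. t *\<^sub>R \<phi> n x - t *\<^sub>R u x) = \<bar>t\<bar> * l2 lborel (\<lambda>x. \<phi> n x - u x)" for n
      using l2_scaleR[of lborel t "\<lambda>x. \<phi> n x - u x"] by (simp add: right_diff_distrib)
    then show "(\<lambda>n. l2 lborel (\<lambda>x. t *\<^sub>R \<phi> n x - t *\<^sub>R u x)) \<longlonglongrightarrow> 0"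
      using tendsto_mult_right_zero[OF \<phi>(2)] by simp
    show "dirichlet (\<lambda>x. t *\<^sub>R \<phi> n x) \<le> t\<^sup>2 * (c + 1 / real (Suc n))" for n
      unfolding d using \<phi>(3)[of n] by (intro mult_left_mono) auto
    have "(\<lambda>n. t\<^sup>2 * (c + 1 / real (Suc n))) \<longlonglongrightarrow> t\<^sup>2 * (c + 0)"
      by (intro tendsto_intros LIMSEQ_Suc[OF lim_1_over_n])
    then show "(\<lambda>n. t\<^sup>2 * (c + 1 / real (Suc n))) \<longlonglongrightarrow> t\<^sup>2 * c" by simp
  qed
qed

section \<open>Composition with Lipschitz functions and truncation\<close>

lemma dirichlet_mono:
  fixes f g :: "'a::euclidean_space \<Rightarrow> real"
  assumes "test_function D f" "test_function D' g"
    and "\<And>x b. b \<in> Basis \<Longrightarrow> \<bar>frechet_derivative f (at x) b\<bar> \<le> \<bar>frechet_derivative g (at x) b\<bar>"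
  shows "dirichlet f \<le> dirichlet g"
  unfolding dirichlet_def
  by (intro integral_mono dirichlet_integrable[OF assms(1)] dirichlet_integrable[OF assms(2)] sum_mono power_mono)
    (use assms(3) in auto)

lemma frechet_derivative_compose_real:
  fixes h :: "real \<Rightarrow> real" and f :: "'a::euclidean_space \<Rightarrow> real"
  assumes h: "smooth h" and f: "smooth f"
  shows "frechet_derivative (\<lambda>x. h (f x)) (at x) v = frechet_derivative h (at (f x)) 1 * frechet_derivative f (at x) v"
  by (rule trans[OF frechet_derivative_eqI[OF has_derivative_compose[OF smooth_has_derivative[OF f] smooth_has_derivative[OF h]]]
        frechet_derivative_real[OF smooth_differentiable[OF h]]])

lemma dirichlet_compose:
  fixes h :: "real \<Rightarrow> real" and f :: "'a::euclidean_space \<Rightarrow> real"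
  assumes h: "smooth h" "\<And>s. \<bar>frechet_derivative h (at s) 1\<bar> \<le> 1"
    and t: "test_function D (\<lambda>x. h (f x))" "test_function D' f"
  shows "dirichlet (\<lambda>x. h (f x)) \<le> dirichlet f"
proof (rule dirichlet_mono[OF t])
  fix x b
  show "\<bar>frechet_derivative (\<lambda>x. h (f x)) (at x) b\<bar> \<le> \<bar>frechet_derivative f (at x) b\<bar>"
    using mult_right_mono[OF h(2)[of "f x"], of "\<bar>frechet_derivative f (at x) b\<bar>"]
    by (simp only: frechet_derivative_compose_real[OF h(1) test_function_smooth[OF t(2)]] abs_mult abs_ge_zero mult_1_left)
qed

lemma derivative_le_1_imp_lipschitz:
  fixes h :: "real \<Rightarrow> real"
  assumes h: "smooth h" "\<And>s. \<bar>frechet_derivative h (at s) 1\<bar> \<le> 1"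
  shows "\<bar>h s - h t\<bar> \<le> \<bar>s - t\<bar>"
proof -
  have "norm (h s - h t) \<le> 1 * norm (s - t)"
  proof (rule differentiable_bound[where S = UNIV and f' = "\<lambda>s. frechet_derivative h (at s)"])
    fix x
    show "(h has_derivative frechet_derivative h (at x)) (at x within UNIV)" using smooth_has_derivative[OF h(1)] .
    have "norm (frechet_derivative h (at x) v) \<le> 1 * norm v" for v
      using mult_right_mono[OF h(2)[of x], of "\<bar>v\<bar>"]
      by (subst frechet_derivative_real[OF smooth_differentiable[OF h(1)]]) (simp add: abs_mult)
    then show "onorm (frechet_derivative h (at x)) \<le> 1" by (intro onorm_le) auto
  qed auto
  then show ?thesis by simp
qed

lemma sqint_indicator_domain:
  assumes "open D" "bounded (D :: 'a::euclidean_space set)"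
  shows "sqint lborel (indicator D :: 'a \<Rightarrow> real)"
  by (rule sqint_indicator) (use assms emeasure_bounded_finite[OF assms(2)] in auto)

text \<open>Replaces the chain rule for weak derivatives: g only has to be a uniform limit of smooth
  functions with slopes at most 1 that vanish at 0. As D is bounded, uniform closeness implies
  closeness in L^2.\<close>

lemma H10_le_compose:
  fixes u :: "'a::euclidean_space \<Rightarrow> real" and h :: "nat \<Rightarrow> real \<Rightarrow> real"
  assumes D: "open D" "bounded D" and u: "H10_le D u c" and out: "\<And>x. x \<notin> D \<Longrightarrow> u x = 0"
    and h: "\<And>n. smooth (h n)" "\<And>n. h n 0 = 0" "\<And>n s. \<bar>frechet_derivative (h n) (at s) 1\<bar> \<le> 1"
    and g: "g \<in> borel_measurable borel" "g 0 = 0" "\<And>n s. \<bar>h n s - g s\<bar> \<le> e n" "e \<longlonglongrightarrow> 0"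
  shows "H10_le D (\<lambda>x. g (u x)) c"
proof -
  obtain \<phi> :: "nat \<Rightarrow> 'a \<Rightarrow> real" where \<phi>: "\<And>n. test_function D (\<phi> n)"
    "(\<lambda>n. l2 lborel (\<lambda>x. \<phi> n x - u x)) \<longlonglongrightarrow> 0" "\<And>n. dirichlet (\<phi> n) < c + 1 / real (Suc n)"
    by (rule H10_le_sequence[OF u]) (rule that)
  note su = H10_le_sqint[OF u]
  note s\<phi> = test_function_sqint[OF \<phi>(1)]
  note [measurable] = g(1) borel_measurable_continuous_onI[OF smooth_continuous[OF h(1)]] sqint_borel[OF su]
  have lip: "\<bar>h n s - h n t\<bar> \<le> \<bar>s - t\<bar>" for n s t by (rule derivative_le_1_imp_lipschitz[OF h(1,3)])
  have s1: "sqint lborel (\<lambda>x. h n (u x))" for n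
    by (rule sqint_bound[OF _ sqint_integrable[OF su]]) (use lip[of n _ 0] h(2) in \<open>auto intro: power_mono simp: abs_le_square_iff[symmetric]\<close>)
  have iD: "sqint lborel (\<lambda>x. r *\<^sub>R indicator D x :: real)" for r
    by (rule sqint_scaleR[OF sqint_indicator_domain[OF D]])
  have e0: "0 \<le> e n" for n using g(3)[of n 0] by linarith
  have ptD: "norm (h n (u x) - g (u x)) \<le> norm (e n *\<^sub>R indicator D x :: real)" for n x
    using g(3)[of n "u x"] out[of x] h(2) g(2) e0[of n] by (cases "x \<in> D") auto
  have sd: "sqint lborel (\<lambda>x. h n (u x) - g (u x))" for n
  proof (rule sqint_bound[OF _ sqint_integrable[OF iD[of "e n"]]])
    show "(\<lambda>x. h n (u x) - g (u x)) \<in> borel_measurable lborel" by measurable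
    show "(norm (h n (u x) - g (u x)))\<^sup>2 \<le> (norm (e n *\<^sub>R indicator D x :: real))\<^sup>2" for x
      by (rule power_mono[OF ptD]) simp
  qed
  have sg: "sqint lborel (\<lambda>x. g (u x))" using sqint_diff[OF s1[of 0] sd[of 0]] by simp
  have t: "test_function D (\<lambda>x. h n (\<phi> n x))" for n by (rule test_function_compose[OF \<phi>(1) h(1,2)])
  show ?thesis
  proof (rule H10_leI[OF sg t])
    have "l2 lborel (\<lambda>x. h n (\<phi> n x) - g (u x)) \<le> l2 lborel (\<lambda>x. \<phi> n x - u x) + e n * l2 lborel (indicator D :: 'a \<Rightarrow> real)" for n
    proof -
      have "l2 lborel (\<lambda>x. h n (\<phi> n x) - g (u x)) \<le> l2 lborel (\<lambda>x. h n (\<phi> n x) - h n (u x)) + l2 lborel (\<lambda>x. h n (u x) - g (u x))"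
        by (rule l2_triangle_diff[OF test_function_sqint[OF t] s1 sg])
      also have "l2 lborel (\<lambda>x. h n (\<phi> n x) - h n (u x)) \<le> l2 lborel (\<lambda>x. \<phi> n x - u x)"
        by (intro l2_mono sqint_diff test_function_sqint[OF t] s1 s\<phi> su AE_I2) (simp add: lip)
      also have "l2 lborel (\<lambda>x. h n (u x) - g (u x)) \<le> l2 lborel (\<lambda>x. e n *\<^sub>R indicator D x :: real)"
        by (intro l2_mono sd iD AE_I2 ptD)
      also have "\<dots> = e n * l2 lborel (indicator D :: 'a \<Rightarrow> real)" using e0[of n] by (simp add: l2_scaleR del: real_scaleR_def)
      finally show ?thesis by simp
    qed
    moreover have "(\<lambda>n. l2 lborel (\<lambda>x. \<phi> n x - u x) + e n * l2 lborel (indicator D :: 'a \<Rightarrow> real)) \<longlonglongrightarrow> 0"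
      using tendsto_add[OF \<phi>(2) tendsto_mult_left_zero[OF g(4)]] by simp
    ultimately show "(\<lambda>n. l2 lborel (\<lambda>x. h n (\<phi> n x) - g (u x))) \<longlonglongrightarrow> 0"
      by (intro Lim_null_comparison[of "\<lambda>n. l2 lborel (\<lambda>x. h n (\<phi> n x) - g (u x))"]) auto
    show "dirichlet (\<lambda>x. h n (\<phi> n x)) \<le> c + 1 / real (Suc n)" for n
      using dirichlet_compose[OF h(1,3) t \<phi>(1), of n] \<phi>(3)[of n] by linarith
    show "(\<lambda>n. c + 1 / real (Suc n)) \<longlonglongrightarrow> c"
      using tendsto_add[OF tendsto_const LIMSEQ_Suc[OF lim_1_over_n], of c] by simp
  qed
qed

lemma smooth_spos_affine: "smooth (\<lambda>s. spos e (a * s + b))"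
  by (rule smooth_affine[OF bounded_linear_mult_right smooth_spos])

lemma frechet_derivative_spos_affine:
  "frechet_derivative (\<lambda>s. spos e (a * s + b)) (at s) 1 = a * frechet_derivative (spos e) (at (a * s + b)) 1"
proof -
  have d: "((\<lambda>s. a * s + b) has_derivative (\<lambda>h. a * h)) (at s)" by (auto intro!: derivative_eq_intros)
  have "frechet_derivative (\<lambda>s. spos e (a * s + b)) (at s) 1 = frechet_derivative (spos e) (at (a * s + b)) (a * 1)"
    by (rule frechet_derivative_eqI[OF has_derivative_compose[OF d smooth_has_derivative[OF smooth_spos]]])
  also have "\<dots> = frechet_derivative (spos e) (at (a * s + b)) 1 * (a * 1)"
    by (rule frechet_derivative_real[OF smooth_differentiable[OF smooth_spos]])
  finally show ?thesis by (simp add: mult.commute)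
qed

lemma H10_pos_truncate:
  fixes u :: "'a::euclidean_space \<Rightarrow> real"
  assumes D: "open D" "bounded D" and u: "H10_pos D u c" and M: "M \<ge> 0"
  shows "H10_pos D (\<lambda>x. min (u x) M) c"
proof -
  let ?e = "\<lambda>n. 1 / real (Suc n)"
  \<comment> \<open>This smooths min s M = M - max (M - s) 0. The leading constant is the smoothed
    value of M instead of M, so that the function vanishes at 0; this doubles the error.\<close>
  let ?h = "\<lambda>n s. spos (?e n) M - spos (?e n) ((-1) * s + M)"
  have e: "?e n > 0" for n by simp
  have "H10_le D (\<lambda>x. min (u x) M) c"
  proof (rule H10_le_compose[OF D H10_posD(1)[OF u] H10_posD(3)[OF u], where h = ?h and e = "\<lambda>n. 2 * ?e n"])
    show "smooth (?h n)" for n by (intro smooth_diff smooth_const smooth_spos_affine)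
    show "?h n 0 = 0" for n by simp
    show "\<bar>frechet_derivative (?h n) (at s) 1\<bar> \<le> 1" for n s
    proof -
      have "frechet_derivative (?h n) (at s) 1 = 0 - frechet_derivative (\<lambda>s. spos (?e n) ((-1) * s + M)) (at s) 1"
        by (rule frechet_derivative_eqI[OF has_derivative_diff[OF has_derivative_const smooth_has_derivative[OF smooth_spos_affine]]])
      then show ?thesis
        using spos_derivative_bounds[OF e[of n], of "(-1) * s + M"] by (simp only: frechet_derivative_spos_affine)
    qed
    show "\<bar>?h n s - min s M\<bar> \<le> 2 * ?e n" for n s
      using spos_bounds(2,3)[OF e[of n], of M] spos_bounds(2,3)[OF e[of n], of "(-1) * s + M"] M
      by (auto simp: abs_le_iff min_def max_def split: if_splits)
    show "(\<lambda>n. 2 * ?e n) \<longlonglongrightarrow> 0" using tendsto_mult_right_zero[OF LIMSEQ_Suc[OF lim_1_over_n], of 2] by simp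
  qed (use M in auto)
  then show ?thesis using H10_posD(2,3)[OF u] M by (auto simp: H10_pos_def)
qed

section \<open>Reflections and polarization\<close>

definition refl0 :: "'a::euclidean_space \<Rightarrow> 'a \<Rightarrow> 'a" where
  "refl0 n z = z - (2 * (z \<bullet> n)) *\<^sub>R n"

text \<open>For a unit vector n this is the reflection in the hyperplane z \<bullet> n = \<beta>,
  with \<open>refl0 n\<close> as its linear part.\<close>

definition reflect :: "'a::euclidean_space \<Rightarrow> real \<Rightarrow> 'a \<Rightarrow> 'a" where
  "reflect n \<beta> z = refl0 n z + (2 * \<beta>) *\<^sub>R n"

lemma bounded_linear_refl0: "bounded_linear (refl0 n)"
proof -
  have "bounded_linear (\<lambda>z. z - (2 * (z \<bullet> n)) *\<^sub>R n)"
    by (intro bounded_linear_sub bounded_linear_ident bounded_linear_scaleR_const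
        bounded_linear_const_mult bounded_linear_inner_left)
  then show ?thesis by (simp add: refl0_def[abs_def])
qed

lemma refl0_add: "refl0 n (x + y) = refl0 n x + refl0 n y"
  by (simp add: linear_add bounded_linear.linear[OF bounded_linear_refl0])

lemma refl0_invol: "norm n = 1 \<Longrightarrow> refl0 n (refl0 n z) = z"
  by (simp add: refl0_def inner_diff_left algebra_simps power2_norm_eq_inner[symmetric] flip: scaleR_scaleR)

lemma refl0_inner: "norm n = 1 \<Longrightarrow> refl0 n x \<bullet> refl0 n y = x \<bullet> y"
  by (simp add: refl0_def inner_diff_left inner_diff_right algebra_simps inner_commute power2_norm_eq_inner[symmetric])

lemma refl0_self_adjoint: "refl0 n x \<bullet> y = x \<bullet> refl0 n y"
  by (simp add: refl0_def inner_diff_left inner_diff_right inner_commute)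

lemma norm_refl0: "norm n = 1 \<Longrightarrow> norm (refl0 n z) = norm z"
  by (simp add: norm_eq_sqrt_inner refl0_inner)

lemma reflect_inner: "norm n = 1 \<Longrightarrow> reflect n \<beta> z \<bullet> n = 2 * \<beta> - z \<bullet> n"
  by (simp add: reflect_def refl0_def inner_diff_left inner_add_left power2_norm_eq_inner[symmetric])

lemma reflect_invol: "norm n = 1 \<Longrightarrow> reflect n \<beta> (reflect n \<beta> z) = z"
proof -
  assume n: "norm n = 1"
  have "refl0 n n = - n" using n by (simp add: refl0_def power2_norm_eq_inner[symmetric] scaleR_2)
  then have "refl0 n ((2 * \<beta>) *\<^sub>R n) = - ((2 * \<beta>) *\<^sub>R n)"
    by (simp add: linear_cmul bounded_linear.linear[OF bounded_linear_refl0])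
  then show ?thesis unfolding reflect_def by (simp only: refl0_add refl0_invol[OF n]) simp
qed

text \<open>For \<beta> > 0 the sign of \<beta> - z \<bullet> n decides: points on the side of the
  origin move away from the origin, points beyond the hyperplane move towards it.\<close>

lemma reflect_norm_sq:
  assumes "norm n = 1" shows "(norm (reflect n \<beta> z))\<^sup>2 = (norm z)\<^sup>2 + 4 * \<beta> * (\<beta> - z \<bullet> n)"
proof -
  have nn: "n \<bullet> n = 1" using assms by (simp add: power2_norm_eq_inner[symmetric])
  show ?thesis
    unfolding power2_norm_eq_inner reflect_def refl0_def
    by (simp add: inner_diff_left inner_diff_right inner_add_left inner_add_right nn inner_commute algebra_simps)
qed

lemma continuous_on_reflect: "continuous_on UNIV (reflect n \<beta>)"
  unfolding reflect_def[abs_def] by (intro continuous_intros linear_continuous_on bounded_linear_refl0)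

text \<open>A translation invariant measure is determined up to a factor by its value on one ball. The
  computation below is the usual Fubini argument for this, applied to the image of \<open>lborel\<close>.\<close>

lemma nn_integral_refl0:
  fixes f :: "'a::euclidean_space \<Rightarrow> ennreal"
  assumes f [measurable]: "f \<in> borel_measurable borel" and n: "norm n = 1"
  shows "(\<integral>\<^sup>+x. f (refl0 n x) \<partial>lborel) = (\<integral>\<^sup>+x. f x \<partial>lborel)"
proof -
  let ?A = "refl0 n"
  define g :: "'a \<Rightarrow> ennreal" where "g = indicator (ball 0 1)"
  have [measurable]: "?A \<in> borel_measurable borel"
    by (rule borel_measurable_continuous_onI[OF linear_continuous_on[OF bounded_linear_refl0]])
  have [measurable]: "g \<in> borel_measurable borel" unfolding g_def by (rule borel_measurable_indicator) simp
  have shift: "(\<integral>\<^sup>+x. h (x + z) \<partial>lborel) = (\<integral>\<^sup>+x. h x \<partial>lborel)" if [measurable]: "h \<in> borel_measurable borel" for h :: "'a \<Rightarrow> ennreal" and z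
  proof -
    have "(\<integral>\<^sup>+x. h x \<partial>lborel) = (\<integral>\<^sup>+x. h x \<partial>distr lborel borel ((+) z))" by (simp add: lborel_distr_plus)
    also have "\<dots> = (\<integral>\<^sup>+x. h (z + x) \<partial>lborel)" by (rule nn_integral_distr) auto
    finally show ?thesis by (simp add: add.commute)
  qed
  have G: "(\<integral>\<^sup>+x. g x \<partial>lborel) = emeasure lborel (ball (0::'a) 1)" by (simp add: g_def)
  have Fub: "(\<integral>\<^sup>+x. \<integral>\<^sup>+y. H x y \<partial>lborel \<partial>lborel) = (\<integral>\<^sup>+y. \<integral>\<^sup>+x. H x y \<partial>lborel \<partial>lborel)"
    if "case_prod H \<in> borel_measurable (borel \<Otimes>\<^sub>M borel)" for H :: "'a \<Rightarrow> 'a \<Rightarrow> ennreal"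
    using that measurable_cong_sets[OF sets_pair_measure_cong[OF sets_lborel sets_lborel] refl]
    by (intro lborel_pair.Fubini'[symmetric]) auto
  have "(\<integral>\<^sup>+x. f (?A x) \<partial>lborel) * (\<integral>\<^sup>+x. g x \<partial>lborel) = (\<integral>\<^sup>+x. \<integral>\<^sup>+y. f (?A x) * g (y - ?A x) \<partial>lborel \<partial>lborel)"
  proof -
    have "(\<integral>\<^sup>+y. f (?A x) * g (y - ?A x) \<partial>lborel) = f (?A x) * (\<integral>\<^sup>+y. g y \<partial>lborel)" for x
      using shift[of g "- ?A x"] by (subst nn_integral_cmult) auto
    then show ?thesis by (simp add: nn_integral_multc)
  qed
  also have "\<dots> = (\<integral>\<^sup>+y. \<integral>\<^sup>+x. f (?A x) * g (y - ?A x) \<partial>lborel \<partial>lborel)"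
    by (rule Fub) measurable
  also have "\<dots> = (\<integral>\<^sup>+y. \<integral>\<^sup>+x. f (?A x + y) * g (- ?A x) \<partial>lborel \<partial>lborel)"
  proof (rule nn_integral_cong)
    fix y
    have "(\<integral>\<^sup>+x. f (?A x) * g (y - ?A x) \<partial>lborel) = (\<integral>\<^sup>+x. f (?A (x + ?A y)) * g (y - ?A (x + ?A y)) \<partial>lborel)"
      \<comment> \<open>Shifting x by A y frees g of y, since A is a linear involution and so A (x +
        A y) = A x + y.\<close>
      by (rule shift[symmetric]) measurable
    then show "(\<integral>\<^sup>+x. f (?A x) * g (y - ?A x) \<partial>lborel) = (\<integral>\<^sup>+x. f (?A x + y) * g (- ?A x) \<partial>lborel)"
      by (simp add: refl0_add refl0_invol[OF n])
  qed
  also have "\<dots> = (\<integral>\<^sup>+x. \<integral>\<^sup>+y. f (?A x + y) * g (- ?A x) \<partial>lborel \<partial>lborel)"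
    by (rule Fub) measurable
  also have "\<dots> = (\<integral>\<^sup>+x. (\<integral>\<^sup>+y. f y \<partial>lborel) * g x \<partial>lborel)"
  proof (rule nn_integral_cong)
    fix x
    have "g (- ?A x) = g x" by (simp add: g_def indicator_def norm_refl0[OF n])
    then show "(\<integral>\<^sup>+y. f (?A x + y) * g (- ?A x) \<partial>lborel) = (\<integral>\<^sup>+y. f y \<partial>lborel) * g x"
      using shift[of f "?A x"] by (simp add: nn_integral_multc add.commute)
  qed
  also have "\<dots> = (\<integral>\<^sup>+y. f y \<partial>lborel) * (\<integral>\<^sup>+x. g x \<partial>lborel)"
    by (rule nn_integral_cmult) simp
  finally have eq: "(\<integral>\<^sup>+x. f (?A x) \<partial>lborel) * emeasure lborel (ball (0::'a) 1) = (\<integral>\<^sup>+y. f y \<partial>lborel) * emeasure lborel (ball (0::'a) 1)"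
    unfolding G .
  have top: "emeasure lborel (ball (0::'a) 1) \<noteq> top"
    using emeasure_lborel_ball_finite[of "0::'a" 1] by (simp add: less_top)
  have "measure lborel (ball (0::'a) 1) > 0" by (rule content_ball_pos) simp
  then have "emeasure lborel (ball (0::'a) 1) \<noteq> 0" by (auto simp: measure_def)
  then show ?thesis using mult_divide_eq_ennreal[OF _ top] eq by metis
qed

lemma lborel_distr_refl0:
  assumes n: "norm (n::'a::euclidean_space) = 1" shows "distr lborel borel (refl0 n) = lborel"
proof (rule measure_eqI)
  have m [measurable]: "refl0 n \<in> borel_measurable borel"
    by (rule borel_measurable_continuous_onI[OF linear_continuous_on[OF bounded_linear_refl0]])
  fix A assume "A \<in> sets (distr lborel borel (refl0 n))"
  then have [measurable]: "A \<in> sets borel" by simp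
  have "emeasure (distr lborel borel (refl0 n)) A = (\<integral>\<^sup>+x. indicator A x \<partial>distr lborel borel (refl0 n))" by simp
  also have "\<dots> = (\<integral>\<^sup>+x. indicator A (refl0 n x) \<partial>lborel)" by (rule nn_integral_distr) simp_all
  also have "\<dots> = emeasure lborel A" by (subst nn_integral_refl0[OF _ n]) auto
  finally show "emeasure (distr lborel borel (refl0 n)) A = emeasure lborel A" .
qed simp

lemma lborel_distr_reflect:
  assumes n: "norm (n::'a::euclidean_space) = 1" shows "distr lborel borel (reflect n \<beta>) = lborel"
proof -
  have m [measurable]: "refl0 n \<in> borel_measurable borel"
    by (rule borel_measurable_continuous_onI[OF linear_continuous_on[OF bounded_linear_refl0]])
  have "distr lborel borel (reflect n \<beta>) = distr (distr lborel borel (refl0 n)) borel ((+) ((2 * \<beta>) *\<^sub>R n))"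
    by (subst distr_distr) (auto simp: reflect_def[abs_def] o_def add.commute)
  then show ?thesis by (simp add: lborel_distr_refl0[OF n] lborel_distr_plus)
qed

section \<open>Reflection invariance of integrals and Dirichlet integrals\<close>

lemma borel_measurable_reflect [measurable]: "reflect n \<beta> \<in> borel_measurable borel"
  by (rule borel_measurable_continuous_onI[OF continuous_on_reflect])

lemma integral_reflect:
  fixes f :: "'a::euclidean_space \<Rightarrow> real"
  assumes n: "norm n = 1" and f: "f \<in> borel_measurable borel"
  shows "(\<integral>x. f (reflect n \<beta> x) \<partial>lborel) = (\<integral>x. f x \<partial>lborel)"
    and "integrable lborel (\<lambda>x. f (reflect n \<beta> x)) \<longleftrightarrow> integrable lborel f"
  using integral_distr[of "reflect n \<beta>" lborel borel f] integrable_distr_eq[of "reflect n \<beta>" lborel borel f] f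
  by (simp_all add: lborel_distr_reflect[OF n])

lemma sqint_reflect:
  fixes f :: "'a::euclidean_space \<Rightarrow> real"
  assumes n: "norm n = 1" and f: "sqint lborel f"
  shows "sqint lborel (\<lambda>x. f (reflect n \<beta> x))" "l2 lborel (\<lambda>x. f (reflect n \<beta> x)) = l2 lborel f"
proof -
  note [measurable] = sqint_borel[OF f]
  have m: "(\<lambda>x. (norm (f x))\<^sup>2) \<in> borel_measurable borel" by simp
  show "sqint lborel (\<lambda>x. f (reflect n \<beta> x))"
    using integral_reflect(2)[OF n m, of \<beta>] sqint_integrable[OF f] by (simp add: sqint_def)
  show "l2 lborel (\<lambda>x. f (reflect n \<beta> x)) = l2 lborel f"
    using integral_reflect(1)[OF n m, of \<beta>] by (simp add: l2_def)
qed

text \<open>A linear functional is the inner product with some g, and either sum is the squared norm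
  of g, respectively of its mirror image.\<close>

lemma sum_Basis_linear_refl0:
  fixes f :: "'a::euclidean_space \<Rightarrow> real"
  assumes lin: "linear f" and n: "norm n = 1"
  shows "(\<Sum>b\<in>Basis. (f (refl0 n b))\<^sup>2) = (\<Sum>b\<in>Basis. (f b)\<^sup>2)"
proof -
  define g where "g = (\<Sum>b\<in>Basis. f b *\<^sub>R b)"
  have f: "f v = g \<bullet> v" for v
  proof -
    have "f v = f (\<Sum>b\<in>Basis. (v \<bullet> b) *\<^sub>R b)" by (simp add: euclidean_representation)
    also have "\<dots> = (\<Sum>b\<in>Basis. (v \<bullet> b) * f b)" by (simp add: linear_sum[OF lin] linear_cmul[OF lin])
    also have "\<dots> = g \<bullet> v"
      unfolding g_def inner_sum_left by (simp add: inner_commute[of v] mult.commute)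
    finally show ?thesis .
  qed
  have s: "(\<Sum>b\<in>Basis. (w \<bullet> b)\<^sup>2) = w \<bullet> w" for w :: 'a
    by (simp add: euclidean_inner[of w w] power2_eq_square)
  have "(\<Sum>b\<in>Basis. (f (refl0 n b))\<^sup>2) = (\<Sum>b\<in>Basis. (refl0 n g \<bullet> b)\<^sup>2)" by (simp add: f refl0_self_adjoint)
  also have "\<dots> = (\<Sum>b\<in>Basis. (f b)\<^sup>2)" by (simp add: s f refl0_inner[OF n])
  finally show ?thesis .
qed

lemma test_function_reflect:
  fixes f :: "'a::euclidean_space \<Rightarrow> real"
  assumes f: "test_function UNIV f" and n: "norm n = 1"
  shows "test_function UNIV (\<lambda>x. f (reflect n \<beta> x))" "dirichlet (\<lambda>x. f (reflect n \<beta> x)) = dirichlet f"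
proof -
  let ?s = "reflect n \<beta>"
  obtain K where K: "compact K" "K \<subseteq> UNIV" "\<And>x. x \<notin> K \<Longrightarrow> f x = 0"
    by (rule test_function_support[OF f]) (rule that)
  show t: "test_function UNIV (\<lambda>x. f (?s x))"
  proof (rule test_functionI)
    show "smooth (\<lambda>x. f (?s x))"
      unfolding reflect_def by (rule smooth_affine[OF bounded_linear_refl0 test_function_smooth[OF f]])
    show "compact (?s ` K)" using K(1) continuous_on_reflect by (meson compact_continuous_image continuous_on_subset subset_UNIV)
    show "f (?s x) = 0" if "x \<notin> ?s ` K" for x
      using that K(3)[of "?s x"] reflect_invol[OF n, of \<beta> x] by (metis image_eqI)
  qed simp
  have d: "frechet_derivative (\<lambda>x. f (?s x)) (at x) b = frechet_derivative f (at (?s x)) (refl0 n b)" for x b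
  proof (rule frechet_derivative_eqI[OF has_derivative_compose[OF _ test_function_has_derivative[OF f]]])
    show "(?s has_derivative refl0 n) (at x)"
      unfolding reflect_def[abs_def]
      using has_derivative_add_const[OF bounded_linear_imp_has_derivative[OF bounded_linear_refl0]] by blast
  qed
  have "dirichlet (\<lambda>x. f (?s x)) = (\<integral>x. (\<Sum>b\<in>Basis. (norm (frechet_derivative f (at (?s x)) b))\<^sup>2) \<partial>lborel)"
    unfolding dirichlet_def d
    using sum_Basis_linear_refl0[OF linear_frechet_derivative[OF smooth_differentiable[OF test_function_smooth[OF f]]] n]
    by simp
  also have "\<dots> = dirichlet f"
    unfolding dirichlet_def
  proof (rule integral_reflect(1)[OF n])
    have "Cc (\<lambda>x. \<Sum>b\<in>Basis. (norm (frechet_derivative f (at x) b))\<^sup>2)"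
      using f by (intro Cc_sum Cc_norm_power test_function_Cc[OF test_function_derivative]) auto
    then show "(\<lambda>x. \<Sum>b\<in>Basis. (norm (frechet_derivative f (at x) b))\<^sup>2) \<in> borel_measurable borel" by (rule Cc_borel)
  qed
  finally show "dirichlet (\<lambda>x. f (?s x)) = dirichlet f" .
qed

section \<open>Polarization of test functions and of the relaxed class\<close>

definition polarize :: "'a::euclidean_space \<Rightarrow> real \<Rightarrow> ('a \<Rightarrow> real) \<Rightarrow> 'a \<Rightarrow> real" where
  "polarize n \<beta> u x = (if x \<bullet> n < \<beta> then max (u x) (u (reflect n \<beta> x)) else min (u x) (u (reflect n \<beta> x)))"

definition sabs :: "real \<Rightarrow> real \<Rightarrow> real" where
  "sabs e s = spos e (1 * s + (- e)) + spos e ((-1) * s + (- e))"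

lemma smooth_sabs: "smooth (sabs e)"
  unfolding sabs_def[abs_def] by (intro smooth_add smooth_spos_affine)

lemma sabs_props:
  assumes e: "e > 0"
  shows "\<bar>s\<bar> \<le> e \<Longrightarrow> sabs e s = 0" "\<bar>sabs e s - \<bar>s\<bar>\<bar> \<le> 2 * e" "sabs e (- s) = sabs e s"
    "\<bar>frechet_derivative (sabs e) (at s) 1\<bar> \<le> 1"
proof -
  show "\<bar>s\<bar> \<le> e \<Longrightarrow> sabs e s = 0" using e by (simp add: sabs_def abs_le_iff)
  show "sabs e (- s) = sabs e s" by (simp add: sabs_def)
  show "\<bar>sabs e s - \<bar>s\<bar>\<bar> \<le> 2 * e"
    using spos_bounds[OF e, of "s - e"] spos_bounds[OF e, of "- s - e"] e
    by (auto simp: sabs_def max_def abs_le_iff abs_if split: if_splits)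
  have "frechet_derivative (sabs e) (at s) 1 = frechet_derivative (\<lambda>s. spos e (1 * s + (- e))) (at s) 1
      + frechet_derivative (\<lambda>s. spos e ((-1) * s + (- e))) (at s) 1"
    unfolding sabs_def[abs_def]
    by (rule frechet_derivative_eqI[OF has_derivative_add[OF smooth_has_derivative[OF smooth_spos_affine] smooth_has_derivative[OF smooth_spos_affine]]])
  then have "frechet_derivative (sabs e) (at s) 1 = frechet_derivative (spos e) (at (1 * s + (- e))) 1
      - frechet_derivative (spos e) (at ((-1) * s + (- e))) 1"
    by (simp only: frechet_derivative_spos_affine)
  then show "\<bar>frechet_derivative (sabs e) (at s) 1\<bar> \<le> 1"
    using spos_derivative_bounds[OF e, of "1 * s + (- e)"] spos_derivative_bounds[OF e, of "(-1) * s + (- e)"] by linarith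
qed

text \<open>The polarization of \<open>f\<close> is \<open>(f + f\<sigma>)/2 \<plusminus> |f - f\<sigma>|/2\<close>. Replacing \<open>|\<cdot>|\<close> by \<^const>\<open>sabs\<close>, which vanishes
  near \<open>0\<close>, makes it smooth across the hyperplane; the Dirichlet integrals of \<open>f\<close> and of the result both split, by the
  parallelogram identity, into those of their even and odd parts under \<open>\<sigma>\<close>.\<close>

lemma smooth_polarization:
  fixes f :: "'a::euclidean_space \<Rightarrow> real"
  assumes f: "test_function UNIV f" and n: "norm n = 1" and e: "e > 0"
  obtains p where "test_function UNIV p" "dirichlet p \<le> dirichlet f" "\<And>x. \<bar>p x - polarize n \<beta> f x\<bar> \<le> e"
proof -
  let ?s = "reflect n \<beta>"
  define w where "w x = f x - f (?s x)" for x
  define sg where "sg x = (if x \<bullet> n < \<beta> then 1 else - 1 :: real)" for x :: 'a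
  define q where "q x = sg x * sabs e (w x)" for x
  define p where "p x = (1/2) *\<^sub>R (f x + f (?s x)) + (1/2) *\<^sub>R q x" for x
  note tfs = test_function_reflect[OF f n, of \<beta>]
  have tw: "test_function UNIV w" unfolding w_def[abs_def] by (rule test_function_diff[OF f tfs(1)])
  have tsw: "test_function UNIV (\<lambda>x. sabs e (w x))"
    by (rule test_function_compose[OF tw smooth_sabs]) (use sabs_props(1)[OF e, of 0] e in simp)
  have ws: "w (?s x) = - w x" for x by (simp add: w_def reflect_invol[OF n])
  have local: "(\<forall>\<^sub>F y in nhds x. q y = sabs e (w y)) \<or> (\<forall>\<^sub>F y in nhds x. q y = - sabs e (w y))" for x
  proof -
    consider "x \<bullet> n < \<beta>" | "x \<bullet> n > \<beta>" | "x \<bullet> n = \<beta>" by linarith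
    then show ?thesis
    proof cases
      case 1
      have "open {y. y \<bullet> n < \<beta>}" by (intro open_Collect_less continuous_intros)
      then have "\<forall>\<^sub>F y in nhds x. y \<bullet> n < \<beta>" using eventually_nhds_in_open[of "{y. y \<bullet> n < \<beta>}" x] 1 by simp
      then show ?thesis by (intro disjI1) (auto elim!: eventually_mono simp: q_def sg_def)
    next
      case 2
      have "open {y. \<beta> < y \<bullet> n}" by (intro open_Collect_less continuous_intros)
      then have "\<forall>\<^sub>F y in nhds x. \<beta> < y \<bullet> n" using eventually_nhds_in_open[of "{y. \<beta> < y \<bullet> n}" x] 2 by simp
      then show ?thesis by (intro disjI2) (auto elim!: eventually_mono simp: q_def sg_def)
    next
      \<comment> \<open>On the hyperplane w vanishes, so |w| < e nearby and
        \<open>sabs e (w y)\<close> is 0 there; the jump of \<open>sg\<close> has no effect.\<close>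
      case 3
      have "?s x = x" using 3 by (simp add: reflect_def refl0_def)
      then have "w x = 0" by (simp add: w_def)
      moreover have "open {y. \<bar>w y\<bar> < e}"
        by (intro open_Collect_less continuous_intros smooth_continuous[OF test_function_smooth[OF tw]])
      ultimately have "\<forall>\<^sub>F y in nhds x. \<bar>w y\<bar> < e" using eventually_nhds_in_open[of "{y. \<bar>w y\<bar> < e}" x] e by simp
      then show ?thesis by (intro disjI1) (auto elim!: eventually_mono simp: q_def sabs_props(1)[OF e])
    qed
  qed
  have tq: "test_function UNIV q"
  proof -
    obtain K where K: "compact K" "K \<subseteq> UNIV" "\<And>x. x \<notin> K \<Longrightarrow> sabs e (w x) = 0"
      by (rule test_function_support[OF tsw]) (rule that)
    show ?thesis
      by (rule test_functionI[OF smooth_local_sign[OF test_function_smooth[OF tsw] local] K(1,2)]) (simp add: q_def K(3))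
  qed
  have dq: "dirichlet q \<le> dirichlet w"
  proof -
    have "dirichlet q \<le> dirichlet (\<lambda>x. sabs e (w x))"
    proof (rule dirichlet_mono[OF tq tsw])
      fix x b
      note D = test_function_has_derivative[OF tsw, of x]
      show "\<bar>frechet_derivative q (at x) b\<bar> \<le> \<bar>frechet_derivative (\<lambda>x. sabs e (w x)) (at x) b\<bar>"
        using local[of x]
      proof
        assume ev: "\<forall>\<^sub>F y in nhds x. q y = sabs e (w y)"
        have "(q has_derivative frechet_derivative (\<lambda>x. sabs e (w x)) (at x)) (at x)"
          using ev eventually_nhds_x_imp_x[OF ev]
          by (intro has_derivative_transform_eventually[OF D]) (auto simp: eventually_at_filter elim: eventually_mono)
        then show ?thesis by (simp add: frechet_derivative_eqI)
      next
        assume ev: "\<forall>\<^sub>F y in nhds x. q y = - sabs e (w y)"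
        have "(q has_derivative (\<lambda>v. - frechet_derivative (\<lambda>x. sabs e (w x)) (at x) v)) (at x)"
          using ev eventually_nhds_x_imp_x[OF ev]
          by (intro has_derivative_transform_eventually[OF has_derivative_minus[OF D]]) (auto simp: eventually_at_filter elim: eventually_mono)
        then show ?thesis by (simp add: frechet_derivative_eqI)
      qed
    qed
    also have "\<dots> \<le> dirichlet w" by (rule dirichlet_compose[OF smooth_sabs sabs_props(4)[OF e] tsw tw])
    finally show ?thesis .
  qed
  have tp: "test_function UNIV p"
    unfolding p_def[abs_def] by (intro test_function_add test_function_scaleR f tfs tq)
  have sgs: "q (?s x) = - q x" for x
  proof (cases "x \<bullet> n = \<beta>")
    case True
    then have "?s x = x" by (simp add: reflect_def refl0_def)
    moreover from this have "q x = 0" using sabs_props(1)[OF e, of 0] e by (simp add: q_def w_def)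
    ultimately show ?thesis by simp
  next
    case False
    then show ?thesis by (auto simp: q_def sg_def ws sabs_props(3)[OF e] reflect_inner[OF n])
  qed
  have "dirichlet (\<lambda>x. p x - p (?s x)) = 2 * dirichlet p + 2 * dirichlet (\<lambda>x. p (?s x)) - 4 * dirichlet (\<lambda>x. (1/2) *\<^sub>R (p x + p (?s x)))"
    by (rule dirichlet_parallelogram[OF tp test_function_reflect(1)[OF tp n]])
  moreover have "(\<lambda>x. p x - p (?s x)) = q" "(\<lambda>x. (1/2) *\<^sub>R (p x + p (?s x))) = (\<lambda>x. (1/2) *\<^sub>R (f x + f (?s x)))"
    by (auto simp: p_def sgs reflect_invol[OF n] field_simps)
  ultimately have "4 * dirichlet p = dirichlet q + 4 * dirichlet (\<lambda>x. (1/2) *\<^sub>R (f x + f (?s x)))"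
    using test_function_reflect(2)[OF tp n, of \<beta>] by simp
  moreover have "dirichlet w = 4 * dirichlet f - 4 * dirichlet (\<lambda>x. (1/2) *\<^sub>R (f x + f (?s x)))"
    using dirichlet_parallelogram[OF f tfs(1)] tfs(2) by (simp add: w_def[abs_def])
  ultimately have "dirichlet p \<le> dirichlet f" using dq by simp
  moreover have "\<bar>p x - polarize n \<beta> f x\<bar> \<le> e" for x
    using sabs_props(2)[OF e, of "w x"]
    by (auto simp: p_def q_def sg_def polarize_def w_def max_def min_def abs_le_iff abs_if field_simps split: if_splits)
  ultimately show thesis using tp by (intro that)
qed

lemma polarize_diff: "\<bar>polarize n \<beta> u x - polarize n \<beta> v x\<bar> \<le> \<bar>u x - v x\<bar> + \<bar>u (reflect n \<beta> x) - v (reflect n \<beta> x)\<bar>"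
  by (auto simp: polarize_def max_def min_def)

lemma borel_measurable_polarize [measurable]:
  assumes [measurable]: "u \<in> borel_measurable borel" shows "polarize n \<beta> u \<in> borel_measurable borel"
  unfolding polarize_def[abs_def] by measurable

text \<open>The polarized function still vanishes off the ball. For x outside the ball with x
  \<bullet> n < \<beta>, the mirror image is farther out because \<beta> > 0, so the maximum is over
  two zeros; beyond the hyperplane the minimum of 0 and a nonnegative value is taken.\<close>

lemma H10_pos_polarize:
  fixes u :: "'a::euclidean_space \<Rightarrow> real"
  assumes u: "H10_pos (ball 0 R) u c" and n: "norm n = 1" and \<beta>: "\<beta> > 0"
  shows "H10_pos (ball 0 R) (polarize n \<beta> u) c"
proof -
  let ?s = "reflect n \<beta>" and ?B = "ball (0::'a) R" and ?e = "\<lambda>k. 1 / real (Suc k)"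
  note su = H10_posD(4)[OF u]
  note [measurable] = H10_posD(5)[OF u]
  obtain \<phi> :: "nat \<Rightarrow> 'a \<Rightarrow> real" where \<phi>: "\<And>k. test_function ?B (\<phi> k)"
    "(\<lambda>k. l2 lborel (\<lambda>x. \<phi> k x - u x)) \<longlonglongrightarrow> 0" "\<And>k. dirichlet (\<phi> k) < c + ?e k"
    by (rule H10_le_sequence[OF H10_posD(1)[OF u]]) (rule that)
  have tU: "test_function UNIV (\<phi> k)" for k by (rule test_function_mono[OF \<phi>(1)]) simp
  have ek: "?e k > 0" for k by simp
  have "\<exists>p. test_function UNIV p \<and> dirichlet p \<le> dirichlet (\<phi> k) \<and> (\<forall>x. \<bar>p x - polarize n \<beta> (\<phi> k) x\<bar> \<le> ?e k)" for k
    by (rule smooth_polarization[OF tU[of k] n ek[of k], of \<beta>]) blast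
  then obtain p where p: "\<And>k. test_function UNIV (p k)" "\<And>k. dirichlet (p k) \<le> dirichlet (\<phi> k)"
    "\<And>k x. \<bar>p k x - polarize n \<beta> (\<phi> k) x\<bar> \<le> ?e k" by metis
  \<comment> \<open>The smoothed polarization need not be supported in the ball. It is, however,
    within 1/(k+1) of a function that is at most 0 outside K and the part of its mirror image with x
    \<bullet> n \<le> \<beta>, a compact subset of the ball. Subtracting 1/(k+1) and applying
    \<open>spos\<close> removes the rest.\<close>
  let ?\<psi> = "\<lambda>k x. spos (?e k) (1 * p k x + (- ?e k))"
  have h0: "spos (?e k) (1 * 0 + (- ?e k)) = 0" for k by simp
  have farther: "norm x \<le> norm (?s x)" if "x \<bullet> n \<le> \<beta>" for x
    by (rule power2_le_imp_le) (use that \<beta> in \<open>auto simp: reflect_norm_sq[OF n]\<close>)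
  have closer: "norm (?s x) \<le> norm x" if "x \<bullet> n \<ge> \<beta>" for x
    by (rule power2_le_imp_le) (use that \<beta> in \<open>auto simp: reflect_norm_sq[OF n] mult_nonneg_nonpos\<close>)
  have t\<psi>: "test_function ?B (?\<psi> k)" for k
  proof -
    obtain K where K: "compact K" "K \<subseteq> ?B" "\<And>x. x \<notin> K \<Longrightarrow> \<phi> k x = 0"
      by (rule test_function_support[OF \<phi>(1)]) (rule that)
    have cs: "compact (?s ` K)" using K(1) continuous_on_reflect by (meson compact_continuous_image continuous_on_subset subset_UNIV)
    have ch: "closed {x. x \<bullet> n \<le> \<beta>}" by (intro closed_Collect_le continuous_intros)
    show ?thesis
    proof (rule test_functionI)
      show "smooth (?\<psi> k)" by (rule smooth_compose[OF smooth_spos_affine test_function_smooth[OF p(1)]])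
      show "compact (K \<union> (?s ` K \<inter> {x. x \<bullet> n \<le> \<beta>}))" using K(1) cs ch by (intro compact_Un compact_Int_closed)
      show "K \<union> (?s ` K \<inter> {x. x \<bullet> n \<le> \<beta>}) \<subseteq> ?B"
      proof
        fix x assume "x \<in> K \<union> (?s ` K \<inter> {x. x \<bullet> n \<le> \<beta>})"
        then consider "x \<in> K" | y where "y \<in> K" "x = ?s y" "x \<bullet> n \<le> \<beta>" by auto
        then show "x \<in> ?B"
        proof cases
          case 2
          then have "?s x = y" by (simp add: reflect_invol[OF n])
          then have "norm x \<le> norm y" using farther[OF 2(3)] by simp
          then show ?thesis using 2(1) K(2) by auto
        qed (use K(2) in auto)
      qed
      fix x assume x: "x \<notin> K \<union> (?s ` K \<inter> {x. x \<bullet> n \<le> \<beta>})"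
      have "polarize n \<beta> (\<phi> k) x \<le> 0"
      proof (cases "x \<bullet> n < \<beta>")
        case True
        then have "x \<notin> ?s ` K" using x by auto
        then have "?s x \<notin> K" using reflect_invol[OF n, of \<beta> x] by (metis image_eqI)
        then show ?thesis using x K(3) True by (simp add: polarize_def)
      next
        case False
        then show ?thesis using x K(3) by (simp add: polarize_def)
      qed
      then have "p k x \<le> ?e k" using p(3)[of k x] by linarith
      then show "?\<psi> k x = 0" by (intro spos_nonpos) auto
    qed
  qed
  have pu0: "0 \<le> polarize n \<beta> u x" for x using H10_posD(2)[OF u] by (auto simp: polarize_def le_max_iff_disj)
  have pout: "polarize n \<beta> v x = 0" if v: "\<And>x. x \<notin> ?B \<Longrightarrow> v x = 0" and x: "x \<notin> ?B" "0 \<le> polarize n \<beta> v x" for v x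
  proof (cases "x \<bullet> n < \<beta>")
    case True
    then have "?s x \<notin> ?B" using farther[of x] x(1) by auto
    then show ?thesis using v x(1) True by (simp add: polarize_def)
  next
    case False
    then show ?thesis using v[OF x(1)] x(2) by (simp add: polarize_def)
  qed
  have pu_out: "polarize n \<beta> u x = 0" if "x \<notin> ?B" for x by (rule pout[OF H10_posD(3)[OF u] that pu0])
  have sdu: "sqint lborel (\<lambda>x. \<bar>\<phi> k x - u x\<bar> + \<bar>\<phi> k (?s x) - u (?s x)\<bar>)"
    "l2 lborel (\<lambda>x. \<bar>\<phi> k x - u x\<bar> + \<bar>\<phi> k (?s x) - u (?s x)\<bar>) \<le> 2 * l2 lborel (\<lambda>x. \<phi> k x - u x)" for k
  proof -
    have s0: "sqint lborel (\<lambda>x. \<phi> k x - u x)" by (intro sqint_diff test_function_sqint[OF \<phi>(1)] su)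
    note [measurable] = sqint_borel[OF s0]
    have s1: "sqint lborel (\<lambda>x. \<bar>\<phi> k x - u x\<bar>)" by (rule sqint_bound[OF _ sqint_integrable[OF s0]]) auto
    note s2 = sqint_reflect[OF n s1, of \<beta>]
    show "sqint lborel (\<lambda>x. \<bar>\<phi> k x - u x\<bar> + \<bar>\<phi> k (?s x) - u (?s x)\<bar>)" by (rule sqint_add[OF s1 s2(1)])
    have "l2 lborel (\<lambda>x. \<bar>\<phi> k x - u x\<bar>) = l2 lborel (\<lambda>x. \<phi> k x - u x)" by (simp add: l2_def)
    then show "l2 lborel (\<lambda>x. \<bar>\<phi> k x - u x\<bar> + \<bar>\<phi> k (?s x) - u (?s x)\<bar>) \<le> 2 * l2 lborel (\<lambda>x. \<phi> k x - u x)"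
      using l2_triangle[OF s1 s2(1)] s2(2) by simp
  qed
  have spu: "sqint lborel (polarize n \<beta> u)"
  proof -
    have s: "sqint lborel (\<lambda>x. u x + u (?s x))" by (rule sqint_add[OF su sqint_reflect(1)[OF n su]])
    show ?thesis
    proof (rule sqint_bound[OF _ sqint_integrable[OF s]])
      fix x
      have "polarize n \<beta> u x \<le> u x + u (?s x)"
        using H10_posD(2)[OF u, of x] H10_posD(2)[OF u, of "?s x"] by (auto simp: polarize_def max_def min_def)
      then show "(norm (polarize n \<beta> u x))\<^sup>2 \<le> (norm (u x + u (?s x)))\<^sup>2"
        using pu0[of x] by (intro power_mono) auto
    qed simp
  qed
  have iB: "sqint lborel (\<lambda>x. r *\<^sub>R indicator ?B x :: real)" for r
    by (intro sqint_scaleR sqint_indicator_domain) auto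
  \<comment> \<open>The factor 3 counts the error of p, the subtracted constant and the error of
    \<open>spos\<close>. The factor 2 comes from comparing \<phi> with u both at x and at its mirror
    image.\<close>
  have close: "l2 lborel (\<lambda>x. ?\<psi> k x - polarize n \<beta> u x)
      \<le> 3 * ?e k * l2 lborel (indicator ?B :: 'a \<Rightarrow> real) + 2 * l2 lborel (\<lambda>x. \<phi> k x - u x)" for k
  proof -
    have "l2 lborel (\<lambda>x. ?\<psi> k x - polarize n \<beta> u x)
        \<le> l2 lborel (\<lambda>x. (3 * ?e k) *\<^sub>R indicator ?B x + (\<bar>\<phi> k x - u x\<bar> + \<bar>\<phi> k (?s x) - u (?s x)\<bar>))"
    proof (rule l2_mono[OF sqint_diff[OF test_function_sqint[OF t\<psi>] spu] sqint_add[OF iB sdu(1)]], rule AE_I2)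
      fix x
      show "norm (?\<psi> k x - polarize n \<beta> u x) \<le> norm ((3 * ?e k) *\<^sub>R indicator ?B x + (\<bar>\<phi> k x - u x\<bar> + \<bar>\<phi> k (?s x) - u (?s x)\<bar>))"
      proof (cases "x \<in> ?B")
        case True
        have "\<bar>?\<psi> k x - polarize n \<beta> u x\<bar> \<le> 3 * ?e k + \<bar>polarize n \<beta> (\<phi> k) x - polarize n \<beta> u x\<bar>"
          using spos_bounds[OF ek[of k], of "p k x - ?e k"] p(3)[of k x] pu0[of x] ek[of k]
          by (simp only: mult_1_left) (auto simp: max_def abs_le_iff abs_if split: if_splits)
        then show ?thesis using polarize_diff[of n \<beta> "\<phi> k" x u] True ek[of k] by simp
      qed (use test_function_zero_outside[OF t\<psi>] pu_out in simp)
    qed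
    also have "\<dots> \<le> l2 lborel (\<lambda>x. (3 * ?e k) *\<^sub>R indicator ?B x :: real) + l2 lborel (\<lambda>x. \<bar>\<phi> k x - u x\<bar> + \<bar>\<phi> k (?s x) - u (?s x)\<bar>)"
      by (rule l2_triangle[OF iB sdu(1)])
    also have "l2 lborel (\<lambda>x. (3 * ?e k) *\<^sub>R indicator ?B x :: real) = 3 * ?e k * l2 lborel (indicator ?B :: 'a \<Rightarrow> real)"
      using ek[of k] by (simp only: l2_scaleR)
    finally show ?thesis using sdu(2)[of k] by linarith
  qed
  have "H10_le ?B (polarize n \<beta> u) c"
  proof (rule H10_leI[OF spu t\<psi>])
    have "(\<lambda>k. 3 * ?e k * l2 lborel (indicator ?B :: 'a \<Rightarrow> real) + 2 * l2 lborel (\<lambda>x. \<phi> k x - u x))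
        \<longlonglongrightarrow> 3 * 0 * l2 lborel (indicator ?B :: 'a \<Rightarrow> real) + 2 * 0"
      by (intro tendsto_intros \<phi>(2) LIMSEQ_Suc[OF lim_1_over_n])
    then show "(\<lambda>k. l2 lborel (\<lambda>x. ?\<psi> k x - polarize n \<beta> u x)) \<longlonglongrightarrow> 0"
      by (intro Lim_null_comparison[of "\<lambda>k. l2 lborel (\<lambda>x. ?\<psi> k x - polarize n \<beta> u x)", OF always_eventually]) (use close in auto)
    show "dirichlet (?\<psi> k) \<le> c + ?e k" for k
    proof -
      have "dirichlet (?\<psi> k) \<le> dirichlet (p k)"
      proof (rule dirichlet_compose[OF smooth_spos_affine _ t\<psi> p(1)])
        show "\<bar>frechet_derivative (\<lambda>s. spos (?e k) (1 * s + (- ?e k))) (at s) 1\<bar> \<le> 1" for s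
          using spos_derivative_bounds[OF ek[of k], of "1 * s + (- ?e k)"] by (simp only: frechet_derivative_spos_affine)
      qed
      then show ?thesis using p(2)[of k] \<phi>(3)[of k] by linarith
    qed
    show "(\<lambda>k. c + ?e k) \<longlonglongrightarrow> c" using tendsto_add[OF tendsto_const LIMSEQ_Suc[OF lim_1_over_n], of c] by simp
  qed
  then show ?thesis using pu0 pu_out by (auto simp: H10_pos_def)
qed

section \<open>Minimisers of the relaxed energy\<close>

text \<open>The bound c stands in for the Dirichlet integral. It enters increasingly, so minimising
  over pairs presses it down to the true value.\<close>

definition relaxed_energy :: "('a::euclidean_space \<Rightarrow> real) \<Rightarrow> real \<Rightarrow> real" where
  "relaxed_energy u c = c / 2 - 1/4 * (\<integral>x. u x ^ 4 \<partial>lborel) + 1/6 * (\<integral>x. u x ^ 6 \<partial>lborel)"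

definition feasible :: "'a::euclidean_space set \<Rightarrow> real \<Rightarrow> ('a \<Rightarrow> real) \<Rightarrow> real \<Rightarrow> bool" where
  "feasible D N u c \<longleftrightarrow> H10_pos D u c \<and> (\<integral>x. (u x)\<^sup>2 \<partial>lborel) = N"

definition minimiser :: "'a::euclidean_space set \<Rightarrow> real \<Rightarrow> ('a \<Rightarrow> real) \<Rightarrow> real \<Rightarrow> bool" where
  "minimiser D N u c \<longleftrightarrow> feasible D N u c \<and> (\<forall>v d. feasible D N v d \<longrightarrow> relaxed_energy u c \<le> relaxed_energy v d)"

text \<open>The nonlinear part of the energy density after adding the multiple of the mass that makes it
  nonnegative.\<close>

definition shifted_density :: "real \<Rightarrow> real" where
  "shifted_density s = 1/6 * s ^ 6 - 1/4 * s ^ 4 + 3/32 * s\<^sup>2"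

text \<open>The constant 3/32 makes the quadratic in s^2 that remains after dividing by s^2 a
  perfect square; it is the least constant for which that quadratic is nonnegative.\<close>

lemma shifted_density_nonneg: "0 \<le> shifted_density s"
proof -
  have "shifted_density s = s\<^sup>2 * (s\<^sup>2 - 3/4)\<^sup>2 / 6"
    by (simp add: shifted_density_def eval_nat_numeral algebra_simps)
  also have "0 \<le> \<dots>" by (intro divide_nonneg_pos mult_nonneg_nonneg zero_le_power2) simp
  finally show ?thesis .
qed

lemma H10_pos_integrable_powers:
  fixes u :: "'a::euclidean_space \<Rightarrow> real"
  assumes u: "H10_pos D u c" and dim: "DIM('a) \<in> {1, 2, 3}"
  shows "integrable lborel (\<lambda>x. (u x)\<^sup>2)" "integrable lborel (\<lambda>x. u x ^ 4)" "integrable lborel (\<lambda>x. u x ^ 6)"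
proof -
  note [measurable] = H10_posD(5)[OF u]
  show i2: "integrable lborel (\<lambda>x. (u x)\<^sup>2)" using sqint_integrable[OF H10_posD(4)[OF u]] by simp
  show i6: "integrable lborel (\<lambda>x. u x ^ 6)" by (rule H10_le_integrable_power6[OF H10_posD(1)[OF u] dim])
  show "integrable lborel (\<lambda>x. u x ^ 4)"
  proof (rule Bochner_Integration.integrable_bound[OF Bochner_Integration.integrable_add[OF i2 i6]])
    have "s ^ 4 \<le> s\<^sup>2 + s ^ 6" for s :: real
    proof -
      have "0 \<le> (s - s ^ 3)\<^sup>2 + s\<^sup>2 + s ^ 6" by (intro add_nonneg_nonneg) auto
      then show ?thesis by (simp add: eval_nat_numeral algebra_simps)
    qed
    then show "AE x in lborel. norm (u x ^ 4) \<le> norm ((u x)\<^sup>2 + u x ^ 6)"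
      by (intro AE_I2) (simp add: power_even_abs abs_of_nonneg)
  qed measurable
qed

lemma relaxed_energy_eq:
  fixes u :: "'a::euclidean_space \<Rightarrow> real"
  assumes u: "H10_pos D u c" and dim: "DIM('a) \<in> {1, 2, 3}"
  shows "integrable lborel (\<lambda>x. shifted_density (u x))"
    "relaxed_energy u c = c / 2 + (\<integral>x. shifted_density (u x) \<partial>lborel) - 3/32 * (\<integral>x. (u x)\<^sup>2 \<partial>lborel)"
  using H10_pos_integrable_powers[OF assms] by (simp_all add: shifted_density_def relaxed_energy_def)

lemma relaxed_energy_lower_bound:
  fixes u :: "'a::euclidean_space \<Rightarrow> real"
  assumes u: "H10_pos D u c" and dim: "DIM('a) \<in> {1, 2, 3}"
  shows "c / 2 - 3/32 * (\<integral>x. (u x)\<^sup>2 \<partial>lborel) \<le> relaxed_energy u c"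
proof -
  have "0 \<le> (\<integral>x. shifted_density (u x) \<partial>lborel)" by (intro integral_nonneg_AE AE_I2 shifted_density_nonneg)
  then show ?thesis using relaxed_energy_eq(2)[OF assms] by simp
qed

text \<open>The bounds c and the masses converge, so Fatou is applied to the shifted density only.
  The energies are merely assumed to lie below a convergent sequence e, because their own
  convergence is not known beforehand.\<close>

lemma relaxed_energy_lsc:
  fixes u :: "nat \<Rightarrow> 'a::euclidean_space \<Rightarrow> real"
  assumes dim: "DIM('a) \<in> {1, 2, 3}" and u: "\<And>n. H10_pos D (u n) (c n)" and v: "H10_pos D v d"
    and lim: "(\<lambda>n. l2 lborel (\<lambda>x. u n x - v x)) \<longlonglongrightarrow> 0" "c \<longlonglongrightarrow> d"
    and e: "\<And>n. relaxed_energy (u n) (c n) \<le> e n" "e \<longlonglongrightarrow> E"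
  shows "relaxed_energy v d \<le> E"
proof -
  note su = H10_posD(4)[OF u] and sv = H10_posD(4)[OF v]
  note [measurable] = H10_posD(5)[OF u] H10_posD(5)[OF v]
  have [measurable]: "shifted_density \<in> borel_measurable borel" unfolding shifted_density_def by measurable
  obtain r :: "nat \<Rightarrow> nat" where r: "strict_mono r" "AE x in lborel. (\<lambda>n. u (r n) x) \<longlonglongrightarrow> v x"
    by (rule l2_AE_subseq[OF su sv lim(1)]) (rule that)
  define q where "q n = e n - c n / 2 + 3/32 * (l2 lborel (u n))\<^sup>2" for n
  define Q where "Q = E - d / 2 + 3/32 * (l2 lborel v)\<^sup>2"
  have qQ: "q \<longlonglongrightarrow> Q"
    unfolding q_def Q_def by (intro tendsto_intros e(2) lim(2) l2_tendsto[OF su sv lim(1)]) simp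
  have W: "(\<integral>x. shifted_density (u n x) \<partial>lborel) \<le> q n" for n
    using e(1)[of n] relaxed_energy_eq(2)[OF u dim, of n] by (simp add: q_def l2_sq)
  have "0 \<le> (\<integral>x. shifted_density (u n x) \<partial>lborel)" for n by (intro integral_nonneg_AE AE_I2 shifted_density_nonneg)
  then have "0 \<le> q n" for n using W order_trans by blast
  then have Q0: "0 \<le> Q" using qQ by (intro LIMSEQ_le_const) auto
  have "(\<integral>\<^sup>+x. ennreal (shifted_density (v x)) \<partial>lborel) = (\<integral>\<^sup>+x. liminf (\<lambda>n. ennreal (shifted_density (u (r n) x))) \<partial>lborel)"
  proof (rule nn_integral_cong_AE)
    show "AE x in lborel. ennreal (shifted_density (v x)) = liminf (\<lambda>n. ennreal (shifted_density (u (r n) x)))"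
      using r(2)
    proof eventually_elim
      case (elim x)
      have "(\<lambda>n. ennreal (shifted_density (u (r n) x))) \<longlonglongrightarrow> ennreal (shifted_density (v x))"
        unfolding shifted_density_def by (intro tendsto_intros elim) auto
      then show ?case by (rule lim_imp_Liminf[OF trivial_limit_sequentially, symmetric])
    qed
  qed
  also have "\<dots> \<le> liminf (\<lambda>n. \<integral>\<^sup>+x. ennreal (shifted_density (u (r n) x)) \<partial>lborel)"
    by (rule nn_integral_liminf) measurable
  also have "\<dots> \<le> liminf (\<lambda>n. ennreal (q (r n)))"
  proof (intro Liminf_mono always_eventually allI)
    fix n
    show "(\<integral>\<^sup>+x. ennreal (shifted_density (u (r n) x)) \<partial>lborel) \<le> ennreal (q (r n))"
      using W[of "r n"] relaxed_energy_eq(1)[OF u dim, of "r n"]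
      by (subst nn_integral_eq_integral) (auto simp: shifted_density_nonneg intro: ennreal_leI)
  qed
  also have "\<dots> = ennreal Q"
    by (intro lim_imp_Liminf trivial_limit_sequentially tendsto_ennrealI LIMSEQ_subseq_LIMSEQ[OF qQ r(1), unfolded o_def])
  finally have "ennreal (\<integral>x. shifted_density (v x) \<partial>lborel) \<le> ennreal Q"
    by (subst (asm) nn_integral_eq_integral[OF relaxed_energy_eq(1)[OF v dim]]) (auto simp: shifted_density_nonneg)
  then have "(\<integral>x. shifted_density (v x) \<partial>lborel) \<le> Q" using Q0 by simp
  then show ?thesis using relaxed_energy_eq(2)[OF v dim] by (simp add: Q_def l2_sq)
qed

text \<open>Used twice: with e n equal to the infimum plus 1/(n+1) to find a minimiser, and with
  constant e to obtain compactness of the set of minimisers.\<close>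

lemma feasible_compact:
  fixes u :: "nat \<Rightarrow> 'a::euclidean_space \<Rightarrow> real"
  assumes dim: "DIM('a) \<in> {1, 2, 3}" and D: "open D" "bounded D"
    and u: "\<And>n. feasible D N (u n) (c n)" and e: "\<And>n. relaxed_energy (u n) (c n) \<le> e n" "e \<longlonglongrightarrow> E"
  obtains k v d where "strict_mono (k :: nat \<Rightarrow> nat)" "feasible D N v d"
    "(\<lambda>n. l2 lborel (\<lambda>x. u (k n) x - v x)) \<longlonglongrightarrow> 0" "relaxed_energy v d \<le> E"
proof -
  have uH: "H10_pos D (u n) (c n)" and uN: "(\<integral>x. (u n x)\<^sup>2 \<partial>lborel) = N" for n using u by (auto simp: feasible_def)
  have "Bseq e" using e(2) convergent_imp_Bseq convergent_def by blast
  then obtain B where B: "\<And>n. norm (e n) \<le> B" unfolding Bseq_def by blast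
  \<comment> \<open>The first entry bounds the norms, which equal sqrt N; the second bounds the
    Dirichlet variables through \<open>relaxed_energy_lower_bound\<close>.\<close>
  define C where "C = max (sqrt N) (2 * (B + 3/32 * N))"
  have "l2 lborel (u n) \<le> C" for n using uN[of n] by (simp add: l2_def C_def)
  moreover have "c n \<le> C" for n
    using relaxed_energy_lower_bound[OF uH dim, of n] e(1)[of n] B[of n] uN[of n] by (simp add: C_def abs_le_iff le_max_iff_disj)
  ultimately obtain k v d where k: "strict_mono (k :: nat \<Rightarrow> nat)" "H10_pos D v d"
    "(\<lambda>n. l2 lborel (\<lambda>x. u (k n) x - v x)) \<longlonglongrightarrow> 0" "(\<lambda>n. c (k n)) \<longlonglongrightarrow> d"
    by (rule rellich[OF D uH]) (rule that)
  have "(\<lambda>n. (l2 lborel (u (k n)))\<^sup>2) \<longlonglongrightarrow> (l2 lborel v)\<^sup>2"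
    by (intro tendsto_power l2_tendsto H10_posD(4)[OF uH] H10_posD(4)[OF k(2)] k(3))
  then have "(l2 lborel v)\<^sup>2 = N" by (simp add: l2_sq uN LIMSEQ_const_iff)
  then have "feasible D N v d" using k(2) by (simp add: feasible_def l2_sq)
  moreover have "relaxed_energy v d \<le> E"
    by (rule relaxed_energy_lsc[OF dim uH k(2) k(3) k(4) e(1) LIMSEQ_subseq_LIMSEQ[OF e(2) k(1), unfolded o_def]])
  ultimately show thesis using k by (intro that)
qed

lemma H10_pos_scale:
  assumes "H10_pos D u c" "t \<ge> 0" shows "H10_pos D (\<lambda>x. t * u x) (t\<^sup>2 * c)"
  using H10_le_scaleR[of D u c t] assms by (simp add: H10_pos_def)

lemma feasible_exists:
  fixes D :: "'a::euclidean_space set"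
  assumes D: "open D" "D \<noteq> {}" and N: "N > 0"
  obtains u c where "feasible D N u c"
proof -
  obtain x where x: "x \<in> D" using D(2) by blast
  then obtain a b where ab: "x \<in> box a b" "cbox a b \<subseteq> D" using open_contains_cbox[OF D(1) x] by metis
  obtain \<phi> :: "nat \<Rightarrow> 'a \<Rightarrow> real" where \<phi>: "\<And>n. test_function D (\<phi> n)" "\<And>n x. 0 \<le> \<phi> n x"
    "\<And>n x. \<phi> n x \<le> indicator (box a b) x" "\<And>x. (\<lambda>n. \<phi> n x) \<longlonglongrightarrow> indicator (box a b) x"
    "\<And>x. x \<in> box a b \<Longrightarrow> \<phi> 1 x > 0"
    by (rule box_bump[OF ab(2)]) (rule that)
  have H: "H10_pos D (\<phi> 1) (dirichlet (\<phi> 1))"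
    using H10_le_test[OF \<phi>(1)] \<phi>(2) test_function_zero_outside[OF \<phi>(1)] by (auto simp: H10_pos_def)
  define m where "m = (\<integral>x. (\<phi> 1 x)\<^sup>2 \<partial>lborel)"
  have "m \<noteq> 0"
  proof
    assume "m = 0"
    moreover have i: "integrable lborel (\<lambda>x. (\<phi> 1 x)\<^sup>2)" using sqint_integrable[OF H10_posD(4)[OF H]] by simp
    ultimately have "AE x in lborel. (\<phi> 1 x)\<^sup>2 = 0" unfolding m_def by (subst (asm) integral_nonneg_eq_0_iff_AE) auto
    then have "AE x in lborel. x \<notin> box a b" by eventually_elim (use \<phi>(5) in force)
    then have "emeasure lborel (box a b) = 0" by (subst (asm) AE_iff_measurable[of "box a b"]) auto
    moreover have "emeasure lborel (box a b) > 0" using ab(1)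
      by (auto simp: emeasure_lborel_box_eq mem_box inner_diff_left intro!: prod_pos less_imp_le[of "a \<bullet> _"]; force)
    ultimately show False by simp
  qed
  then have m: "m > 0" unfolding m_def by (simp add: order_less_le integral_nonneg_AE)
  define t where "t = sqrt (N / m)"
  have "(\<integral>x. (t * \<phi> 1 x)\<^sup>2 \<partial>lborel) = N"     by (simp only: power_mult_distrib integral_mult_right_zero m_def[symmetric] t_def) (use N m in simp)
  moreover have "t \<ge> 0" using N m by (simp add: t_def)
  ultimately have "feasible D N (\<lambda>x. t * \<phi> 1 x) (t\<^sup>2 * dirichlet (\<phi> 1))"
    using H10_pos_scale[OF H] by (simp add: feasible_def)
  then show thesis by (rule that)
qed

lemma minimiser_exists:
  fixes D :: "'a::euclidean_space set"
  assumes dim: "DIM('a) \<in> {1, 2, 3}" and D: "open D" "bounded D" "D \<noteq> {}" and N: "N > 0"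
  obtains u c where "minimiser D N u c"
proof -
  define S where "S = {relaxed_energy u c |u c. feasible D N u c}"
  obtain u0 c0 where "feasible D N u0 c0" by (rule feasible_exists[OF D(1,3) N]) (rule that)
  then have ne: "S \<noteq> {}" unfolding S_def by blast
  have lb: "- 3/32 * N \<le> s" if s: "s \<in> S" for s
  proof -
    obtain u c where u: "s = relaxed_energy u c" "H10_pos D u c" "(\<integral>x. (u x)\<^sup>2 \<partial>lborel) = N"
      using s by (auto simp: S_def feasible_def)
    show ?thesis using relaxed_energy_lower_bound[OF u(2) dim] H10_le_nonneg[OF H10_posD(1)[OF u(2)]] u by simp
  qed
  then have bdd: "bdd_below S" by (rule bdd_belowI)
  have "\<exists>u c. feasible D N u c \<and> relaxed_energy u c < Inf S + 1 / real (Suc n)" for n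
    using cInf_less_iff[OF ne bdd, of "Inf S + 1 / real (Suc n)"] unfolding S_def by auto
  then obtain u c where u: "\<And>n. feasible D N (u n) (c n)" "\<And>n. relaxed_energy (u n) (c n) < Inf S + 1 / real (Suc n)"
    by metis
  have "(\<lambda>n. Inf S + 1 / real (Suc n)) \<longlonglongrightarrow> Inf S"
    using tendsto_add[OF tendsto_const LIMSEQ_Suc[OF lim_1_over_n], of "Inf S"] by simp
  then obtain k v d where "strict_mono (k :: nat \<Rightarrow> nat)" and v: "feasible D N v d"
    and "(\<lambda>n. l2 lborel (\<lambda>x. u (k n) x - v x)) \<longlonglongrightarrow> 0" and le: "relaxed_energy v d \<le> Inf S"
    by (rule feasible_compact[OF dim D(1,2) u(1) less_imp_le[OF u(2)]]) (rule that)
  have "relaxed_energy v d \<le> relaxed_energy w e" if "feasible D N w e" for w e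
    using le cInf_lower[OF _ bdd, of "relaxed_energy w e"] that by (force simp: S_def)
  then show thesis using v by (intro that[of v d]) (auto simp: minimiser_def)
qed

section \<open>Return to the original minimisation problem\<close>

lemma integral_representative:
  fixes f :: "'a::euclidean_space \<Rightarrow> real"
  assumes D: "open D" and u: "u \<in> borel_measurable borel" "\<And>x. x \<notin> D \<Longrightarrow> u x = 0"
    and f: "f \<in> borel_measurable (lebesgue_on D)" "AE x in lebesgue_on D. f x = u x" and p: "p > 0"
  shows "(\<integral>x. f x ^ p \<partial>lebesgue_on D) = (\<integral>x. u x ^ p \<partial>lborel)"
proof -
  note [measurable] = f(1) u(1) borel_lebesgue_on[OF u(1), of D]
  have "(\<integral>x. f x ^ p \<partial>lebesgue_on D) = (\<integral>x. u x ^ p \<partial>lebesgue_on D)"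
    by (rule integral_cong_AE) (use f(2) in auto)
  also have "\<dots> = (\<integral>x. u x ^ p \<partial>lborel)"
    by (rule integral_lebesgue_on(1)[OF _ D]) (use u p in \<open>auto simp: power_0_left\<close>)
  finally show ?thesis .
qed

text \<open>For every admissible \<Phi>, the energy of u is at most its relaxed energy, which is at
  most the relaxed energy of |\<Phi>| paired with the gradient integral of \<Phi>, and this last
  number is the energy of \<Phi>.\<close>

lemma minimiser_ground_state:
  fixes D :: "'a::euclidean_space set"
  assumes D: "open D" "bounded D" and u: "minimiser D N u c"
  shows "ground_state D N (\<lambda>x. complex_of_real (u x))"
proof -
  let ?u = "\<lambda>x. complex_of_real (u x)"
  have uH: "H10_pos D u c" and uN: "(\<integral>x. (u x)\<^sup>2 \<partial>lborel) = N"
    and min: "\<And>v d. feasible D N v d \<Longrightarrow> relaxed_energy u c \<le> relaxed_energy v d"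
    using u by (auto simp: minimiser_def feasible_def)
  note rel = relaxed_H10[OF D(1) H10_posD(1)[OF uH] H10_posD(3)[OF uH]]
  have int: "(\<integral>x. (norm (?u x)) ^ p \<partial>lebesgue_on D) = (\<integral>x. u x ^ p \<partial>lborel)" if "p > 0" for p
  proof (rule integral_representative[OF D(1) H10_posD(5)[OF uH] H10_posD(3)[OF uH] _ _ that])
    show "(\<lambda>x. norm (?u x)) \<in> borel_measurable (lebesgue_on D)"
      using borel_lebesgue_on[OF H10_posD(5)[OF uH]] by simp
    show "AE x in lebesgue_on D. norm (?u x) = u x" using H10_posD(2)[OF uH] by simp
  qed
  have adm: "?u \<in> admissible D N" using rel(1) int[of 2] uN by (simp add: admissible_def)
  have le: "energy D ?u \<le> relaxed_energy u c"
    unfolding energy_def relaxed_energy_def using rel(2) int[of 4] int[of 6] by simp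
  have "relaxed_energy u c \<le> energy D \<Phi>" if \<Phi>: "\<Phi> \<in> admissible D N" for \<Phi>
  proof -
    have \<Phi>H: "\<Phi> \<in> H10 D" and \<Phi>N: "(\<integral>x. (norm (\<Phi> x))\<^sup>2 \<partial>lebesgue_on D) = N" using \<Phi> by (auto simp: admissible_def)
    obtain v where v: "v \<in> borel_measurable borel" "\<And>x. 0 \<le> v x" "\<And>x. x \<notin> D \<Longrightarrow> v x = 0"
      "AE x in lebesgue_on D. norm (\<Phi> x) = v x" "H10_le D v (\<integral>x. grad_norm_sq D \<Phi> x \<partial>lebesgue_on D)"
      by (rule H10_norm_relaxed[OF D \<Phi>H]) (rule that)
    have "\<Phi> \<in> borel_measurable (lebesgue_on D)" using \<Phi>H by (simp add: H10_def H1_def L2_def)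
    then have "(\<lambda>x. norm (\<Phi> x)) \<in> borel_measurable (lebesgue_on D)" by simp
    from integral_representative[OF D(1) v(1,3) this v(4)]
    have i: "(\<integral>x. (norm (\<Phi> x)) ^ p \<partial>lebesgue_on D) = (\<integral>x. v x ^ p \<partial>lborel)" if "p > 0" for p using that by blast
    have "feasible D N v (\<integral>x. grad_norm_sq D \<Phi> x \<partial>lebesgue_on D)"
      using v i[of 2] \<Phi>N by (simp add: feasible_def H10_pos_def)
    from min[OF this] show ?thesis unfolding energy_def relaxed_energy_def using i[of 4] i[of 6] by simp
  qed
  then have "ereal (energy D ?u) \<le> min_energy D N"
    unfolding min_energy_def using le by (intro INF_greatest) (auto intro: order_trans)
  moreover have "min_energy D N \<le> ereal (energy D ?u)" unfolding min_energy_def by (rule INF_lower[OF adm])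
  ultimately show ?thesis using adm by (simp add: ground_state_def antisym)
qed

section \<open>Boundedness of minimisers\<close>

lemma minimiser_cong_AE:
  fixes u v :: "'a::euclidean_space \<Rightarrow> real"
  assumes u: "minimiser D N u c" and v: "v \<in> borel_measurable borel" "\<And>x. 0 \<le> v x" "\<And>x. x \<notin> D \<Longrightarrow> v x = 0"
    and eq: "AE x in lborel. u x = v x"
  shows "minimiser D N v c"
proof -
  have uH: "H10_pos D u c" using u by (simp add: minimiser_def feasible_def)
  note [measurable] = v(1) H10_posD(5)[OF uH]
  have "(\<integral>x. u x ^ p \<partial>lborel) = (\<integral>x. v x ^ p \<partial>lborel)" for p
    by (rule integral_cong_AE) (use eq in auto)
  then show ?thesis
    using u v H10_le_cong_AE[OF H10_posD(1)[OF uH] v(1) eq]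
    by (simp add: minimiser_def feasible_def H10_pos_def relaxed_energy_def)
qed

text \<open>With b = s^2 and a = M^2 the density is F b = b^3/6 - b^2/4, which is convex for b \<ge>
  1/2. Hence F b - F a is at least b - a times the slope a (a - 1)/2 of F at a.\<close>

lemma density_truncation_gain:
  fixes s M :: real
  assumes "0 \<le> s" "1 \<le> M"
  defines "t \<equiv> min s M"
  shows "(M\<^sup>2 * (M\<^sup>2 - 1) / 2) * (s\<^sup>2 - t\<^sup>2) \<le> (1/6 * s ^ 6 - 1/4 * s ^ 4) - (1/6 * t ^ 6 - 1/4 * t ^ 4)"
proof (cases "s \<le> M")
  case False
  define a b where "a = M\<^sup>2" and "b = s\<^sup>2"
  have a: "1 \<le> a" using assms by (simp add: a_def)
  have ba: "a \<le> b" unfolding a_def b_def using False assms by (intro power_mono) auto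
  have id: "(1/6 * b ^ 3 - 1/4 * b\<^sup>2) - (1/6 * a ^ 3 - 1/4 * a\<^sup>2) = (b - a) * ((b\<^sup>2 + a * b + a\<^sup>2) / 6 - (a + b) / 4)"
    by (simp add: eval_nat_numeral field_simps)
  have "(a * (a - 1) / 2) \<le> (b\<^sup>2 + a * b + a\<^sup>2) / 6 - (a + b) / 4"
  proof -
    define h where "h = b - a"
    have b: "b = a + h" and h: "0 \<le> h" using ba by (auto simp: h_def)
    have "(b\<^sup>2 + a * b + a\<^sup>2) / 6 - (a + b) / 4 - (a * (a - 1) / 2) = h\<^sup>2 / 6 + h * (a / 2 - 1 / 4)"
      unfolding b by (simp add: power2_eq_square field_simps)
    moreover have "0 \<le> h * (a / 2 - 1 / 4)" using h a by simp
    ultimately show ?thesis by (smt (verit) zero_le_power2 divide_nonneg_pos)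
  qed
  then have "(b - a) * (a * (a - 1) / 2) \<le> (b - a) * ((b\<^sup>2 + a * b + a\<^sup>2) / 6 - (a + b) / 4)"
    using ba by (intro mult_left_mono) auto
  then have "(a * (a - 1) / 2) * (b - a) \<le> (1/6 * b ^ 3 - 1/4 * b\<^sup>2) - (1/6 * a ^ 3 - 1/4 * a\<^sup>2)"
    unfolding id by (simp add: mult.commute)
  moreover have "t = M" using False by (simp add: t_def)
  ultimately show ?thesis by (simp add: a_def b_def power_mult[symmetric])
qed (simp add: t_def)

text \<open>Cutting \<open>u\<close> off at a high level \<open>M\<close> and rescaling to mass \<open>N\<close> would gain of order \<open>M\<^sup>4\<close> times the
  removed mass, at the cost of a fixed multiple of it.\<close>

lemma minimiser_bounded:
  fixes u :: "'a::euclidean_space \<Rightarrow> real"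
  assumes dim: "DIM('a) \<in> {1, 2, 3}" and D: "open D" "bounded D" and N: "N > 0" and u: "minimiser D N u c"
  obtains M where "M \<ge> 0" "AE x in lborel. u x \<le> M"
proof -
  have uH: "H10_pos D u c" and uN: "(\<integral>x. (u x)\<^sup>2 \<partial>lborel) = N"
    and min: "\<And>v d. feasible D N v d \<Longrightarrow> relaxed_energy u c \<le> relaxed_energy v d"
    using u by (auto simp: minimiser_def feasible_def)
  note iu = H10_pos_integrable_powers[OF uH dim]
  define S where "S = (\<integral>x. u x ^ 6 \<partial>lborel)"
  have S: "S \<ge> 0" unfolding S_def by (intro integral_nonneg_AE AE_I2) simp
  have c: "c \<ge> 0" by (rule H10_le_nonneg[OF H10_posD(1)[OF uH]])
  \<comment> \<open>The price of rescaling per unit of removed mass: the factor T satisfies T - 1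
    \<le> 2 \<delta>/N and T^3 - 1 \<le> 7 (T - 1) for T \<le> 2, while the quadratic and sextic
    terms contribute c/2 and S/6.\<close>
  define C where "C = 2 / N * (c / 2 + 7/6 * S)"
  have C: "C \<ge> 0" using N c S by (simp add: C_def)
  \<comment> \<open>Large enough for two purposes: the gain factor K exceeds C, and \<delta> \<le>
    S/M^4 \<le> N/2, which keeps T at most 2.\<close>
  define M where "M = 2 + C + 2 * S / N"
  have SN: "0 \<le> 2 * S / N" using S N by simp
  have M: "M \<ge> 2" "M > C" "M \<ge> 2 * S / N" using C SN by (auto simp: M_def)
  have M2: "M\<^sup>2 - 1 \<ge> M" "M\<^sup>2 \<ge> 2" "M ^ 4 \<ge> M"
  proof -
    have "M * 2 \<le> M\<^sup>2" unfolding power2_eq_square using M by (intro mult_left_mono) auto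
    then show a: "M\<^sup>2 - 1 \<ge> M" "M\<^sup>2 \<ge> 2" using M by auto
    have "M ^ 1 \<le> M ^ 4" using M by (intro power_increasing) auto
    then show "M ^ 4 \<ge> M" by simp
  qed
  define K where "K = M\<^sup>2 * (M\<^sup>2 - 1) / 2"
  have K: "K > C"
  proof -
    have "2 * M \<le> M\<^sup>2 * (M\<^sup>2 - 1)" using M2 M by (intro mult_mono) auto
    then show ?thesis using M by (simp add: K_def)
  qed
  define v where "v x = min (u x) M" for x
  have vH: "H10_pos D v c" unfolding v_def[abs_def] using M by (intro H10_pos_truncate[OF D uH]) simp
  note iv = H10_pos_integrable_powers[OF vH dim]
  define \<delta> where "\<delta> = (\<integral>x. (u x)\<^sup>2 - (v x)\<^sup>2 \<partial>lborel)"
  have vu: "0 \<le> v x" "v x \<le> u x" for x using H10_posD(2)[OF vH] by (auto simp: v_def)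
  have vu2: "(v x)\<^sup>2 \<le> (u x)\<^sup>2" for x by (intro power_mono vu)
  have \<delta>: "0 \<le> \<delta>" unfolding \<delta>_def using vu2 by (intro integral_nonneg_AE AE_I2) simp
  have vN: "(\<integral>x. (v x)\<^sup>2 \<partial>lborel) = N - \<delta>"
    unfolding \<delta>_def by (subst Bochner_Integration.integral_diff[OF iu(1) iv(1)]) (simp add: uN)
  have \<delta>N: "\<delta> \<le> N / 2"
  proof -
    have "\<delta> \<le> (\<integral>x. u x ^ 6 / M ^ 4 \<partial>lborel)"
      unfolding \<delta>_def
    proof (intro integral_mono Bochner_Integration.integrable_diff iu iv integrable_divide_zero)
      fix x
      show "(u x)\<^sup>2 - (v x)\<^sup>2 \<le> u x ^ 6 / M ^ 4"
      proof (cases "u x \<le> M")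
        case False
        then have "M ^ 4 \<le> u x ^ 4" using M by (intro power_mono) auto
        then have "(u x)\<^sup>2 * M ^ 4 \<le> (u x)\<^sup>2 * u x ^ 4" by (intro mult_left_mono) auto
        also have "\<dots> = u x ^ 6" by (simp add: power_add[symmetric])
        finally have "(u x)\<^sup>2 \<le> u x ^ 6 / M ^ 4" using M by (simp add: pos_le_divide_eq)
        then show ?thesis using zero_le_power2[of "v x"] by linarith
      qed (use M in \<open>simp add: v_def\<close>)
    qed
    also have "\<dots> = S / M ^ 4" by (simp add: S_def)
    also have "\<dots> \<le> S / M" using M M2 S by (intro divide_left_mono) auto
    also have "\<dots> \<le> N / 2"
    proof -
      have "2 * S \<le> M * N" using M(3) N by (simp add: pos_divide_le_eq)
      then show ?thesis using M by (simp add: field_simps)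
    qed
    finally show ?thesis .
  qed
  have "\<delta> = 0"
  proof (rule ccontr)
    assume "\<delta> \<noteq> 0"
    then have \<delta>0: "\<delta> > 0" using \<delta> by simp
    have N\<delta>: "N - \<delta> > 0" using \<delta>N N by simp
    \<comment> \<open>The truncated function has mass N - \<delta>; multiplying it by sqrt T
      restores N.\<close>
    define T where "T = N / (N - \<delta>)"
    have T: "1 \<le> T" "T \<le> 2" using N\<delta> \<delta> \<delta>N by (auto simp: T_def field_simps)
    have T1: "T - 1 \<le> 2 / N * \<delta>"
    proof -
      have "T - 1 = \<delta> / (N - \<delta>)" using N\<delta> by (simp add: T_def field_simps)
      also have "\<dots> \<le> \<delta> / (N / 2)" using \<delta>N \<delta> N by (intro divide_left_mono) auto
      finally show ?thesis by (simp add: mult.commute)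
    qed
    have sT: "(sqrt T)\<^sup>2 = T" "sqrt T ^ 4 = T\<^sup>2" "sqrt T ^ 6 = T ^ 3"
    proof -
      show sq: "(sqrt T)\<^sup>2 = T" using T by simp
      show "sqrt T ^ 4 = T\<^sup>2" "sqrt T ^ 6 = T ^ 3"
        using power_mult[of "sqrt T" 2 2] power_mult[of "sqrt T" 2 3] sq by simp_all
    qed
    have feas: "feasible D N (\<lambda>x. sqrt T * v x) (T * c)"
    proof -
      have "(\<integral>x. (sqrt T * v x)\<^sup>2 \<partial>lborel) = T * (N - \<delta>)" by (simp add: power_mult_distrib sT vN)
      also have "\<dots> = N" using N\<delta> by (simp add: T_def)
      finally show ?thesis using H10_pos_scale[OF vH, of "sqrt T"] T by (simp add: feasible_def sT)
    qed
    define V4 V6 U4 where "V4 = (\<integral>x. v x ^ 4 \<partial>lborel)" and "V6 = (\<integral>x. v x ^ 6 \<partial>lborel)" and "U4 = (\<integral>x. u x ^ 4 \<partial>lborel)"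
    have V4: "0 \<le> V4" unfolding V4_def by (intro integral_nonneg_AE AE_I2) simp
    have V6: "V6 \<le> S" "0 \<le> V6" unfolding V6_def S_def
      by (intro integral_mono iu iv power_mono vu) (intro integral_nonneg_AE AE_I2, simp)
    have gain: "K * \<delta> \<le> (1/6 * S - 1/4 * U4) - (1/6 * V6 - 1/4 * V4)"
    proof -
      have "K * \<delta> = (\<integral>x. K * ((u x)\<^sup>2 - (v x)\<^sup>2) \<partial>lborel)" by (simp add: \<delta>_def)
      also have "\<dots> \<le> (\<integral>x. (1/6 * u x ^ 6 - 1/4 * u x ^ 4) - (1/6 * v x ^ 6 - 1/4 * v x ^ 4) \<partial>lborel)"
      proof (intro integral_mono)
        fix x
        show "K * ((u x)\<^sup>2 - (v x)\<^sup>2) \<le> (1/6 * u x ^ 6 - 1/4 * u x ^ 4) - (1/6 * v x ^ 6 - 1/4 * v x ^ 4)"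
          unfolding K_def v_def using density_truncation_gain[of "u x" M] H10_posD(2)[OF uH] M by simp
      qed (use iu iv in auto)
      also have "\<dots> = (1/6 * S - 1/4 * U4) - (1/6 * V6 - 1/4 * V4)"
        using iu iv by (simp add: S_def U4_def V6_def V4_def)
      finally show ?thesis .
    qed
    have "relaxed_energy u c \<le> relaxed_energy (\<lambda>x. sqrt T * v x) (T * c)" by (rule min[OF feas])
    then have "c / 2 - 1/4 * U4 + 1/6 * S \<le> T * c / 2 - 1/4 * (T\<^sup>2 * V4) + 1/6 * (T ^ 3 * V6)"
      by (simp add: relaxed_energy_def power_mult_distrib sT U4_def S_def V4_def V6_def)
    \<comment> \<open>The quartic term has a negative sign, so rescaling by T \<ge> 1 only helps
      there and its change is dropped.\<close>
    moreover have "V4 \<le> T\<^sup>2 * V4"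
    proof -
      have "1 \<le> T\<^sup>2" using T by (simp add: one_le_power)
      then show ?thesis using mult_right_mono[of 1 "T\<^sup>2" V4] V4 by simp
    qed
    moreover have "(T - 1) * c / 2 + 1/6 * ((T ^ 3 - 1) * V6) = T * c / 2 - c / 2 + 1/6 * (T ^ 3 * V6) - 1/6 * V6"
      by (simp add: algebra_simps diff_divide_distrib)
    ultimately have "K * \<delta> \<le> (T - 1) * c / 2 + 1/6 * ((T ^ 3 - 1) * V6)"
      using gain by linarith
    also have "(T ^ 3 - 1) * V6 \<le> (7 * (T - 1)) * S"
    proof (rule mult_mono)
      have "T ^ 3 - 1 = (T\<^sup>2 + T + 1) * (T - 1)" by (simp add: eval_nat_numeral algebra_simps)
      moreover have "T\<^sup>2 \<le> 2\<^sup>2" using T by (intro power_mono) auto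
      then have "(T\<^sup>2 + T + 1) * (T - 1) \<le> 7 * (T - 1)" using T by (intro mult_right_mono) auto
      ultimately show "T ^ 3 - 1 \<le> 7 * (T - 1)" by simp
    qed (use T V6 in auto)
    also have "(T - 1) * c / 2 + 1/6 * (7 * (T - 1) * S) = (T - 1) * (c / 2 + 7/6 * S)" by (simp add: field_simps)
    also have "\<dots> \<le> (2 / N * \<delta>) * (c / 2 + 7/6 * S)" using T1 c S by (intro mult_right_mono) auto
    also have "\<dots> = C * \<delta>" by (simp add: C_def)
    finally have "K * \<delta> \<le> C * \<delta>" by simp
    then show False using K \<delta>0 by simp
  qed
  then have "AE x in lborel. (u x)\<^sup>2 - (v x)\<^sup>2 = 0"
    unfolding \<delta>_def using vu2 iu iv by (subst (asm) integral_nonneg_eq_0_iff_AE) auto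
  then have "AE x in lborel. u x \<le> M"
  proof eventually_elim
    case (elim x)
    then have "u x = v x" using vu[of x] H10_posD(2)[OF uH, of x] by (simp add: power2_eq_iff_nonneg)
    then show ?case by (simp add: v_def)
  qed
  then show thesis using M by (intro that[of M]) auto
qed

section \<open>Symmetric minimisers on balls\<close>

text \<open>Polarization at most swaps the two values at x and its mirror image. Consequently the
  integral of any function of u is preserved.\<close>

lemma polarize_sum:
  fixes g :: "real \<Rightarrow> real"
  assumes n: "norm n = 1"
  shows "g (polarize n \<beta> u x) + g (polarize n \<beta> u (reflect n \<beta> x)) = g (u x) + g (u (reflect n \<beta> x))"
proof (cases "x \<bullet> n = \<beta>")
  case True
  then have "reflect n \<beta> x = x" by (simp add: reflect_def refl0_def)
  then show ?thesis by (simp add: polarize_def)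
next
  case False
  then show ?thesis
    by (auto simp: polarize_def reflect_inner[OF n] reflect_invol[OF n] max_def min_def)
qed

lemma integral_polarize:
  fixes u :: "'a::euclidean_space \<Rightarrow> real" and g :: "real \<Rightarrow> real"
  assumes n: "norm n = 1" and u [measurable]: "u \<in> borel_measurable borel" and g [measurable]: "g \<in> borel_measurable borel"
    and i: "integrable lborel (\<lambda>x. g (u x))" "integrable lborel (\<lambda>x. g (polarize n \<beta> u x))"
  shows "(\<integral>x. g (polarize n \<beta> u x) \<partial>lborel) = (\<integral>x. g (u x) \<partial>lborel)"
proof -
  let ?s = "reflect n \<beta>"
  have m: "(\<lambda>x. g (u x)) \<in> borel_measurable borel" "(\<lambda>x. g (polarize n \<beta> u x)) \<in> borel_measurable borel" by measurable
  have "(\<integral>x. g (polarize n \<beta> u x) + g (polarize n \<beta> u (?s x)) \<partial>lborel) = (\<integral>x. g (u x) + g (u (?s x)) \<partial>lborel)"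
    by (simp only: polarize_sum[OF n, of g \<beta> u])
  then show ?thesis
    using integral_reflect[OF n m(1), of \<beta>] integral_reflect[OF n m(2), of \<beta>] i
    by (simp add: Bochner_Integration.integral_add)
qed

lemma minimiser_polarize:
  fixes u :: "'a::euclidean_space \<Rightarrow> real"
  assumes dim: "DIM('a) \<in> {1, 2, 3}" and u: "minimiser (ball 0 R) N u c" and n: "norm n = 1" and \<beta>: "\<beta> > 0"
  shows "minimiser (ball 0 R) N (polarize n \<beta> u) c"
proof -
  have uH: "H10_pos (ball 0 R) u c" using u by (simp add: minimiser_def feasible_def)
  have pH: "H10_pos (ball 0 R) (polarize n \<beta> u) c" by (rule H10_pos_polarize[OF uH n \<beta>])
  note iu = H10_pos_integrable_powers[OF uH dim] and ip = H10_pos_integrable_powers[OF pH dim]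
  have "(\<integral>x. (polarize n \<beta> u x) ^ p \<partial>lborel) = (\<integral>x. u x ^ p \<partial>lborel)" if "p \<in> {2, 4, 6}" for p
    using that by (intro integral_polarize[OF n H10_posD(5)[OF uH], of "\<lambda>s. s ^ p"]) (use iu ip in auto)
  then show ?thesis using u pH by (simp add: minimiser_def feasible_def relaxed_energy_def)
qed

text \<open>Any strictly radially decreasing weight would do.\<close>

definition radial_weight :: "'a::euclidean_space \<Rightarrow> real" where
  "radial_weight x = exp (- (norm x)\<^sup>2)"

definition radial_mass :: "'a::euclidean_space set \<Rightarrow> ('a \<Rightarrow> real) \<Rightarrow> real" where
  "radial_mass D u = (\<integral>x. (indicator D x * radial_weight x) *\<^sub>R u x \<partial>lborel)"

lemma borel_measurable_radial_weight [measurable]: "radial_weight \<in> borel_measurable borel"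
  unfolding radial_weight_def[abs_def] by measurable

lemma radial_weight_bounds: "0 < radial_weight x" "radial_weight x \<le> 1"
  by (auto simp: radial_weight_def)

lemma sqint_radial_weight:
  fixes D :: "'a::euclidean_space set"
  assumes "open D" "bounded D"
  shows "sqint lborel (\<lambda>x. indicator D x * radial_weight x :: real)"
proof (rule sqint_bound[OF _ sqint_integrable[OF sqint_indicator_domain[OF assms]]])
  have [measurable]: "D \<in> sets borel" using assms(1) by simp
  show "(\<lambda>x. indicator D x * radial_weight x :: real) \<in> borel_measurable lborel" by measurable
  show "(norm (indicator D x * radial_weight x :: real))\<^sup>2 \<le> (norm (indicator D x :: real))\<^sup>2" for x
    using radial_weight_bounds[of x] by (auto simp: indicator_def intro!: power_le_one)
qed

text \<open>The difference \<delta> is odd under the reflection, so the integral of (w - w composed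
  with the reflection) \<delta> is twice that of w \<delta>, which is at most 0 by hypothesis. As w
  is strictly decreasing and \<beta> > 0, both factors are nonnegative on the origin's side and
  nonpositive beyond. The integrand therefore vanishes almost everywhere, and off the hyperplane its
  first factor is nonzero.\<close>

lemma polarize_fixed:
  fixes u :: "'a::euclidean_space \<Rightarrow> real"
  assumes u: "H10_pos (ball 0 R) u c" and n: "norm n = 1" and \<beta>: "\<beta> > 0"
    and le: "radial_mass (ball 0 R) (polarize n \<beta> u) \<le> radial_mass (ball 0 R) u"
  shows "AE x in lborel. polarize n \<beta> u x = u x"
proof -
  let ?s = "reflect n \<beta>" and ?B = "ball (0::'a) R"
  have pH: "H10_pos ?B (polarize n \<beta> u) c" by (rule H10_pos_polarize[OF u n \<beta>])
  define \<delta> where "\<delta> x = polarize n \<beta> u x - u x" for x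
  note [measurable] = H10_posD(5)[OF u] H10_posD(5)[OF pH]
  have [measurable]: "\<delta> \<in> borel_measurable borel" unfolding \<delta>_def[abs_def] by measurable
  have sw: "sqint lborel (\<lambda>x. indicator ?B x * radial_weight x :: real)" by (rule sqint_radial_weight) auto
  have eqp: "(\<lambda>x. (indicator ?B x * radial_weight x) *\<^sub>R polarize n \<beta> u x) = (\<lambda>x. radial_weight x * polarize n \<beta> u x)"
  proof
    fix x
    show "(indicator ?B x * radial_weight x) *\<^sub>R polarize n \<beta> u x = radial_weight x * polarize n \<beta> u x"
      using H10_posD(3)[OF pH, of x] by (cases "x \<in> ?B") auto
  qed
  have equ: "(\<lambda>x. (indicator ?B x * radial_weight x) *\<^sub>R u x) = (\<lambda>x. radial_weight x * u x)"
  proof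
    fix x
    show "(indicator ?B x * radial_weight x) *\<^sub>R u x = radial_weight x * u x"
      using H10_posD(3)[OF u, of x] by (cases "x \<in> ?B") auto
  qed
  have ip: "integrable lborel (\<lambda>x. radial_weight x * polarize n \<beta> u x)"
    using sqint_integrable_product[OF sw H10_posD(4)[OF pH]] by (simp only: eqp)
  have iu: "integrable lborel (\<lambda>x. radial_weight x * u x)"
    using sqint_integrable_product[OF sw H10_posD(4)[OF u]] by (simp only: equ)
  have i: "integrable lborel (\<lambda>x. radial_weight x * \<delta> x)"
    using Bochner_Integration.integrable_diff[OF ip iu] by (simp add: \<delta>_def right_diff_distrib)
  have J: "(\<integral>x. radial_weight x * \<delta> x \<partial>lborel) \<le> 0"
    using le Bochner_Integration.integral_diff[OF ip iu]
    unfolding radial_mass_def eqp equ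
    by (simp add: \<delta>_def right_diff_distrib)
  have odd: "\<delta> (?s x) = - \<delta> x" for x
    using polarize_sum[OF n, of "\<lambda>t. t" \<beta> u x] by (simp add: \<delta>_def)
  have m: "(\<lambda>x. radial_weight x * \<delta> x) \<in> borel_measurable borel" by measurable
  have i2: "integrable lborel (\<lambda>x. radial_weight (?s x) * \<delta> x)"
    using integral_reflect(2)[OF n m, of \<beta>] i by (simp add: odd)
  have "(\<integral>x. radial_weight (?s x) * \<delta> x \<partial>lborel) = - (\<integral>x. radial_weight x * \<delta> x \<partial>lborel)"
    using integral_reflect(1)[OF n m, of \<beta>] by (simp add: odd)
  then have I: "(\<integral>x. (radial_weight x - radial_weight (?s x)) * \<delta> x \<partial>lborel) \<le> 0"
    using J i i2 by (simp add: left_diff_distrib)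
  have ii: "integrable lborel (\<lambda>x. (radial_weight x - radial_weight (?s x)) * \<delta> x)"
    using i i2 by (simp add: left_diff_distrib)
  have wlt: "radial_weight (?s x) < radial_weight x" if "x \<bullet> n < \<beta>" for x
    using that \<beta> by (simp add: radial_weight_def reflect_norm_sq[OF n])
  have wgt: "radial_weight x < radial_weight (?s x)" if "\<beta> < x \<bullet> n" for x
    using that \<beta> by (simp add: radial_weight_def reflect_norm_sq[OF n] mult_pos_neg)
  have \<delta>pos: "0 \<le> \<delta> x" if "x \<bullet> n < \<beta>" for x using that by (simp add: \<delta>_def polarize_def)
  have \<delta>neg: "\<delta> x \<le> 0" if "\<not> x \<bullet> n < \<beta>" for x using that by (simp add: \<delta>_def polarize_def)
  have \<delta>0: "\<delta> x = 0" if "x \<bullet> n = \<beta>" for x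
    using that by (simp add: \<delta>_def polarize_def reflect_def refl0_def)
  have nn: "0 \<le> (radial_weight x - radial_weight (?s x)) * \<delta> x" for x
  proof -
    consider "x \<bullet> n < \<beta>" | "\<beta> < x \<bullet> n" | "x \<bullet> n = \<beta>" by linarith
    then show ?thesis
    proof cases
      case 1 then show ?thesis using wlt[of x] \<delta>pos[of x] by simp
    next
      case 2 then show ?thesis using wgt[of x] \<delta>neg[of x] by (intro mult_nonpos_nonpos) auto
    qed (simp add: \<delta>0)
  qed
  have "(\<integral>x. (radial_weight x - radial_weight (?s x)) * \<delta> x \<partial>lborel) = 0"
    using I nn by (intro antisym integral_nonneg_AE) auto
  then have "AE x in lborel. (radial_weight x - radial_weight (?s x)) * \<delta> x = 0"
    using ii nn by (subst (asm) integral_nonneg_eq_0_iff_AE) auto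
  then show ?thesis
  proof eventually_elim
    case (elim x)
    consider "x \<bullet> n < \<beta>" | "\<beta> < x \<bullet> n" | "x \<bullet> n = \<beta>" by linarith
    then have "\<delta> x = 0"
    proof cases
      case 1 then show ?thesis using elim wlt[of x] by simp
    next
      case 2 then show ?thesis using elim wgt[of x] by simp
    qed (simp add: \<delta>0)
    then show ?case by (simp add: \<delta>_def)
  qed
qed

text \<open>The radial mass is continuous in L^2, and minimisers form a compact set: apply
  \<open>feasible_compact\<close> with the minimal energy as a constant bound.\<close>

lemma radial_mass_maximiser:
  fixes D :: "'a::euclidean_space set"
  assumes dim: "DIM('a) \<in> {1, 2, 3}" and D: "open D" "bounded D" "D \<noteq> {}" and N: "N > 0"
  obtains u c where "minimiser D N u c" "\<And>v d. minimiser D N v d \<Longrightarrow> radial_mass D v \<le> radial_mass D u"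
proof -
  define S where "S = {radial_mass D v |v d. minimiser D N v d}"
  obtain u0 c0 where m0: "minimiser D N u0 c0" by (rule minimiser_exists[OF dim D N]) (rule that)
  then have ne: "S \<noteq> {}" by (auto simp: S_def)
  note sw = sqint_radial_weight[OF D(1,2)]
  have mH: "H10_pos D v d" and mN: "(\<integral>x. (v x)\<^sup>2 \<partial>lborel) = N" if "minimiser D N v d" for v d
    using that by (auto simp: minimiser_def feasible_def)
  have "s \<le> l2 lborel (\<lambda>x. indicator D x * radial_weight x :: real) * sqrt N" if s: "s \<in> S" for s
  proof -
    obtain v d where v: "s = radial_mass D v" "minimiser D N v d" using s by (auto simp: S_def)
    show ?thesis
      using l2_product_bound[OF sw H10_posD(4)[OF mH[OF v(2)]]] mN[OF v(2)] v(1)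
      by (simp add: radial_mass_def l2_def)
  qed
  then have bdd: "bdd_above S" by (rule bdd_aboveI)
  have "\<exists>v d. minimiser D N v d \<and> Sup S - 1 / real (Suc k) < radial_mass D v" for k
    using less_cSup_iff[OF ne bdd, of "Sup S - 1 / real (Suc k)"] unfolding S_def by auto
  then obtain v d where v: "\<And>k. minimiser D N (v k) (d k)" "\<And>k. Sup S - 1 / real (Suc k) < radial_mass D (v k)"
    by metis
  have fv: "feasible D N (v k) (d k)" for k using v(1) by (simp add: minimiser_def)
  have same: "relaxed_energy (v k) (d k) \<le> relaxed_energy u0 c0" for k
    using v(1)[of k] m0 by (simp add: minimiser_def)
  obtain k w e where k: "strict_mono (k :: nat \<Rightarrow> nat)" "feasible D N w e"
    "(\<lambda>n. l2 lborel (\<lambda>x. v (k n) x - w x)) \<longlonglongrightarrow> 0" "relaxed_energy w e \<le> relaxed_energy u0 c0"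
    by (rule feasible_compact[OF dim D(1,2) fv same tendsto_const]) (rule that)
  have mw: "minimiser D N w e"
    using k(2,4) m0 by (auto simp: minimiser_def intro: order_trans)
  have "(\<lambda>n. radial_mass D (v (k n))) \<longlonglongrightarrow> radial_mass D w"
    unfolding radial_mass_def by (rule l2_product_tendsto[OF sw H10_posD(4)[OF mH[OF v(1)]] H10_posD(4)[OF mH[OF mw]] k(3)])
  moreover have "(\<lambda>n. Sup S - 1 / real (Suc (k n))) \<longlonglongrightarrow> Sup S - 0"
    by (intro tendsto_intros LIMSEQ_subseq_LIMSEQ[OF LIMSEQ_Suc[OF lim_1_over_n] k(1), unfolded o_def])
  ultimately have "Sup S - 0 \<le> radial_mass D w"
    by (intro LIMSEQ_le[of "\<lambda>n. Sup S - 1 / real (Suc (k n))" "Sup S - 0" "\<lambda>n. radial_mass D (v (k n))"])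
      (use v(2) in \<open>auto intro!: less_imp_le simp del: of_nat_Suc\<close>)
  moreover have "radial_mass D v \<le> Sup S" if "minimiser D N v d" for v d
    by (rule cSup_upper[OF _ bdd]) (use that in \<open>auto simp: S_def\<close>)
  ultimately have "radial_mass D v \<le> radial_mass D w" if "minimiser D N v d" for v d
    using that by force
  with mw show thesis by (rule that)
qed

section \<open>Functions invariant under all polarizations\<close>

lemma AE_shift:
  fixes x :: "'a::euclidean_space" and P :: "'a \<Rightarrow> bool"
  assumes "AE y in lborel. P y" shows "AE z in lborel. P (x + z)"
proof -
  have "AE y in distr lborel borel ((+) x). P y" unfolding lborel_distr_plus by (rule assms)
  then show ?thesis by (rule AE_distrD[rotated]) simp
qed

text \<open>The ball of radius r about x stays on the side of the hyperplane where v dominates its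
  mirror image almost everywhere, and reflection carries it to the ball about the reflected point.
  The null set is absorbed by the integral, so the inequality holds at each such x.\<close>

lemma ball_avg_reflect_le:
  fixes v :: "'a::euclidean_space \<Rightarrow> real"
  assumes n: "norm n = 1" and v: "sqint lborel v" and AE: "AE x in lborel. polarize n \<beta> v x = v x"
    and r: "r > 0" "r \<le> \<beta> - x \<bullet> n"
  shows "ball_avg r v (reflect n \<beta> x) \<le> ball_avg r v x"
proof -
  let ?s = "reflect n \<beta>" and ?V = "measure lborel (ball (0::'a) r)"
  have [measurable]: "v \<in> borel_measurable borel" using sqint_borel[OF v] by simp
  have [measurable]: "ball (0::'a) r \<in> sets borel" by simp
  have sh: "sqint lborel (\<lambda>z. v (y + z))" for y using sqint_shift(1)[OF v, of y] by (simp add: add.commute)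
  have m: "(\<lambda>z. indicator (ball 0 r) z *\<^sub>R v (?s x + z)) \<in> borel_measurable borel" by measurable
  have i1: "integrable lborel (\<lambda>z. indicator (ball 0 r) z *\<^sub>R v (?s x + z))" "integrable lborel (\<lambda>z. indicator (ball 0 r) z *\<^sub>R v (x + z))"
    by (rule sqint_integrable_product[OF sqint_ball sh])+
  have e: "indicator (ball 0 r) (reflect n 0 z) *\<^sub>R v (?s x + reflect n 0 z) = indicator (ball 0 r) z *\<^sub>R v (?s (x + z))" for z
  proof -
    have "?s x + reflect n 0 z = ?s (x + z)" by (simp add: reflect_def refl0_add)
    moreover have "norm (reflect n 0 z) = norm z" by (simp add: reflect_def norm_refl0[OF n])
    ultimately show ?thesis by (simp add: indicator_def)
  qed
  have "(\<integral>z. indicator (ball 0 r) z *\<^sub>R v (?s x + z) \<partial>lborel) = (\<integral>z. indicator (ball 0 r) z *\<^sub>R v (?s (x + z)) \<partial>lborel)"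
    using integral_reflect(1)[OF n m, of 0] by (simp only: e)
  also have "\<dots> \<le> (\<integral>z. indicator (ball 0 r) z *\<^sub>R v (x + z) \<partial>lborel)"
  proof (rule integral_mono_AE)
    show "integrable lborel (\<lambda>z. indicator (ball 0 r) z *\<^sub>R v (?s (x + z)))"
      using integral_reflect(2)[OF n m, of 0] i1(1) by (simp only: e)
    show "AE z in lborel. indicator (ball 0 r) z *\<^sub>R v (?s (x + z)) \<le> indicator (ball 0 r) z *\<^sub>R v (x + z)"
      using AE_shift[OF AE, of x]
    proof eventually_elim
      case (elim z)
      show ?case
      proof (cases "z \<in> ball 0 r")
        case True
        have "z \<bullet> n \<le> norm z" using norm_cauchy_schwarz[of z n] n by simp
        then have "(x + z) \<bullet> n < \<beta>" using True r by (simp add: inner_add_left)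
        then have "v (?s (x + z)) \<le> v (x + z)" using elim by (simp add: polarize_def max_def split: if_splits)
        then show ?thesis using True by simp
      qed simp
    qed
  qed (rule i1)
  finally show ?thesis unfolding ball_avg_def by (intro divide_right_mono) auto
qed

text \<open>The hyperplane is the perpendicular bisector of x and y; the origin lies strictly on the
  side of x because x has the smaller norm.\<close>

lemma reflect_between:
  fixes x y :: "'a::euclidean_space"
  assumes "norm x < norm y"
  obtains n \<beta> where "norm n = 1" "\<beta> > 0" "reflect n \<beta> x = y" "\<beta> - x \<bullet> n = norm (y - x) / 2"
proof -
  define l where "l = norm (y - x)"
  have l: "l > 0" using assms by (auto simp: l_def)
  define n where "n = (1 / l) *\<^sub>R (y - x)"
  define \<beta> where "\<beta> = ((norm y)\<^sup>2 - (norm x)\<^sup>2) / (2 * l)"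
  have n: "norm n = 1" using l by (simp add: n_def l_def)
  have "(norm x)\<^sup>2 < (norm y)\<^sup>2" using assms by (intro power_strict_mono) auto
  then have \<beta>: "\<beta> > 0" using l by (simp add: \<beta>_def)
  have l2: "l\<^sup>2 = (norm y)\<^sup>2 - (norm x)\<^sup>2 - 2 * (x \<bullet> (y - x))"
    by (simp add: l_def power2_norm_eq_inner inner_diff_left inner_diff_right inner_commute)
  have "x \<bullet> n = (x \<bullet> (y - x)) / l" by (simp add: n_def)
  then have "\<beta> - x \<bullet> n = ((norm y)\<^sup>2 - (norm x)\<^sup>2 - 2 * (x \<bullet> (y - x))) / (2 * l)"
    using l by (simp add: \<beta>_def field_simps)
  also have "\<dots> = l / 2" using l unfolding l2[symmetric] by (simp add: power2_eq_square)
  finally have d: "\<beta> - x \<bullet> n = l / 2" .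
  have "reflect n \<beta> x = x + (2 * (\<beta> - x \<bullet> n)) *\<^sub>R n" by (simp add: reflect_def refl0_def algebra_simps)
  also have "(2 * (\<beta> - x \<bullet> n)) *\<^sub>R n = y - x" unfolding d using l by (simp add: n_def)
  finally have "reflect n \<beta> x = y" by simp
  then show thesis using n \<beta> d by (intro that) (auto simp: l_def)
qed

text \<open>For equal norms the bisector passes through the origin, where \<beta> = 0. Therefore y
  is first stretched to a point of larger norm, and continuity of the averages lets the stretching
  tend to 0.\<close>

lemma ball_avg_radial_mono:
  fixes v :: "'a::euclidean_space \<Rightarrow> real"
  assumes v: "H10_le D v c" and AE: "\<And>n \<beta>. norm n = 1 \<Longrightarrow> \<beta> > 0 \<Longrightarrow> AE x in lborel. polarize n \<beta> v x = v x"
    and xy: "norm x \<le> norm y" "x \<noteq> y" and r: "r > 0" "r < norm (y - x) / 2"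
  shows "ball_avg r v y \<le> ball_avg r v x"
proof -
  have strict: "ball_avg r v z \<le> ball_avg r v x" if z: "norm x < norm z" "r \<le> norm (z - x) / 2" for z
  proof -
    obtain n \<beta> where n: "norm n = 1" "\<beta> > 0" "reflect n \<beta> x = z" "\<beta> - x \<bullet> n = norm (z - x) / 2"
      by (rule reflect_between[OF z(1)]) (rule that)
    show ?thesis using ball_avg_reflect_le[OF n(1) H10_le_sqint[OF v] AE[OF n(1,2)] r(1), of x] n z(2) by simp
  qed
  have y: "y \<noteq> 0" using xy by auto
  let ?y = "\<lambda>k. y + (1 / real (Suc k)) *\<^sub>R y"
  have ly: "?y \<longlonglongrightarrow> y + 0 *\<^sub>R y" by (intro tendsto_intros LIMSEQ_Suc[OF lim_1_over_n])
  then have ly: "?y \<longlonglongrightarrow> y" by simp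
  have ny: "norm x < norm (?y k)" for k
  proof -
    have "?y k = (1 + 1 / real (Suc k)) *\<^sub>R y" by (simp add: scaleR_add_left)
    then have "norm (?y k) = (1 + 1 / real (Suc k)) * norm y" by (simp only: norm_scaleR) (simp del: of_nat_Suc)
    moreover have "1 / real (Suc k) * norm y > 0" using y by simp
    ultimately show ?thesis using xy(1) by (simp add: distrib_right)
  qed
  have "(\<lambda>k. norm (?y k - x) / 2) \<longlonglongrightarrow> norm (y - x) / 2" by (intro tendsto_intros ly) simp
  then have "\<forall>\<^sub>F k in sequentially. r < norm (?y k - x) / 2" by (rule order_tendstoD(1)[OF _ r(2)])
  then have ev: "\<forall>\<^sub>F k in sequentially. ball_avg r v (?y k) \<le> ball_avg r v x"
    by eventually_elim (rule strict[OF ny], simp)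
  define L where "L = sqrt c / sqrt (measure lborel (ball (0::'a) r))"
  have "(\<lambda>k. ball_avg r v (?y k) - ball_avg r v y) \<longlonglongrightarrow> 0"
  proof (rule Lim_null_comparison)
    show "\<forall>\<^sub>F k in sequentially. norm (ball_avg r v (?y k) - ball_avg r v y) \<le> norm (?y k - y) * L"
      unfolding real_norm_def L_def by (intro always_eventually allI ball_avg_lipschitz[OF v r(1)])
    have "(\<lambda>k. norm (?y k - y) * L) \<longlonglongrightarrow> norm (y - y) * L" by (intro tendsto_intros ly)
    then show "(\<lambda>k. norm (?y k - y) * L) \<longlonglongrightarrow> 0" by simp
  qed
  then have "(\<lambda>k. ball_avg r v (?y k)) \<longlonglongrightarrow> ball_avg r v y" by (simp add: LIM_zero_iff)
  then show ?thesis by (rule tendsto_upperbound[OF _ ev]) simp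
qed

text \<open>On the set X where the averages converge to v, monotonicity of the averages passes to v.
  The complement of X is the only null set left, and a monotone profile in the norm extends v from X
  to the whole space.\<close>

lemma radial_representative:
  fixes v :: "'a::euclidean_space \<Rightarrow> real"
  assumes v: "H10_pos (ball 0 R) v c" and AE: "\<And>n \<beta>. norm n = 1 \<Longrightarrow> \<beta> > 0 \<Longrightarrow> AE x in lborel. polarize n \<beta> v x = v x"
    and M: "\<And>x. v x \<le> M"
  obtains g where "g \<in> borel_measurable borel" "AE x in lborel. v x = g x" "\<And>x. 0 \<le> g x"
    "\<And>x. x \<notin> ball 0 R \<Longrightarrow> g x = 0" "\<And>x y. norm x \<le> norm y \<Longrightarrow> g y \<le> g x"
proof -
  note vH = H10_posD(1)[OF v] and v0 = H10_posD(2)[OF v] and vout = H10_posD(3)[OF v] and sv = H10_posD(4)[OF v]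
  let ?r = "\<lambda>k. 1 / real (Suc k)"
  have rk: "?r k > 0" for k by simp
  have lim0: "(\<lambda>k. l2 lborel (\<lambda>x. ball_avg (?r k) v x - v x)) \<longlonglongrightarrow> 0"
  proof (rule Lim_null_comparison)
    show "\<forall>\<^sub>F k in sequentially. norm (l2 lborel (\<lambda>x. ball_avg (?r k) v x - v x)) \<le> ?r k * sqrt c"
      using ball_avg_approx(2)[OF vH rk] by (intro always_eventually allI) (simp del: of_nat_Suc)
    show "(\<lambda>k. ?r k * sqrt c) \<longlonglongrightarrow> 0" by (rule tendsto_mult_left_zero[OF LIMSEQ_Suc[OF lim_1_over_n]])
  qed
  obtain s :: "nat \<Rightarrow> nat" where s: "strict_mono s" "AE x in lborel. (\<lambda>k. ball_avg (?r (s k)) v x) \<longlonglongrightarrow> v x"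
    by (rule l2_AE_subseq[OF ball_avg_approx(1)[OF vH rk] sv lim0]) (rule that)
  define X where "X = {x. (\<lambda>k. ball_avg (?r (s k)) v x) \<longlonglongrightarrow> v x}"
  have mono: "v y \<le> v x" if "x \<in> X" "y \<in> X" "norm x \<le> norm y" for x y
  proof (cases "x = y")
    case False
    have "(\<lambda>k. ?r (s k)) \<longlonglongrightarrow> 0"
      using LIMSEQ_subseq_LIMSEQ[OF LIMSEQ_Suc[OF lim_1_over_n] s(1)] by (simp add: o_def)
    then have "\<forall>\<^sub>F k in sequentially. ?r (s k) < norm (y - x) / 2"
      by (rule order_tendstoD(2)) (use False in simp)
    then have ev: "\<forall>\<^sub>F k in sequentially. ball_avg (?r (s k)) v y \<le> ball_avg (?r (s k)) v x"
      by eventually_elim (rule ball_avg_radial_mono[OF vH AE that(3) False rk])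
    show ?thesis
      using that(1,2) by (intro tendsto_le[OF sequentially_bot _ _ ev]) (auto simp: X_def)
  qed simp
  \<comment> \<open>The inserted 0 gives G a value where no point of X is far enough out; it also
    yields G \<ge> 0 and makes G vanish beyond the ball.\<close>
  define G where "G t = Sup (insert 0 {v y |y. y \<in> X \<and> t \<le> norm y})" for t
  have bdd: "bdd_above (insert 0 {v y |y. y \<in> X \<and> t \<le> norm y})" for t
    using M by (intro bdd_aboveI[of _ "max 0 M"]) (auto simp: le_max_iff_disj)
  have anti: "G t \<le> G t'" if "t' \<le> t" for t t'
    unfolding G_def by (rule cSup_subset_mono[OF _ bdd]) (use that in auto)
  have G0: "0 \<le> G t" for t unfolding G_def by (rule cSup_upper[OF _ bdd]) simp
  show thesis
  proof (rule that[of "\<lambda>x. G (norm x)"])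
    have "mono (\<lambda>t. - G t)" by (rule monoI) (use anti in simp)
    then have "(\<lambda>t. - G t) \<in> borel_measurable borel" by (rule borel_measurable_mono)
    from borel_measurable_uminus[OF this] have [measurable]: "G \<in> borel_measurable borel" by simp
    show "(\<lambda>x::'a. G (norm x)) \<in> borel_measurable borel" by measurable
    show "AE x in lborel. v x = G (norm x)"
      using s(2)
    proof eventually_elim
      case (elim x)
      then have x: "x \<in> X" by (simp add: X_def)
      show ?case
        unfolding G_def
        by (rule cSup_eq_maximum[symmetric]) (use x v0 mono[OF x] in auto)
    qed
    show "G (norm x) = 0" if "x \<notin> ball 0 R" for x
    proof -
      have "v y = 0" if "norm x \<le> norm y" for y by (rule vout) (use that \<open>x \<notin> ball 0 R\<close> in auto)
      then have "insert 0 {v y |y. y \<in> X \<and> norm x \<le> norm y} = {0}" by auto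
      then show ?thesis unfolding G_def by (simp only: cSup_singleton)
    qed
    show "0 \<le> G (norm x)" for x by (rule G0)
    show "G (norm y) \<le> G (norm x)" if "norm x \<le> norm y" for x y :: 'a by (rule anti[OF that])
  qed
qed

lemma radial_minimiser_exists:
  assumes dim: "DIM('a::euclidean_space) \<in> {1, 2, 3}" and R: "R > 0" and N: "N > 0"
  obtains g :: "'a::euclidean_space \<Rightarrow> real" and c where "minimiser (ball 0 R) N g c" "\<And>x y. norm x \<le> norm y \<Longrightarrow> g y \<le> g x"
proof -
  let ?B = "ball (0::'a) R"
  have B: "open ?B" "bounded ?B" "?B \<noteq> {}" using R by auto
  obtain u c where u: "minimiser ?B N u c" "\<And>v d. minimiser ?B N v d \<Longrightarrow> radial_mass ?B v \<le> radial_mass ?B u"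
    by (rule radial_mass_maximiser[OF dim B N]) (rule that)
  obtain M where M: "M \<ge> 0" "AE x in lborel. u x \<le> M" by (rule minimiser_bounded[OF dim B(1,2) N u(1)]) (rule that)
  \<comment> \<open>Truncation turns the almost everywhere bound into one at every point, so the
    supremum defining the profile is finite even at radius 0.\<close>
  define v where "v x = min (u x) M" for x
  have uH: "H10_pos ?B u c" using u(1) by (simp add: minimiser_def feasible_def)
  note [measurable] = H10_posD(5)[OF uH]
  have vm [measurable]: "v \<in> borel_measurable borel" unfolding v_def[abs_def] by measurable
  have uv: "AE x in lborel. u x = v x" using M(2) by eventually_elim (simp add: v_def)
  have mv: "minimiser ?B N v c"
    by (rule minimiser_cong_AE[OF u(1) vm _ _ uv]) (use H10_posD(2,3)[OF uH] M(1) in \<open>auto simp: v_def\<close>)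
  have [measurable]: "?B \<in> sets borel" by simp
  have "radial_mass ?B u = radial_mass ?B v"
    unfolding radial_mass_def by (rule integral_cong_AE) (use uv in auto)
  then have max: "radial_mass ?B w \<le> radial_mass ?B v" if "minimiser ?B N w d" for w d using u(2)[OF that] by simp
  have vH: "H10_pos ?B v c" using mv by (simp add: minimiser_def feasible_def)
  have fixed: "AE x in lborel. polarize n \<beta> v x = v x" if "norm n = 1" "\<beta> > 0" for n \<beta>
    by (rule polarize_fixed[OF vH that max[OF minimiser_polarize[OF dim mv that]]])
  obtain g where g: "g \<in> borel_measurable borel" "AE x in lborel. v x = g x" "\<And>x. 0 \<le> g x"
    "\<And>x. x \<notin> ?B \<Longrightarrow> g x = 0" "\<And>x y. norm x \<le> norm y \<Longrightarrow> g y \<le> g x"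
    by (rule radial_representative[OF vH fixed, of M]) (auto simp: v_def intro: that)
  show thesis by (rule that[OF minimiser_cong_AE[OF mv g(1,3,4,2)] g(5)])
qed

theorem theorem1p1:
  fixes D :: "'a::euclidean_space set" and N :: real
  assumes "DIM('a) \<in> {1, 2, 3}"
    and "open D" and "connected D" and "D \<noteq> {}" and "bounded D"
    and "N > 0"
  shows "(\<exists>u :: 'a \<Rightarrow> real.
            ground_state D N (\<lambda>x. complex_of_real (u x)) \<and> (\<forall>x\<in>D. 0 \<le> u x)) \<and>
         ((\<exists>R>0. D = ball 0 R) \<longrightarrow>
          (\<exists>u :: 'a \<Rightarrow> real.
            ground_state D N (\<lambda>x. complex_of_real (u x)) \<and> (\<forall>x\<in>D. 0 \<le> u x) \<and>
            radially_symmetric_on D u \<and> radially_decreasing_on D u))"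
proof (intro conjI impI)
  have nonneg: "0 \<le> u x" if "minimiser D N u c" for u c x
    using that H10_posD(2) by (auto simp: minimiser_def feasible_def)
  obtain u c where u: "minimiser D N u c"
    by (rule minimiser_exists[OF assms(1,2,5,4,6)]) (rule that)
  show "\<exists>u. ground_state D N (\<lambda>x. complex_of_real (u x)) \<and> (\<forall>x\<in>D. 0 \<le> u x)"
    using minimiser_ground_state[OF assms(2,5) u] nonneg[OF u] by blast
  assume "\<exists>R>0. D = ball 0 R"
  then obtain R where R: "R > 0" "D = ball 0 R" by blast
  obtain g :: "'a \<Rightarrow> real" and d where g: "minimiser (ball 0 R) N g d" "\<And>x y. norm x \<le> norm y \<Longrightarrow> g y \<le> g x"
    by (rule radial_minimiser_exists[OF assms(1) R(1) assms(6)]) (rule that)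
  have gD: "minimiser D N g d" using g(1) R(2) by simp
  have "radially_decreasing_on D g" using g(2) by (simp add: radially_decreasing_on_def)
  moreover have "radially_symmetric_on D g"
    unfolding radially_symmetric_on_def using g(2) by (metis antisym order_refl)
  ultimately show "\<exists>u. ground_state D N (\<lambda>x. complex_of_real (u x)) \<and> (\<forall>x\<in>D. 0 \<le> u x) \<and>
      radially_symmetric_on D u \<and> radially_decreasing_on D u"
    using minimiser_ground_state[OF assms(2,5) gD] nonneg[OF gD] by blast
qed

end
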